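(* Let $\Gamma_1$ and $\Gamma_2$ be two affine semigroups in $\mathbb{N}^r$ and let $\Gamma=\Gamma_1\sqcup\Gamma_2$ be the join of $\Gamma_1$ and $\Gamma_2$. Then $\Gamma$ has a strongly indispensable minimal free resolution (SIFR) if and only if $\Gamma_1$ and $\Gamma_2$ have SIFRs.
   Context: $\mathbb{N}$ denotes the non-negative integers and $\mathbb{K}$ a field. Join: let $\Gamma_1,\Gamma_2\subset\mathbb{N}^r$ be affine semigroups (finitely generated submonoids) of dimensions $r_1$ and $r_2$, minimally generated by disjoint sets $\mathcal{G}_1=\{\mathbf{a}_1,\dots,\mathbf{a}_{r_1},\dots,\mathbf{a}_{r_1+n_1}\}$ and $\mathcal{G}_2=\{\mathbf{b}_1,\dots,\mathbf{b}_{r_2},\dots,\mathbf{b}_{r_2+n_2}\}$, with sets of extremal rays $E_{\Gamma_1}=\{\mathbf{a}_1,\dots,\mathbf{a}_{r_1}\}$ and $E_{\Gamma_2}=\{\mathbf{b}_1,\dots,\mathbf{b}_{r_2}\}$ respectively (so every element of $\Gamma_i$ is a non-negative rational combination of the elements of $E_{\Gamma_i}$). Assume that $\{\mathbf{a}_1,\dots,\mathbf{a}_{r_1},\mathbf{b}_1,\dots,\mathbf{b}_{r_2}\}$ is linearly independent over $\mathbb{Q}$. Then the affine semigroup $\Gamma_1\sqcup\Gamma_2=\langle\mathcal{G}_1\cup\mathcal{G}_2\rangle$ is called the join of $\Gamma_1$ and $\Gamma_2$; $\mathcal{G}_1\cup\mathcal{G}_2$ is a minimal generating set of it. Semigroup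 ring: for an affine semigroup $\Gamma$ minimally generated by $\mathbf{c}_1,\dots,\mathbf{c}_m$, let $R=\mathbb{K}[z_1,\dots,z_m]$, graded by $\Gamma$ via $\deg z_i=\mathbf{c}_i$; $\mathbb{K}[\Gamma]$ is a $\Gamma$-graded $R$-module via $z_i\mapsto\mathbf{x}^{\mathbf{c}_i}$. All resolutions are $\Gamma$-graded minimal free $R$-resolutions of $\mathbb{K}[\Gamma]$ (for each semigroup in question, over its own polynomial ring and with its own grading), with chosen homogeneous bases of the free modules. SIFR: a graded minimal free resolution $(\mathbf{F},\phi)$ of $\mathbb{K}[\Gamma]$ is called strongly indispensable if for any graded minimal free resolution $(\mathbf{G},\theta)$ of $\mathbb{K}[\Gamma]$ there is an injective complex map $i:(\mathbf{F},\phi)\to(\mathbf{G},\theta)$, where such a map sends each basis element of $F_j$ to a nonzero scalar multiple (scalar in $\mathbb{K}$) of a basis element of $G_j$. When such a resolution $(\mathbf{F},\phi)$ exists, $\Gamma$ (or $\mathbb{K}[\Gamma]$) is said to have a SIFR. *)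

theory Defs
  imports "HOL-Analysis.Cartesian_Space" "HOL-Library.Poly_Mapping"
begin

section \<open>Affine semigroups in \<open>\<nat>\<^sup>r\<close>\<close>

inductive_set monoid_span :: "(nat ^ 'r) set \<Rightarrow> (nat ^ 'r) set" for G where
  zero: "0 \<in> monoid_span G"
| add: "a \<in> G \<Longrightarrow> x \<in> monoid_span G \<Longrightarrow> a + x \<in> monoid_span G"

definition affine_semigroup :: "(nat ^ 'r) set \<Rightarrow> bool" where
  "affine_semigroup \<Gamma> \<longleftrightarrow> (\<exists>G. finite G \<and> \<Gamma> = monoid_span G)"

definition minimally_generates :: "(nat ^ 'r) set \<Rightarrow> (nat ^ 'r) set \<Rightarrow> bool" where
  "minimally_generates G \<Gamma> \<longleftrightarrow>
     finite G \<and> monoid_span G = \<Gamma> \<and> (\<forall>H. H \<subset> G \<longrightarrow> monoid_span H \<noteq> \<Gamma>)"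

definition rat_vec :: "nat ^ 'r \<Rightarrow> rat ^ 'r" where
  "rat_vec a = (\<chi> i. of_nat (a $ i))"

definition semigroup_dim :: "(nat ^ 'r) set \<Rightarrow> nat" where
  "semigroup_dim \<Gamma> = vec.dim (rat_vec ` \<Gamma>)"

definition rat_cone :: "(nat ^ 'r) set \<Rightarrow> (rat ^ 'r) set" where
  "rat_cone A = {(\<Sum>a\<in>S. q a *s rat_vec a) | S q. finite S \<and> S \<subseteq> A \<and> (\<forall>a\<in>S. 0 \<le> q a)}"

text \<open>
  An extremal ray of the cone is a one-dimensional face. As usual for affine semigroups, it is
  represented by the componentwise smallest nonzero element of the semigroup lying on it; such an
  element belongs to every generating set.
\<close>

definition extremal_rays :: "(nat ^ 'r) set \<Rightarrow> (nat ^ 'r) set" where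
  "extremal_rays \<Gamma> = {a \<in> \<Gamma>. a \<noteq> 0 \<and>
     (\<forall>u\<in>rat_cone \<Gamma>. \<forall>v\<in>rat_cone \<Gamma>. u + v \<in> rat_cone {a} \<longrightarrow> u \<in> rat_cone {a} \<and> v \<in> rat_cone {a}) \<and>
     (\<forall>b\<in>\<Gamma>. b \<noteq> 0 \<longrightarrow> rat_vec b \<in> rat_cone {a} \<longrightarrow> (\<forall>i. a $ i \<le> b $ i))}"

definition is_join :: "(nat ^ 'r) set \<Rightarrow> (nat ^ 'r) set \<Rightarrow> (nat ^ 'r) set \<Rightarrow> bool" where
  "is_join \<Gamma>1 \<Gamma>2 \<Gamma> \<longleftrightarrow> (\<exists>G1 G2.
     minimally_generates G1 \<Gamma>1 \<and> minimally_generates G2 \<Gamma>2 \<and> G1 \<inter> G2 = {} \<and>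
     card (extremal_rays \<Gamma>1) = semigroup_dim \<Gamma>1 \<and>
     card (extremal_rays \<Gamma>2) = semigroup_dim \<Gamma>2 \<and>
     vec.independent (rat_vec ` (extremal_rays \<Gamma>1 \<union> extremal_rays \<Gamma>2)) \<and>
     \<Gamma> = monoid_span (G1 \<union> G2))"


section \<open>The polynomial ring and the semigroup ring\<close>

text \<open>
  The variables are indexed by the generators themselves, the variable \<open>z\<^sub>c\<close> having degree \<open>c\<close>.
\<close>

type_synonym 'r mon = "(nat ^ 'r) \<Rightarrow>\<^sub>0 nat"
type_synonym ('r, 'k) mpoly = "'r mon \<Rightarrow>\<^sub>0 'k"

definition poly_ring :: "(nat ^ 'r) set \<Rightarrow> ('r, 'k::zero) mpoly set" where
  "poly_ring G = {p. \<forall>m\<in>Poly_Mapping.keys p. Poly_Mapping.keys m \<subseteq> G}"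

definition irrelevant_ideal :: "(nat ^ 'r) set \<Rightarrow> ('r, 'k::zero) mpoly set" where
  "irrelevant_ideal G = {p \<in> poly_ring G. Poly_Mapping.lookup p 0 = 0}"

definition mon_deg :: "'r mon \<Rightarrow> nat ^ 'r" where
  "mon_deg m = (\<Sum>c\<in>Poly_Mapping.keys m. Poly_Mapping.lookup m c *s c)"

definition semigroup_ring :: "(nat ^ 'r) set \<Rightarrow> ((nat ^ 'r) \<Rightarrow>\<^sub>0 'k::zero) set" where
  "semigroup_ring \<Gamma> = {f. Poly_Mapping.keys f \<subseteq> \<Gamma>}"

text \<open>The ring homomorphism \<open>z\<^sub>c \<mapsto> x\<^sup>c\<close>.\<close>

definition to_semigroup_ring :: "('r, 'k::comm_monoid_add) mpoly \<Rightarrow> ((nat ^ 'r) \<Rightarrow>\<^sub>0 'k)" where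
  "to_semigroup_ring p =
     (\<Sum>m\<in>Poly_Mapping.keys p. Poly_Mapping.single (mon_deg m) (Poly_Mapping.lookup p m))"


section \<open>Graded minimal free resolutions with bases\<close>

text \<open>
  The free module with basis \<open>e\<^sub>0, \<dots>, e\<^bsub>n-1\<^esub>\<close> consists of the coordinate vectors supported on
  \<open>{..<n}\<close>. Every free module with a chosen finite basis is of this form.
\<close>

type_synonym ('r, 'k) fvec = "nat \<Rightarrow>\<^sub>0 ('r, 'k) mpoly"

definition free_module :: "(nat ^ 'r) set \<Rightarrow> nat \<Rightarrow> ('r, 'k::zero) fvec set" where
  "free_module G n = {v. Poly_Mapping.keys v \<subseteq> {..<n} \<and>
     (\<forall>k. Poly_Mapping.lookup v k \<in> poly_ring G)}"

definition smult :: "('r, 'k::comm_ring_1) mpoly \<Rightarrow> ('r, 'k) fvec \<Rightarrow> ('r, 'k) fvec" where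
  "smult p v = Poly_Mapping.map ((*) p) v"

definition linear_map_on ::
  "'a set \<Rightarrow> ('a \<Rightarrow> 'b \<Rightarrow> 'b) \<Rightarrow> ('a \<Rightarrow> 'c \<Rightarrow> 'c) \<Rightarrow> 'b::plus set \<Rightarrow> 'c::plus set \<Rightarrow> ('b \<Rightarrow> 'c) \<Rightarrow> bool" where
  "linear_map_on R s t M N f \<longleftrightarrow>
     f ` M \<subseteq> N \<and>
     (\<forall>u\<in>M. \<forall>v\<in>M. f (u + v) = f u + f v) \<and>
     (\<forall>p\<in>R. \<forall>v\<in>M. f (s p v) = t p (f v))"

text \<open>
  In homological degree \<open>j\<close> the module has basis \<open>e\<^sub>k\<close>, \<open>k < betti j\<close>, with \<open>e\<^sub>k\<close> of degree
  \<open>bdeg j k\<close>. The map \<open>diff (Suc j)\<close> goes from degree \<open>Suc j\<close> to degree \<open>j\<close> (the value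
  \<open>diff 0\<close> is not used), and \<open>aug\<close> is the augmentation onto the semigroup ring.
\<close>

record (overloaded) ('r, 'k) based_complex =
  betti :: "nat \<Rightarrow> nat"
  bdeg :: "nat \<Rightarrow> nat \<Rightarrow> nat ^ ('r::finite)"
  diff :: "nat \<Rightarrow> ('r, 'k::zero) fvec \<Rightarrow> ('r, 'k) fvec"
  aug :: "('r, 'k) fvec \<Rightarrow> ((nat ^ 'r) \<Rightarrow>\<^sub>0 'k)"

definition cmod :: "(nat ^ 'r) set \<Rightarrow> ('r, 'k::zero) based_complex \<Rightarrow> nat \<Rightarrow> ('r, 'k) fvec set" where
  "cmod G F j = free_module G (betti F j)"

definition homogeneous_in ::
  "('r, 'k::zero) based_complex \<Rightarrow> nat \<Rightarrow> nat ^ 'r \<Rightarrow> ('r, 'k) fvec \<Rightarrow> bool" where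
  "homogeneous_in F j d v \<longleftrightarrow>
     (\<forall>k\<in>Poly_Mapping.keys v. \<forall>m\<in>Poly_Mapping.keys (Poly_Mapping.lookup v k). mon_deg m + bdeg F j k = d)"

definition graded_free_complex :: "(nat ^ 'r) set \<Rightarrow> ('r, 'k::comm_ring_1) based_complex \<Rightarrow> bool" where
  "graded_free_complex G F \<longleftrightarrow>
     (\<forall>j. \<forall>k < betti F j. bdeg F j k \<in> monoid_span G) \<and>
     (\<forall>j. linear_map_on (poly_ring G) smult smult (cmod G F (Suc j)) (cmod G F j) (diff F (Suc j))) \<and>
     (\<forall>j. \<forall>d. \<forall>v\<in>cmod G F (Suc j).
        homogeneous_in F (Suc j) d v \<longrightarrow> homogeneous_in F j d (diff F (Suc j) v)) \<and>
     linear_map_on (poly_ring G) smult (\<lambda>p f. to_semigroup_ring p * f)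
       (cmod G F 0) (semigroup_ring (monoid_span G)) (aug F) \<and>
     (\<forall>d. \<forall>v\<in>cmod G F 0. homogeneous_in F 0 d v \<longrightarrow> Poly_Mapping.keys (aug F v) \<subseteq> {d})"

definition graded_free_resolution :: "(nat ^ 'r) set \<Rightarrow> ('r, 'k::comm_ring_1) based_complex \<Rightarrow> bool" where
  "graded_free_resolution G F \<longleftrightarrow>
     graded_free_complex G F \<and>
     aug F ` cmod G F 0 = semigroup_ring (monoid_span G) \<and>
     diff F (Suc 0) ` cmod G F (Suc 0) = {v \<in> cmod G F 0. aug F v = 0} \<and>
     (\<forall>j. diff F (Suc (Suc j)) ` cmod G F (Suc (Suc j)) =
          {v \<in> cmod G F (Suc j). diff F (Suc j) v = 0})"

definition graded_minimal_free_resolution ::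
  "(nat ^ 'r) set \<Rightarrow> ('r, 'k::comm_ring_1) based_complex \<Rightarrow> bool" where
  "graded_minimal_free_resolution G F \<longleftrightarrow>
     graded_free_resolution G F \<and>
     (\<forall>j. \<forall>v\<in>cmod G F (Suc j). \<forall>k. Poly_Mapping.lookup (diff F (Suc j) v) k \<in> irrelevant_ideal G)"


section \<open>Strong indispensability\<close>

text \<open>
  The complexes considered here do not include the augmentation. Between minimal resolutions the
  maps below automatically preserve degrees.
\<close>

definition injective_complex_map ::
  "(nat ^ 'r) set \<Rightarrow> ('r, 'k::comm_ring_1) based_complex \<Rightarrow> ('r, 'k) based_complex \<Rightarrow>
   (nat \<Rightarrow> ('r, 'k) fvec \<Rightarrow> ('r, 'k) fvec) \<Rightarrow> bool" where
  "injective_complex_map G F F' i \<longleftrightarrow>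
     (\<forall>j. linear_map_on (poly_ring G) smult smult (cmod G F j) (cmod G F' j) (i j)) \<and>
     (\<forall>j. \<forall>v\<in>cmod G F (Suc j). i j (diff F (Suc j) v) = diff F' (Suc j) (i (Suc j) v)) \<and>
     (\<forall>j. inj_on (i j) (cmod G F j)) \<and>
     (\<forall>j. \<forall>k < betti F j. \<exists>l < betti F' j. \<exists>c::'k. c \<noteq> 0 \<and>
        i j (Poly_Mapping.single k 1) = Poly_Mapping.single l (Poly_Mapping.single 0 c))"

definition strongly_indispensable ::
  "(nat ^ 'r) set \<Rightarrow> ('r, 'k::comm_ring_1) based_complex \<Rightarrow> bool" where
  "strongly_indispensable G F \<longleftrightarrow>
     graded_minimal_free_resolution G F \<and>
     (\<forall>F'. graded_minimal_free_resolution G F' \<longrightarrow> (\<exists>i. injective_complex_map G F F' i))"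

text \<open>The minimal generating set of a submonoid of \<open>\<nat>\<^sup>r\<close> is unique.\<close>

definition has_SIFR :: "'k::field itself \<Rightarrow> (nat ^ 'r) set \<Rightarrow> bool" where
  "has_SIFR _ \<Gamma> \<longleftrightarrow>
     (\<exists>G (F :: ('r, 'k) based_complex). minimally_generates G \<Gamma> \<and> strongly_indispensable G F)"

end

theory Submission
  imports Defs
begin

text \<open>
  A minimal free resolution is strongly indispensable if and only if, in each homological degree,
  no two distinct basis elements have degrees differing by an element of the semigroup. If the
  degrees are incomparable in this sense, every graded lift of one minimal resolution to another
  is forced to be monomial. Conversely, if the degree of \<open>e\<^sub>k\<close> equals that of \<open>e\<^sub>l\<close> plus the degree of
  a monomial \<open>m\<close>, replace \<open>e\<^sub>k\<close> by \<open>e\<^sub>k + m e\<^sub>l\<close>: a monomial map to the new resolution is a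
  multiple of the identity below this homological degree, which forces \<open>m e\<^sub>l\<close> to be a cycle.

  Linear independence of the extremal rays makes the join a direct sum of semigroups. Its minimal
  resolution is then the tensor product of the two minimal resolutions, and each of these is
  recovered as the part of a resolution of the join that is spanned by the basis elements with
  degree in the summand. Incomparability passes to the summands trivially; it passes to the tensor
  product since the degrees strictly decrease along nonzero entries of the differentials.
\<close>

text \<open>Constant terms drive both halves of the criterion. Complex maps ignore the augmentation,
  so a monomial map is pinned down only up to one scalar: rank one in degree 0 supplies it, and
  minimality propagates it, because two candidates with equal boundary differ by a cycle and cycles
  have no constant terms. In the other direction, lifts both ways between two minimal resolutions
  have mutually inverse matrices of constant terms.

  For the join, the condition that the number of extremal rays equals the dimension makes the rays
  of each summand span it rationally, so independence of all rays gives uniqueness of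
  decompositions. Each summand is then a face, and keeping only the terms with degree in a face is
  exact and lands over the smaller polynomial ring.

  The two factors live over polynomial rings in disjoint variables, so their tensor product is taken
  over the field. There the augmented factors have linear contractions, and these combine into a
  contraction of the product.\<close>

abbreviation "lookup \<equiv> Poly_Mapping.lookup"
abbreviation "keys \<equiv> Poly_Mapping.keys"
abbreviation "single \<equiv> Poly_Mapping.single"

section \<open>Polynomials and free modules\<close>

lemma sum_closed:
  assumes "\<And>x. x \<in> A \<Longrightarrow> P (f x)" "P 0" "\<And>x y. P x \<Longrightarrow> P y \<Longrightarrow> P (x + y)"
  shows "P (sum f A)"
  using assms by (induction A rule: infinite_finite_induct) auto

lemma poly_mapping_sum_single: "(\<Sum>k\<in>keys p. single k (lookup p k)) = p"
proof (rule poly_mapping_eqI)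
  fix k
  have "lookup (\<Sum>k\<in>keys p. single k (lookup p k)) k = (\<Sum>l\<in>keys p. if l = k then lookup p k else 0)"
    unfolding lookup_sum by (rule sum.cong) (auto simp: lookup_single when_def)
  also have "\<dots> = lookup p k" by (simp add: in_keys_iff)
  finally show "lookup (\<Sum>k\<in>keys p. single k (lookup p k)) k = lookup p k" .
qed

lemma poly_mapping_induct [case_names zero single add]:
  assumes "Q 0" "\<And>k c. Q (single k c)" "\<And>p q. Q p \<Longrightarrow> Q q \<Longrightarrow> Q (p + q)"
  shows "Q (p :: 'a \<Rightarrow>\<^sub>0 'b::comm_monoid_add)"
proof -
  have "Q (\<Sum>k\<in>keys p. single k (lookup p k))"
    by (rule sum_closed) (use assms in auto)
  thus ?thesis by (simp add: poly_mapping_sum_single)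
qed

lemma poly_ring_0 [simp]: "0 \<in> poly_ring G"
  by (simp add: poly_ring_def)

lemma poly_ring_add: "p \<in> poly_ring G \<Longrightarrow> q \<in> poly_ring G \<Longrightarrow> p + q \<in> poly_ring G"
  using keys_add[of p q] by (auto simp: poly_ring_def)

lemma poly_ring_single: "keys m \<subseteq> G \<Longrightarrow> single m c \<in> poly_ring G"
  by (auto simp: poly_ring_def)

lemma poly_ring_const [simp]: "single 0 c \<in> poly_ring G"
  by (rule poly_ring_single) simp

lemma poly_ring_1 [simp]: "1 \<in> poly_ring G"
  by (simp flip: single_one)

lemma poly_ring_mult:
  assumes "p \<in> poly_ring G" "q \<in> poly_ring G"
  shows "p * q \<in> poly_ring G"
  unfolding poly_ring_def
proof safe
  fix m c assume m: "m \<in> keys (p * q)" and c: "c \<in> keys m"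
  then obtain a b where "m = a + b" "a \<in> keys p" "b \<in> keys q"
    using keys_mult[of p q] by auto
  thus "c \<in> G" using assms c keys_add[of a b] unfolding poly_ring_def by blast
qed

lemma poly_ring_uminus: "(p :: ('r::finite, 'k::comm_ring_1) mpoly) \<in> poly_ring G \<Longrightarrow> - p \<in> poly_ring G"
  by (simp add: poly_ring_def in_keys_iff)

lemma poly_ring_mono: "G \<subseteq> H \<Longrightarrow> poly_ring G \<subseteq> poly_ring H"
  by (auto simp: poly_ring_def)

lemma add_eq_0_poly_mapping_nat:
  fixes a b :: "'a \<Rightarrow>\<^sub>0 nat"
  shows "a + b = 0 \<longleftrightarrow> a = 0 \<and> b = 0"
proof
  assume "a + b = 0"
  hence "lookup (a + b) k = 0" for k by simp
  hence "lookup a k = 0 \<and> lookup b k = 0" for k by (simp add: lookup_add)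
  thus "a = 0 \<and> b = 0" by (auto intro!: poly_mapping_eqI)
qed simp

text \<open>Exponents are natural numbers, so only the product of the two constant terms can
  contribute. Minimality is tested throughout by this ring map to the coefficients.\<close>

lemma lookup_mult_0:
  fixes p q :: "('r::finite, 'k::comm_ring_1) mpoly"
  shows "lookup (p * q) 0 = lookup p 0 * lookup q 0"
proof (induction p rule: poly_mapping_induct)
  case (single m c)
  show ?case
    by (induction q rule: poly_mapping_induct)
       (auto simp: mult_single lookup_single when_def add_eq_0_poly_mapping_nat distrib_left lookup_add)
qed (auto simp: distrib_right lookup_add)

lemma lookup_single_mult:
  fixes p :: "('r::finite, 'k::comm_ring_1) mpoly"
  shows "lookup (single m c * p) (m + n) = c * lookup p n"
  by (induction p rule: poly_mapping_induct)
     (auto simp: mult_single lookup_single when_def distrib_left lookup_add)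

lemma single_mult_eq_0:
  fixes p :: "('r::finite, 'k::idom) mpoly"
  assumes "single m c * p = 0" "c \<noteq> 0"
  shows "p = 0"
proof (rule poly_mapping_eqI)
  fix n show "lookup p n = lookup 0 n"
    using lookup_single_mult[of m c p n] assms by simp
qed

lemma mon_deg_superset:
  assumes "finite A" "keys m \<subseteq> A"
  shows "mon_deg m = (\<Sum>c\<in>A. lookup m c *s c)"
  unfolding mon_deg_def
  by (rule sum.mono_neutral_left) (use assms in \<open>auto simp: in_keys_iff\<close>)

lemma mon_deg_add: "mon_deg (m + n :: 'r::finite mon) = mon_deg m + mon_deg n"
proof -
  let ?A = "keys m \<union> keys n"
  have "mon_deg (m + n) = (\<Sum>c\<in>?A. lookup (m + n) c *s c)"
    by (rule mon_deg_superset) (use keys_add[of m n] in auto)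
  thus ?thesis
    by (simp add: mon_deg_superset[of ?A m] mon_deg_superset[of ?A n] lookup_add
        vector_sadd_rdistrib sum.distrib)
qed

lemma mon_deg_0 [simp]: "mon_deg 0 = 0"
  by (simp add: mon_deg_def)

lemma mon_deg_single: "mon_deg (single c n :: 'r::finite mon) = n *s c"
  by (auto simp: mon_deg_def)

lemma monoid_span_add:
  "x \<in> monoid_span G \<Longrightarrow> y \<in> monoid_span G \<Longrightarrow> x + y \<in> monoid_span G"
  by (induction rule: monoid_span.induct) (auto simp: add.assoc intro: monoid_span.add)

lemma monoid_span_base: "(g :: nat ^ 'r::finite) \<in> G \<Longrightarrow> g \<in> monoid_span G"
  using monoid_span.add[OF _ monoid_span.zero, of g G] by simp

lemma monoid_span_mono: "G \<subseteq> H \<Longrightarrow> monoid_span G \<subseteq> monoid_span H"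
proof
  fix x assume "G \<subseteq> H" "x \<in> monoid_span G"
  from this(2,1) show "x \<in> monoid_span H"
    by (induction rule: monoid_span.induct) (auto intro: monoid_span.intros)
qed

lemma monoid_span_scale:
  assumes "(x :: nat ^ 'r::finite) \<in> monoid_span G"
  shows "n *s x \<in> monoid_span G"
proof (induction n)
  case 0
  have "0 *s x = 0" by (simp add: vec_eq_iff)
  thus ?case by (simp add: monoid_span.zero)
next
  case (Suc n)
  have "Suc n *s x = x + n *s x" by (simp add: vec_eq_iff)
  thus ?case using Suc assms by (simp add: monoid_span_add)
qed

lemma mon_deg_in_span:
  assumes "keys m \<subseteq> G"
  shows "mon_deg (m :: 'r::finite mon) \<in> monoid_span G"
  unfolding mon_deg_def
  by (rule sum_closed[where P="\<lambda>x. x \<in> monoid_span G"])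
     (use assms in \<open>auto intro: monoid_span_add monoid_span.zero monoid_span_scale monoid_span_base\<close>)

lemma span_is_mon_deg:
  assumes "g \<in> monoid_span G"
  obtains m where "keys m \<subseteq> G" "mon_deg m = (g :: nat ^ 'r::finite)"
  using assms
proof (induction arbitrary: thesis rule: monoid_span.induct)
  case zero
  show ?case by (rule zero[of 0]) auto
next
  case (add a x)
  obtain m where m: "keys m \<subseteq> G" "mon_deg m = x" using add by blast
  show ?case
  proof (rule add.prems)
    show "keys (single a 1 + m) \<subseteq> G"
      using m add.hyps keys_add[of "single a 1" m] by auto
    have "(1::nat) *s a = a" by (simp add: vec_eq_iff)
    thus "mon_deg (single a 1 + m) = a + x"
      using m by (simp only: mon_deg_add mon_deg_single)
  qed
qed

text \<open>The summands of a degree are natural vectors and cannot cancel. This positivity is what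
  turns an equality of degrees into the statement that an entry is constant.\<close>

lemma mon_deg_eq_0:
  assumes "keys m \<subseteq> G" "0 \<notin> G" "mon_deg m = (0 :: nat ^ 'r::finite)"
  shows "m = 0"
proof (rule ccontr)
  assume "m \<noteq> 0"
  then obtain c where c: "c \<in> keys m" by (metis all_not_in_conv keys_eq_empty)
  have "\<forall>i. (\<Sum>c\<in>keys m. lookup m c * c $ i) = 0"
    using assms(3) by (simp add: mon_deg_def vec_eq_iff)
  hence "\<forall>i. lookup m c * c $ i = 0"
    using c by simp
  hence "c = 0" using c by (auto simp: vec_eq_iff in_keys_iff)
  thus False using c assms by auto
qed

lemma smult_conv: "smult p v = single 0 p * v"
  by (simp add: smult_def mult_map_scale_conv_mult)

lemma lookup_smult [simp]: "lookup (smult p v) k = p * lookup v k"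
  by (simp add: smult_def map.rep_eq when_def)

lemma smult_add_right: "smult p (u + v) = smult p u + smult p v"
  by (simp add: smult_conv distrib_left)
lemma smult_add_left: "smult (p + q) v = smult p v + smult q v"
  by (simp add: smult_conv single_add distrib_right)
lemma smult_smult: "smult p (smult q v) = smult (p * q) v"
  by (rule poly_mapping_eqI) (simp add: mult.assoc)
lemma smult_one [simp]: "smult 1 v = v"
  by (rule poly_mapping_eqI) simp
lemma smult_0 [simp]: "smult 0 v = 0" "smult p 0 = 0"
  by (rule poly_mapping_eqI, simp)+
lemma smult_single [simp]: "smult p (single k q) = single k (p * q)"
  by (rule poly_mapping_eqI) (simp add: lookup_single when_def)
lemma smult_sum_right: "smult p (sum f A) = (\<Sum>a\<in>A. smult p (f a))"
  by (simp add: smult_conv sum_distrib_left)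
lemma smult_diff_right: "smult p (u - v) = smult p u - smult p v"
  by (rule poly_mapping_eqI) (simp add: lookup_minus algebra_simps)

text \<open>Arbitrary index sets are allowed because restriction to a summand keeps only part of a
  basis, and the tensor product indexes its basis by encoded triples.\<close>

definition gfree :: "(nat ^ 'r) set \<Rightarrow> nat set \<Rightarrow> ('r, 'k::zero) fvec set" where
  "gfree G S = {v. keys v \<subseteq> S \<and> (\<forall>k. lookup v k \<in> poly_ring G)}"

lemma free_module_eq: "free_module G n = gfree G {..<n}"
  by (simp add: free_module_def gfree_def)

lemma gfree_0 [simp]: "0 \<in> gfree G S"
  by (simp add: gfree_def)

lemma gfree_add: "u \<in> gfree G S \<Longrightarrow> v \<in> gfree G S \<Longrightarrow> u + v \<in> gfree G S"
  using keys_add[of u v] by (auto simp: gfree_def lookup_add intro: poly_ring_add)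

lemma gfree_smult: "p \<in> poly_ring G \<Longrightarrow> v \<in> gfree G S \<Longrightarrow> smult p v \<in> gfree G S"
  by (auto simp: gfree_def in_keys_iff subset_iff intro: poly_ring_mult) (metis mult_zero_right)

lemma gfree_uminus: "(v :: ('r::finite, 'k::comm_ring_1) fvec) \<in> gfree G S \<Longrightarrow> - v \<in> gfree G S"
  by (auto simp: gfree_def in_keys_iff subset_iff intro: poly_ring_uminus)

lemma gfree_diff:
  "(u :: ('r::finite, 'k::comm_ring_1) fvec) \<in> gfree G S \<Longrightarrow> v \<in> gfree G S \<Longrightarrow> u - v \<in> gfree G S"
  using gfree_add[OF _ gfree_uminus, of u G S v] by simp

lemma gfree_sum: "(\<And>x. x \<in> A \<Longrightarrow> f x \<in> gfree G S) \<Longrightarrow> sum f A \<in> gfree G S"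
  by (rule sum_closed[where P="\<lambda>p. p \<in> gfree G S"]) (auto intro: gfree_add)

lemma gfree_single: "k \<in> S \<Longrightarrow> p \<in> poly_ring G \<Longrightarrow> single k p \<in> gfree G S"
  by (auto simp: gfree_def lookup_single when_def)

lemma gfree_mono: "G \<subseteq> H \<Longrightarrow> S \<subseteq> T \<Longrightarrow> gfree G S \<subseteq> gfree H T"
  unfolding gfree_def using poly_ring_mono[of G H] by blast

text \<open>The coefficient stays inside the term, so the rule also applies to maps that are merely
  additive, or linear only over the field.\<close>

lemma gfree_induct [consumes 1, case_names zero single add]:
  assumes v: "v \<in> gfree G S"
    and z: "Q 0"
    and t: "\<And>k m c. k \<in> S \<Longrightarrow> keys m \<subseteq> G \<Longrightarrow> Q (single k (single m c))"
    and a: "\<And>u w. u \<in> gfree G S \<Longrightarrow> w \<in> gfree G S \<Longrightarrow> Q u \<Longrightarrow> Q w \<Longrightarrow> Q (u + w)"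
  shows "Q (v :: ('r::finite, 'k::comm_ring_1) fvec)"
proof -
  let ?P = "\<lambda>v. v \<in> gfree G S \<and> Q v"
  have "?P (single k (lookup v k))" if "k \<in> keys v" for k
  proof -
    have k: "k \<in> S" and p: "lookup v k \<in> poly_ring G" using v that by (auto simp: gfree_def)
    have "?P (single k (\<Sum>m\<in>keys (lookup v k). single m (lookup (lookup v k) m)))"
    proof (rule sum_closed[where P="\<lambda>p. ?P (single k p)"])
      fix m assume "m \<in> keys (lookup v k)"
      hence "keys m \<subseteq> G" using p by (auto simp: poly_ring_def)
      thus "?P (single k (single m (lookup (lookup v k) m)))"
        by (simp add: k t gfree_single poly_ring_single)
    qed (simp_all add: z single_add gfree_add a)
    thus ?thesis by (simp add: poly_mapping_sum_single)
  qed
  hence "?P (\<Sum>k\<in>keys v. single k (lookup v k))"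
    by (rule sum_closed[where P="?P"]) (simp_all add: z gfree_add a)
  thus ?thesis by (simp add: poly_mapping_sum_single)
qed

lemma linear_map_on_iff:
  "linear_map_on R s t M N f \<longleftrightarrow>
     (\<forall>v\<in>M. f v \<in> N) \<and> (\<forall>u\<in>M. \<forall>v\<in>M. f (u + v) = f u + f v) \<and>
     (\<forall>p\<in>R. \<forall>v\<in>M. f (s p v) = t p (f v))"
  by (auto simp: linear_map_on_def image_subset_iff)

definition lin :: "(nat \<Rightarrow> ('r::finite, 'k::comm_ring_1) fvec) \<Rightarrow> ('r, 'k) fvec \<Rightarrow> ('r, 'k) fvec" where
  "lin w v = (\<Sum>k\<in>keys v. smult (lookup v k) (w k))"

lemma lin_superset:
  assumes "finite A" "keys v \<subseteq> A"
  shows "lin w v = (\<Sum>k\<in>A. smult (lookup v k) (w k))"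
  unfolding lin_def by (rule sum.mono_neutral_left) (use assms in \<open>auto simp: in_keys_iff\<close>)

lemma lin_add: "lin w (u + v) = lin w u + lin w v"
proof -
  let ?A = "keys u \<union> keys v"
  have "lin w (u + v) = (\<Sum>k\<in>?A. smult (lookup (u + v) k) (w k))"
    by (rule lin_superset) (use keys_add[of u v] in auto)
  thus ?thesis
    by (simp add: lin_superset[of ?A u] lin_superset[of ?A v] lookup_add smult_add_left sum.distrib)
qed

lemma lin_0 [simp]: "lin w 0 = 0"
  by (simp add: lin_def)

lemma lin_smult: "lin w (smult p v) = smult p (lin w v)"
proof -
  have "lin w (smult p v) = (\<Sum>k\<in>keys v. smult (lookup (smult p v) k) (w k))"
    by (rule lin_superset) (auto simp: in_keys_iff)
  thus ?thesis by (simp add: lin_def smult_sum_right smult_smult)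
qed

lemma lin_single [simp]: "lin w (single k p) = smult p (w k)"
  by (auto simp: lin_def)

lemma lin_closed:
  assumes "v \<in> gfree G S" "\<And>k. k \<in> S \<Longrightarrow> w k \<in> gfree G T"
  shows "lin w v \<in> gfree G T"
  unfolding lin_def
proof (intro gfree_sum gfree_smult)
  fix k assume "k \<in> keys v"
  thus "lookup v k \<in> poly_ring G" "w k \<in> gfree G T" using assms by (auto simp: gfree_def)
qed

lemma lin_linear:
  assumes "\<And>k. k \<in> S \<Longrightarrow> w k \<in> gfree G T"
  shows "linear_map_on (poly_ring G) smult smult (gfree G S) (gfree G T) (lin w)"
  by (auto simp: linear_map_on_iff lin_add lin_smult intro: lin_closed assms)

lemma lin_cong: "v \<in> gfree G S \<Longrightarrow> (\<And>k. k \<in> S \<Longrightarrow> w k = w' k) \<Longrightarrow> lin w v = lin w' v"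
  unfolding lin_def by (rule sum.cong) (auto simp: gfree_def)

lemma additive_0:
  assumes "f (0 + 0 :: 'b::monoid_add) = f 0 + (f 0 :: 'a::cancel_comm_monoid_add)" shows "f 0 = 0"
  using assms by simp

lemma linear_map_on_0:
  assumes "linear_map_on R s t (gfree G S) N f"
  shows "f 0 = (0 :: 'a::cancel_comm_monoid_add)"
  by (rule additive_0) (use assms gfree_0 in \<open>unfold linear_map_on_iff, blast\<close>)

lemma linear_map_on_diff:
  fixes f :: "('r::finite, 'k::comm_ring_1) fvec \<Rightarrow> 'a::ab_group_add"
  assumes f: "linear_map_on R s t (gfree G S) N f" and uv: "u \<in> gfree G S" "v \<in> gfree G S"
  shows "f (u - v) = f u - f v"
proof -
  have "f ((u - v) + v) = f (u - v) + f v"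
    using f gfree_diff[OF uv] uv unfolding linear_map_on_iff by blast
  thus ?thesis by (simp add: algebra_simps)
qed

lemma linear_map_on_sum:
  fixes f :: "('r::finite, 'k::comm_ring_1) fvec \<Rightarrow> 'a::cancel_comm_monoid_add"
  assumes f: "linear_map_on R s t (gfree G S) N f" and u: "\<And>a. a \<in> A \<Longrightarrow> u a \<in> gfree G S"
  shows "f (sum u A) = (\<Sum>a\<in>A. f (u a))"
  using u
proof (induction A rule: infinite_finite_induct)
  case (insert x F)
  hence "f (u x + sum u F) = f (u x) + f (sum u F)"
    using f by (simp add: linear_map_on_iff gfree_sum)
  with insert show ?case by simp
qed (auto simp: linear_map_on_0[OF f])

lemma linear_map_on_basis:
  fixes f :: "('r::finite, 'k::comm_ring_1) fvec \<Rightarrow> 'a::cancel_comm_monoid_add"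
  assumes f: "linear_map_on (poly_ring G) smult t (gfree G S) N f" and v: "v \<in> gfree G S"
  shows "f v = (\<Sum>k\<in>keys v. t (lookup v k) (f (single k 1)))"
proof -
  have k: "k \<in> S" "lookup v k \<in> poly_ring G" if "k \<in> keys v" for k
    using v that by (auto simp: gfree_def)
  have "f v = f (\<Sum>k\<in>keys v. smult (lookup v k) (single k 1))"
    by (simp add: poly_mapping_sum_single)
  also have "\<dots> = (\<Sum>k\<in>keys v. f (smult (lookup v k) (single k 1)))"
    by (rule linear_map_on_sum[OF f]) (use k in \<open>auto intro: gfree_single\<close>)
  also have "\<dots> = (\<Sum>k\<in>keys v. t (lookup v k) (f (single k 1)))"
    by (rule sum.cong[OF refl]) (use f k in \<open>simp only: linear_map_on_iff gfree_single poly_ring_1\<close>)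
  finally show ?thesis .
qed

lemma linear_map_on_lin:
  assumes f: "linear_map_on (poly_ring G) smult smult (gfree G S) N f" and v: "v \<in> gfree G S"
  shows "f v = lin (\<lambda>k. f (single k 1)) v"
  using linear_map_on_basis[OF assms] by (simp add: lin_def)

section \<open>Homogeneous vectors and graded components\<close>

definition ghom :: "(nat \<Rightarrow> nat ^ 'r) \<Rightarrow> nat ^ 'r \<Rightarrow> ('r, 'k::zero) fvec \<Rightarrow> bool" where
  "ghom e d v \<longleftrightarrow> (\<forall>k\<in>keys v. \<forall>m\<in>keys (lookup v k). mon_deg m + e k = d)"

lemma homogeneous_in_eq: "homogeneous_in F j = ghom (bdeg F j)"
  by (intro ext) (simp add: homogeneous_in_def ghom_def)

lemma ghom_alt:
  "ghom e d v \<longleftrightarrow> (\<forall>k m. lookup (lookup v k) m \<noteq> 0 \<longrightarrow> mon_deg m + e k = d)"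
  unfolding ghom_def by (metis in_keys_iff lookup_zero)

lemma ghom_0 [simp]: "ghom e d 0"
  by (simp add: ghom_alt)

lemma ghom_add:
  fixes u v :: "('r::finite, 'k::comm_ring_1) fvec"
  shows "ghom e d u \<Longrightarrow> ghom e d v \<Longrightarrow> ghom e d (u + v)"
  unfolding ghom_alt lookup_add by (metis add_0)

lemma ghom_sum:
  fixes f :: "'a \<Rightarrow> ('r::finite, 'k::comm_ring_1) fvec"
  shows "(\<And>x. x \<in> A \<Longrightarrow> ghom e d (f x)) \<Longrightarrow> ghom e d (sum f A)"
  by (rule sum_closed[where P="ghom e d"]) (auto intro: ghom_add)

lemma ghom_single_single: "ghom e (mon_deg m + e k) (single k (single m c))"
  by (auto simp: ghom_alt lookup_single when_def)

lemma ghom_basis: "ghom e (e k) (single k 1 :: ('r::finite, 'k::comm_ring_1) fvec)"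
  using ghom_single_single[of e 0 k "1::'k"] by simp

lemma ghom_smult:
  fixes v :: "('r::finite, 'k::comm_ring_1) fvec"
  assumes "ghom e d v" "\<And>m. m \<in> keys p \<Longrightarrow> mon_deg m + d = d'"
  shows "ghom e d' (smult p v)"
  unfolding ghom_def
proof safe
  fix k m assume m: "m \<in> keys (lookup (smult p v) k)"
  then obtain a b where "m = a + b" "a \<in> keys p" "b \<in> keys (lookup v k)"
    using keys_mult[of p "lookup v k"] by auto
  moreover from this have "k \<in> keys v" by (metis in_keys_iff keys_zero empty_iff)
  ultimately show "mon_deg m + e k = d'"
    using assms by (fastforce simp: ghom_def mon_deg_add add.assoc)
qed

lemma lin_ghom:
  assumes "ghom e d v" "\<And>k. k \<in> keys v \<Longrightarrow> ghom e' (e k) (w k)"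
  shows "ghom e' d (lin w v)"
  unfolding lin_def
  by (rule ghom_sum, rule ghom_smult) (use assms in \<open>auto simp: ghom_def\<close>)

lemma lin_lookup_0:
  "lookup (lookup (lin w v) k) 0 = (\<Sum>l\<in>keys v. lookup (lookup v l) 0 * lookup (lookup (w l) k) 0)"
  by (simp add: lin_def lookup_sum lookup_mult_0)

text \<open>\<open>B\<close> is a singleton when homogeneous preimages are extracted, and the span
  of \<open>G1\<close> when a resolution is restricted to a summand.\<close>

definition hcomp ::
  "(nat \<Rightarrow> nat ^ 'r) \<Rightarrow> (nat ^ 'r) set \<Rightarrow> ('r::finite, 'k::comm_ring_1) fvec \<Rightarrow> ('r, 'k) fvec" where
  "hcomp e B v =
     Poly_Mapping.mapp (\<lambda>k. Poly_Mapping.mapp (\<lambda>m c. if mon_deg m + e k \<in> B then c else 0)) v"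

text \<open>Serves two purposes: on the semigroup ring \<open>B\<close> is a set of degrees; on a
  monomial \<open>B\<close> is a set of variables, and the result is the factor in these
  variables.\<close>

definition sproj :: "'a set \<Rightarrow> ('a \<Rightarrow>\<^sub>0 'k::zero) \<Rightarrow> ('a \<Rightarrow>\<^sub>0 'k)" where
  "sproj B f = Poly_Mapping.mapp (\<lambda>g c. if g \<in> B then c else 0) f"

lemma lookup_hcomp:
  "lookup (lookup (hcomp e B v) k) m =
     (if mon_deg m + e k \<in> B then lookup (lookup v k) m else 0)"
  by (auto simp: hcomp_def lookup_mapp when_def in_keys_iff)

lemma lookup_sproj: "lookup (sproj B f) g = (if g \<in> B then lookup f g else 0)"
  by (auto simp: sproj_def lookup_mapp when_def in_keys_iff)

lemma fvec_eqI:
  assumes "\<And>k m. lookup (lookup u k) m = lookup (lookup v k) m"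
  shows "(u :: ('r, 'k::zero) fvec) = v"
  by (intro poly_mapping_eqI assms)

lemma hcomp_add: "hcomp e B (u + v) = hcomp e B u + hcomp e B v"
  by (rule fvec_eqI) (simp add: lookup_hcomp lookup_add)
lemma sproj_add: "sproj B (u + v) = sproj B u + sproj B v"
  by (rule poly_mapping_eqI) (simp add: lookup_sproj lookup_add)

lemma hcomp_0 [simp]: "hcomp e B 0 = 0"
  by (rule fvec_eqI) (simp add: lookup_hcomp)
lemma sproj_0 [simp]: "sproj B 0 = 0"
  by (rule poly_mapping_eqI) (simp add: lookup_sproj)

lemma hcomp_closed: "v \<in> gfree G S \<Longrightarrow> hcomp e B v \<in> gfree G S"
  unfolding gfree_def poly_ring_def
proof safe
  fix k assume v: "keys v \<subseteq> S" and k: "k \<in> keys (hcomp e B v)"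
  have "lookup v k \<noteq> 0"
    using k by (auto simp: hcomp_def in_keys_iff lookup_mapp)
  thus "k \<in> S" using v by (auto simp: in_keys_iff)
next
  fix k m c assume v: "\<forall>k. lookup v k \<in> {p. \<forall>m\<in>keys p. keys m \<subseteq> G}"
    and m: "m \<in> keys (lookup (hcomp e B v) k)" and c: "c \<in> keys m"
  have "m \<in> keys (lookup v k)" using m by (auto simp: in_keys_iff lookup_hcomp split: if_splits)
  thus "c \<in> G" using v c by auto
qed

lemma hcomp_ghom_gen: "ghom e b v \<Longrightarrow> hcomp e B v = (if b \<in> B then v else 0)"
  by (rule fvec_eqI) (auto simp: lookup_hcomp ghom_alt)

lemma ghom_hcomp: "ghom e b (hcomp e {b} v)"
  by (auto simp: ghom_alt lookup_hcomp split: if_splits)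

lemma sproj_gen: "keys f \<subseteq> {b} \<Longrightarrow> sproj B f = (if b \<in> B then f else 0)"
  by (rule poly_mapping_eqI) (auto simp: lookup_sproj subset_iff in_keys_iff)

text \<open>A single term is homogeneous, so both sides keep its whole image or drop it; additivity
  does the rest.\<close>

lemma hcomp_natural:
  assumes f: "linear_map_on (poly_ring G) smult smult (gfree G S) (gfree G T) f"
    and hom: "\<And>d v. v \<in> gfree G S \<Longrightarrow> ghom e d v \<Longrightarrow> ghom e' d (f v)"
    and v: "v \<in> gfree G S"
  shows "f (hcomp e B v) = hcomp e' B (f v)"
  using v
proof (induction v rule: gfree_induct)
  case (single k m c)
  let ?t = "single k (single m c)" and ?d = "mon_deg m + e k"
  have t: "?t \<in> gfree G S" using single by (simp add: gfree_single poly_ring_single)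
  have "ghom e ?d ?t" by (rule ghom_single_single)
  with hom[OF t] have "ghom e' ?d (f ?t)" by blast
  thus ?case using \<open>ghom e ?d ?t\<close> by (simp add: hcomp_ghom_gen linear_map_on_0[OF f])
next
  case (add u w)
  thus ?case using f by (simp add: hcomp_add linear_map_on_iff hcomp_closed)
qed (simp add: linear_map_on_0[OF f])

lemma sproj_natural:
  fixes f :: "('r::finite, 'k::comm_ring_1) fvec \<Rightarrow> ((nat ^ 'r) \<Rightarrow>\<^sub>0 'k)"
  assumes f: "linear_map_on (poly_ring G) smult t (gfree G S) N f"
    and hom: "\<And>d v. v \<in> gfree G S \<Longrightarrow> ghom e d v \<Longrightarrow> keys (f v) \<subseteq> {d}"
    and v: "v \<in> gfree G S"
  shows "f (hcomp e B v) = sproj B (f v)"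
  using v
proof (induction v rule: gfree_induct)
  case (single k m c)
  let ?t = "single k (single m c)" and ?d = "mon_deg m + e k"
  have t: "?t \<in> gfree G S" using single by (simp add: gfree_single poly_ring_single)
  have "ghom e ?d ?t" by (rule ghom_single_single)
  with hom[OF t] have "keys (f ?t) \<subseteq> {?d}" by blast
  thus ?case using \<open>ghom e ?d ?t\<close> by (simp add: hcomp_ghom_gen sproj_gen linear_map_on_0[OF f])
next
  case (add u w)
  thus ?case using f by (simp add: hcomp_add sproj_add linear_map_on_iff hcomp_closed)
qed (simp add: linear_map_on_0[OF f])

section \<open>Minimal resolutions with arbitrary finite index sets\<close>

text \<open>For index sets that are initial segments this is
  \<open>graded_minimal_free_resolution\<close>. The freedom in \<open>S\<close> lets restrictions
  and tensor products be instances directly; \<open>relabel\<close> leads back to the record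
  type.\<close>

locale minimal_resolution =
  fixes G :: "(nat ^ 'r::finite) set" and S :: "nat \<Rightarrow> nat set" and e :: "nat \<Rightarrow> nat \<Rightarrow> nat ^ 'r"
    and D :: "nat \<Rightarrow> ('r, 'k::field) fvec \<Rightarrow> ('r, 'k) fvec"
    and E :: "('r, 'k) fvec \<Rightarrow> ((nat ^ 'r) \<Rightarrow>\<^sub>0 'k)"
  assumes fin: "finite (S j)"
    and deg: "k \<in> S j \<Longrightarrow> e j k \<in> monoid_span G"
    and D_lin: "linear_map_on (poly_ring G) smult smult (gfree G (S (Suc j))) (gfree G (S j)) (D (Suc j))"
    and D_hom: "v \<in> gfree G (S (Suc j)) \<Longrightarrow> ghom (e (Suc j)) d v \<Longrightarrow> ghom (e j) d (D (Suc j) v)"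
    and E_lin: "linear_map_on (poly_ring G) smult (\<lambda>p f. to_semigroup_ring p * f)
       (gfree G (S 0)) (semigroup_ring (monoid_span G)) E"
    and E_hom: "v \<in> gfree G (S 0) \<Longrightarrow> ghom (e 0) d v \<Longrightarrow> keys (E v) \<subseteq> {d}"
    and E_surj: "E ` gfree G (S 0) = semigroup_ring (monoid_span G)"
    and exact_0: "D (Suc 0) ` gfree G (S (Suc 0)) = {v \<in> gfree G (S 0). E v = 0}"
    and exact_Suc: "D (Suc (Suc j)) ` gfree G (S (Suc (Suc j))) = {v \<in> gfree G (S (Suc j)). D (Suc j) v = 0}"
    and minimal: "v \<in> gfree G (S (Suc j)) \<Longrightarrow> lookup (lookup (D (Suc j) v) k) 0 = 0"
begin

abbreviation "M j \<equiv> gfree G (S j) :: ('r, 'k) fvec set"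

text \<open>Taking the image as definition treats all degrees alike; only \<open>cyc_0\<close> and
  \<open>cyc_Suc\<close> distinguish the kernel of the augmentation from that of a
  differential.\<close>

definition "cyc j = D (Suc j) ` M (Suc j)"

lemma cyc_0: "cyc 0 = {v \<in> M 0. E v = 0}"
  by (simp add: cyc_def exact_0)

lemma cyc_Suc: "cyc (Suc j) = {v \<in> M (Suc j). D (Suc j) v = 0}"
  by (simp add: cyc_def exact_Suc)

lemma cyc_sub: "v \<in> cyc j \<Longrightarrow> v \<in> M j"
  by (cases j) (auto simp: cyc_0 cyc_Suc)

lemma cyc_minimal: "v \<in> cyc j \<Longrightarrow> lookup (lookup v k) 0 = 0"
  by (auto simp: cyc_def minimal)

lemma D_closed: "v \<in> M (Suc j) \<Longrightarrow> D (Suc j) v \<in> M j"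
  using D_lin by (auto simp: linear_map_on_iff)

lemma D_add: "u \<in> M (Suc j) \<Longrightarrow> v \<in> M (Suc j) \<Longrightarrow> D (Suc j) (u + v) = D (Suc j) u + D (Suc j) v"
  using D_lin by (auto simp: linear_map_on_iff)

lemma D_smult: "p \<in> poly_ring G \<Longrightarrow> v \<in> M (Suc j) \<Longrightarrow> D (Suc j) (smult p v) = smult p (D (Suc j) v)"
  using D_lin by (auto simp: linear_map_on_iff)

lemma E_add: "u \<in> M 0 \<Longrightarrow> v \<in> M 0 \<Longrightarrow> E (u + v) = E u + E v"
  using E_lin by (auto simp: linear_map_on_iff)

lemma E_smult: "p \<in> poly_ring G \<Longrightarrow> v \<in> M 0 \<Longrightarrow> E (smult p v) = to_semigroup_ring p * E v"
  using E_lin by (auto simp: linear_map_on_iff)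

lemma E_closed: "v \<in> M 0 \<Longrightarrow> E v \<in> semigroup_ring (monoid_span G)"
  using E_lin by (auto simp: linear_map_on_iff)

lemma basis: "k \<in> S j \<Longrightarrow> single k 1 \<in> M j"
  by (simp add: gfree_single)

text \<open>By exactness a basis vector in the kernel would be a boundary, but its coefficient 1 has
  a nonzero constant term.\<close>

lemma D_basis_nonzero:
  assumes "k \<in> S (Suc j)"
  shows "D (Suc j) (single k 1) \<noteq> 0"
proof
  assume "D (Suc j) (single k 1) = 0"
  hence "single k 1 \<in> cyc (Suc j)" using assms by (simp add: cyc_Suc gfree_single)
  from cyc_minimal[OF this, of k] show False by (simp add: lookup_one)
qed

text \<open>The component of degree \<open>b\<close> of any preimage is again a preimage, since the
  differential commutes with taking components.\<close>

lemma homogeneous_lift: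
  assumes w: "w \<in> cyc j" "ghom (e j) b w"
  obtains v where "v \<in> M (Suc j)" "ghom (e (Suc j)) b v" "D (Suc j) v = w"
proof -
  obtain u where u: "u \<in> M (Suc j)" "D (Suc j) u = w" using w by (auto simp: cyc_def)
  show thesis
  proof (rule that[of "hcomp (e (Suc j)) {b} u"])
    show "D (Suc j) (hcomp (e (Suc j)) {b} u) = w"
      using hcomp_natural[OF D_lin D_hom u(1), where B = "{b}"] u(2) w(2) by (simp add: hcomp_ghom_gen)
  qed (use u in \<open>auto intro: hcomp_closed ghom_hcomp\<close>)
qed

lemma homogeneous_lift_E:
  assumes w: "f \<in> semigroup_ring (monoid_span G)" "keys f \<subseteq> {b}"
  obtains v where "v \<in> M 0" "ghom (e 0) b v" "E v = f"
proof -
  have "f \<in> E ` M 0" using w E_surj by simp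
  then obtain u where u: "u \<in> M 0" "E u = f" by auto
  show thesis
  proof (rule that[of "hcomp (e 0) {b} u"])
    show "E (hcomp (e 0) {b} u) = f"
      using sproj_natural[OF E_lin E_hom u(1), where B = "{b}"] u(2) w(2) by (simp add: sproj_gen)
  qed (use u in \<open>auto intro: hcomp_closed ghom_hcomp\<close>)
qed

text \<open>Conjugation by graded isomorphisms. Minimality survives because \<open>T'\<close> is
  linear over the polynomial ring, so constant terms of the image are combinations of vanishing
  ones. Used both to renumber bases and to change a basis inside one degree. The truncated
  \<open>j - 1\<close> matters only at \<open>j = 0\<close>, where the differential is
  unconstrained.\<close>

lemma transport:
  assumes fin': "\<And>j. finite (S' j)"
    and deg': "\<And>j k. k \<in> S' j \<Longrightarrow> e' j k \<in> monoid_span G"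
    and T: "\<And>j. linear_map_on (poly_ring G) smult smult (gfree G (S' j)) (M j) (T j)"
    and T': "\<And>j. linear_map_on (poly_ring G) smult smult (M j) (gfree G (S' j)) (T' j)"
    and TT': "\<And>j v. v \<in> M j \<Longrightarrow> T j (T' j v) = v"
    and T'T: "\<And>j v. v \<in> gfree G (S' j) \<Longrightarrow> T' j (T j v) = v"
    and T_hom: "\<And>j d v. v \<in> gfree G (S' j) \<Longrightarrow> ghom (e' j) d v \<Longrightarrow> ghom (e j) d (T j v)"
    and T'_hom: "\<And>j d v. v \<in> M j \<Longrightarrow> ghom (e j) d v \<Longrightarrow> ghom (e' j) d (T' j v)"
  shows "minimal_resolution G S' e' (\<lambda>j v. T' (j - 1) (D j (T j v))) (\<lambda>v. E (T 0 v))"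
proof -
  let ?M = "\<lambda>j. gfree G (S' j) :: ('r, 'k) fvec set"
  have Tc: "T j v \<in> M j" if "v \<in> ?M j" for j v
    using T[of j] that by (auto simp: linear_map_on_iff)
  have T'c: "T' j v \<in> ?M j" if "v \<in> M j" for j v
    using T'[of j] that by (auto simp: linear_map_on_iff)
  have im: "T j ` ?M j = M j" for j
    using Tc T'c TT' by force
  have inj: "T' j v = 0 \<longleftrightarrow> v = 0" if "v \<in> M j" for j v
    using TT'[OF that] linear_map_on_0[OF T[of j]] linear_map_on_0[OF T'[of j]] by auto
  have cyc': "T' j ` cyc j = {v \<in> ?M j. T j v \<in> cyc j}" for j
    using Tc T'c TT' T'T cyc_sub by force
  have im_D: "(\<lambda>v. T' j (D (Suc j) (T (Suc j) v))) ` ?M (Suc j) = T' j ` cyc j" for j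
    unfolding cyc_def im[symmetric] by (simp add: image_image)
  show ?thesis
  proof
    fix j show "linear_map_on (poly_ring G) smult smult (?M (Suc j)) (?M j)
        (\<lambda>v. T' (Suc j - 1) (D (Suc j) (T (Suc j) v)))"
      using T[of "Suc j"] T'[of j] D_lin[of j] by (simp add: linear_map_on_iff)
  next
    fix j d v assume "v \<in> ?M (Suc j)" "ghom (e' (Suc j)) d v"
    thus "ghom (e' j) d (T' (Suc j - 1) (D (Suc j) (T (Suc j) v)))"
      by (simp add: T'_hom D_closed D_hom T_hom Tc)
  next
    show "linear_map_on (poly_ring G) smult (\<lambda>p f. to_semigroup_ring p * f)
       (?M 0) (semigroup_ring (monoid_span G)) (\<lambda>v. E (T 0 v))"
      using T[of 0] E_lin by (simp add: linear_map_on_iff)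
  next
    fix d v assume "v \<in> ?M 0" "ghom (e' 0) d v"
    thus "keys (E (T 0 v)) \<subseteq> {d}" using E_hom T_hom Tc by blast
  next
    show "(\<lambda>v. E (T 0 v)) ` ?M 0 = semigroup_ring (monoid_span G)"
      unfolding E_surj[symmetric] im[symmetric] by (simp add: image_image)
  next
    show "(\<lambda>v. T' (Suc 0 - 1) (D (Suc 0) (T (Suc 0) v))) ` ?M (Suc 0) = {v \<in> ?M 0. E (T 0 v) = 0}"
      unfolding diff_Suc_1 im_D cyc' by (auto simp: cyc_0 Tc)
  next
    fix j
    show "(\<lambda>v. T' (Suc (Suc j) - 1) (D (Suc (Suc j)) (T (Suc (Suc j)) v))) ` ?M (Suc (Suc j)) =
        {v \<in> ?M (Suc j). T' (Suc j - 1) (D (Suc j) (T (Suc j) v)) = 0}"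
      unfolding diff_Suc_1 im_D cyc' by (auto simp: cyc_Suc Tc inj D_closed)
  next
    fix j v k assume v: "v \<in> ?M (Suc j)"
    let ?w = "D (Suc j) (T (Suc j) v)"
    have w: "?w \<in> M j" using v by (simp add: D_closed Tc)
    show "lookup (lookup (T' (Suc j - 1) ?w) k) 0 = 0"
      by (simp add: linear_map_on_lin[OF T' w] lin_lookup_0 minimal Tc v)
  qed (use fin' deg' in auto)
qed

end

text \<open>Linearity already places the entries of a boundary in the polynomial ring, so membership
  in the irrelevant ideal reduces to a vanishing constant term.\<close>

lemma graded_minimal_free_resolution_iff:
  "graded_minimal_free_resolution G F \<longleftrightarrow>
     minimal_resolution G (\<lambda>j. {..<betti F j}) (bdeg F) (diff F) (aug F)"
proof -
  have *: "linear_map_on (poly_ring G) smult smult (gfree G {..<betti F (Suc j)}) (gfree G {..<betti F j}) (diff F (Suc j)) \<Longrightarrow>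
     (\<forall>v\<in>gfree G {..<betti F (Suc j)}. \<forall>k. lookup (diff F (Suc j) v) k \<in> irrelevant_ideal G)
    \<longleftrightarrow> (\<forall>v\<in>gfree G {..<betti F (Suc j)}. \<forall>k. lookup (lookup (diff F (Suc j) v) k) 0 = 0)" for j
    by (auto simp: linear_map_on_iff irrelevant_ideal_def gfree_def)
  show ?thesis
    unfolding graded_minimal_free_resolution_def graded_free_resolution_def graded_free_complex_def
      minimal_resolution_def cmod_def free_module_eq homogeneous_in_eq
    using * by (auto 0 3)
qed

section \<open>Strong indispensability and incomparable degrees\<close>

text \<open>The value \<open>g = 0\<close> is included, so equal degrees are excluded as well and
  \<open>e\<close> is injective on \<open>S\<close>.\<close>

definition incomparable :: "(nat ^ 'r) set \<Rightarrow> nat set \<Rightarrow> (nat \<Rightarrow> nat ^ 'r::finite) \<Rightarrow> bool" where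
  "incomparable G S e \<longleftrightarrow> (\<forall>k\<in>S. \<forall>l\<in>S. \<forall>g\<in>monoid_span G. e k = e l + g \<longrightarrow> k = l)"

lemma incomparableD:
  "incomparable G S e \<Longrightarrow> k \<in> S \<Longrightarrow> l \<in> S \<Longrightarrow> g \<in> monoid_span G \<Longrightarrow> e k = e l + g \<Longrightarrow> k = l"
  by (auto simp: incomparable_def)

lemma lin_lin_id:
  assumes v: "v \<in> gfree G S" and w: "\<And>k. k \<in> S \<Longrightarrow> lin w (w' k) = single k 1"
  shows "lin w (lin w' v) = v"
  using v by (induction v rule: gfree_induct) (auto simp: lin_add lin_smult w)

lemma to_semigroup_ring_single:
  "to_semigroup_ring (single m c) = single (mon_deg m) c"
  by (auto simp: to_semigroup_ring_def)

text \<open>A permutation matrix with rescaled entries that respects degrees. No ring occurs: the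
  entries are constants, so the same \<open>f\<close> acts over every
  \<open>poly_ring G\<close>.\<close>

definition mono_iso ::
  "nat set \<Rightarrow> (nat \<Rightarrow> nat ^ 'r) \<Rightarrow> nat set \<Rightarrow> (nat \<Rightarrow> nat ^ 'r) \<Rightarrow>
   (('r::finite, 'k::field) fvec \<Rightarrow> ('r, 'k) fvec) \<Rightarrow> bool" where
  "mono_iso S e S' e' f \<longleftrightarrow> (\<exists>\<pi> c. bij_betw \<pi> S S' \<and> (\<forall>k\<in>S. c k \<noteq> 0 \<and> e' (\<pi> k) = e k) \<and>
     f = lin (\<lambda>k. single (\<pi> k) (single 0 (c k))))"

lemma mono_iso_linear:
  assumes "mono_iso S e S' e' f"
  shows "linear_map_on (poly_ring G) smult smult (gfree G S) (gfree G S') f"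
  using assms by (auto simp: mono_iso_def bij_betw_def intro!: lin_linear gfree_single)

lemma mono_iso_ghom:
  assumes "mono_iso S e S' e' f" "v \<in> gfree G S" "ghom e d v"
  shows "ghom e' d (f v)"
proof -
  obtain \<pi> c where f: "\<forall>k\<in>S. c k \<noteq> 0 \<and> e' (\<pi> k) = e k"
     "f = lin (\<lambda>k. single (\<pi> k) (single 0 (c k)))"
    using assms(1) by (auto simp: mono_iso_def)
  show ?thesis unfolding f(2)
  proof (rule lin_ghom[OF assms(3)])
    fix k assume "k \<in> keys v"
    hence "k \<in> S" using assms(2) by (auto simp: gfree_def)
    thus "ghom e' (e k) (single (\<pi> k) (single 0 (c k)))"
      using f(1) ghom_single_single[of e' 0 "\<pi> k" "c k"] by simp
  qed
qed

lemma mono_iso_inverse: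
  fixes f :: "('r::finite, 'k::field) fvec \<Rightarrow> ('r, 'k) fvec"
  assumes "mono_iso S e S' e' f"
  obtains f' where "mono_iso S' e' S e f'"
    "\<And>G v. v \<in> gfree G S \<Longrightarrow> f' (f v) = v" "\<And>G v. v \<in> gfree G S' \<Longrightarrow> f (f' v) = v"
proof -
  obtain \<pi> c where pi: "bij_betw \<pi> S S'" and c: "\<forall>k\<in>S. c k \<noteq> 0 \<and> e' (\<pi> k) = e k"
     and f: "f = lin (\<lambda>k. single (\<pi> k) (single 0 (c k)))"
    using assms by (auto simp: mono_iso_def)
  let ?\<sigma> = "inv_into S \<pi>"
  have l: "?\<sigma> (\<pi> k) = k" if "k \<in> S" for k
    using pi that by (rule bij_betw_inv_into_left)
  have r: "\<pi> (?\<sigma> k) = k" if "k \<in> S'" for k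
    using pi that by (rule bij_betw_inv_into_right)
  have s: "?\<sigma> k \<in> S" if "k \<in> S'" for k
    using pi that by (metis bij_betw_def inv_into_into)
  define f' :: "('r::finite, 'k::field) fvec \<Rightarrow> ('r, 'k) fvec"
    where "f' = lin (\<lambda>k. single (?\<sigma> k) (single 0 (1 / c (?\<sigma> k))))"
  show thesis
  proof (rule that)
    have "\<forall>k\<in>S'. 1 / c (?\<sigma> k) \<noteq> 0 \<and> e (?\<sigma> k) = e' k"
      using c s r by fastforce
    thus "mono_iso S' e' S e f'"
      unfolding mono_iso_def f'_def using bij_betw_inv_into[OF pi]
      by (intro exI[of _ ?\<sigma>] exI[of _ "\<lambda>k. 1 / c (?\<sigma> k)"]) auto
    show "f' (f v) = v" if v: "v \<in> gfree G S" for G v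
      unfolding f f'_def by (rule lin_lin_id[OF v]) (simp add: l c mult_single)
    show "f (f' v) = v" if v: "v \<in> gfree G S'" for G v
      unfolding f f'_def by (rule lin_lin_id[OF v]) (simp add: r c s mult_single)
  qed
qed

section \<open>Renumbering a basis, and the module in degree 0\<close>

context minimal_resolution
begin

text \<open>Numbers each finite index set by an initial segment, as \<open>based_complex\<close>
  demands, and transports the resolution along the permuted bases.\<close>

lemma relabel:
  obtains F :: "('r, 'k) based_complex" and \<rho> where "graded_minimal_free_resolution G F"
    "\<And>j. bij_betw (\<rho> j) {..<betti F j} (S j)"
    "\<And>j k. k < betti F j \<Longrightarrow> bdeg F j k = e j (\<rho> j k)"
proof -
  have "\<exists>r. \<forall>j. bij_betw (r j) {..<card (S j)} (S j)"
    using fin ex_bij_betw_nat_finite by (intro choice allI) (auto simp: lessThan_atLeast0)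
  then obtain \<rho> where \<rho>: "\<And>j. bij_betw (\<rho> j) {..<card (S j)} (S j)" by blast
  let ?T = "\<lambda>j. lin (\<lambda>k. single (\<rho> j k) (single 0 (1::'k)))"
  have T: "mono_iso {..<card (S j)} (e j \<circ> \<rho> j) (S j) (e j) (?T j)" for j
    unfolding mono_iso_def using \<rho>[of j]
    by (intro exI[of _ "\<rho> j"] exI[of _ "\<lambda>_. 1"]) auto
  have "\<exists>f'. mono_iso (S j) (e j) {..<card (S j)} (e j \<circ> \<rho> j) f' \<and>
       (\<forall>G. \<forall>v \<in> gfree G {..<card (S j)}. f' (?T j v) = v) \<and>
       (\<forall>G. \<forall>v \<in> gfree G (S j). ?T j (f' v) = v)" for j
    using mono_iso_inverse[OF T[of j]] by metis
  then obtain T' where T': "\<And>j. mono_iso (S j) (e j) {..<card (S j)} (e j \<circ> \<rho> j) (T' j)"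
     "\<And>j G v. v \<in> gfree G {..<card (S j)} \<Longrightarrow> T' j (?T j v) = v"
     "\<And>j G v. v \<in> gfree G (S j) \<Longrightarrow> ?T j (T' j v) = v"
    by metis
  define F :: "('r, 'k) based_complex" where
    "F = \<lparr>betti = (\<lambda>j. card (S j)), bdeg = (\<lambda>j. e j \<circ> \<rho> j),
       diff = (\<lambda>j v. T' (j - 1) (D j (?T j v))), aug = (\<lambda>v. E (?T 0 v))\<rparr>"
  show thesis
  proof (rule that[of F \<rho>])
    have "minimal_resolution G (\<lambda>j. {..<card (S j)}) (\<lambda>j. e j \<circ> \<rho> j)
        (\<lambda>j v. T' (j - 1) (D j (?T j v))) (\<lambda>v. E (?T 0 v))"
    proof (rule transport)
      fix j k assume "k \<in> {..<card (S j)}"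
      thus "(e j \<circ> \<rho> j) k \<in> monoid_span G"
        using \<rho>[of j] by (auto intro: deg simp: bij_betw_def)
    next
      fix j
      show "linear_map_on (poly_ring G) smult smult (gfree G {..<card (S j)}) (M j) (?T j)"
        by (rule mono_iso_linear[OF T])
      show "linear_map_on (poly_ring G) smult smult (M j) (gfree G {..<card (S j)}) (T' j)"
        by (rule mono_iso_linear[OF T'(1)])
    next
      fix j d and v :: "('r, 'k) fvec"
      show "ghom (e j) d (?T j v)"
        if "v \<in> gfree G {..<card (S j)}" "ghom (e j \<circ> \<rho> j) d v"
        using that by (rule mono_iso_ghom[OF T])
      show "ghom (e j \<circ> \<rho> j) d (T' j v)" if "v \<in> M j" "ghom (e j) d v"
        using that by (rule mono_iso_ghom[OF T'(1)])
    qed (use T' in auto)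
    thus "graded_minimal_free_resolution G F"
      by (simp add: graded_minimal_free_resolution_iff F_def)
  qed (auto simp: F_def \<rho>)
qed

text \<open>The semigroup ring is generated by 1. Some basis element of degree 0 has nonzero image,
  and a second basis element would differ from a multiple of it by a cycle with constant coefficient
  1.\<close>

lemma rank_one:
  assumes "0 \<notin> G"
  obtains i where "S 0 = {i}"
proof -
  have "single 0 1 \<in> semigroup_ring (monoid_span G)"
    by (auto simp: semigroup_ring_def monoid_span.zero)
  then obtain v where v: "v \<in> M 0" "ghom (e 0) 0 v" "E v = single 0 1"
    by (rule homogeneous_lift_E[of _ 0]) auto
  have "(\<Sum>i\<in>keys v. to_semigroup_ring (lookup v i) * E (single i 1)) \<noteq> 0"
    using linear_map_on_basis[OF E_lin v(1)] v(3) by (metis keys_single keys_zero insert_not_empty zero_neq_one)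
  then obtain i where i: "i \<in> keys v" "E (single i 1) \<noteq> 0"
    by (metis (no_types, lifting) mult_zero_right sum.neutral)
  have iS: "i \<in> S 0" using v(1) i by (auto simp: gfree_def)
  have "lookup v i \<noteq> 0" using i by (auto simp: in_keys_iff)
  then obtain m where "m \<in> keys (lookup v i)" by (metis all_not_in_conv keys_eq_empty)
  hence "mon_deg m + e 0 i = 0" using v(2) i by (auto simp: ghom_def)
  hence ei: "e 0 i = 0" by (auto simp: vec_eq_iff)
  have Ei: "keys (E (single i 1)) \<subseteq> {0}" using E_hom[OF basis[OF iS] ghom_basis] ei by simp
  define a where "a = lookup (E (single i 1)) 0"
  have Ea: "E (single i 1) = single 0 a"
    by (rule poly_mapping_eqI) (use Ei in \<open>auto simp: a_def lookup_single when_def in_keys_iff subset_iff\<close>)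
  hence a: "a \<noteq> 0" using i by auto
  have "l = i" if l: "l \<in> S 0" for l
  proof (rule ccontr)
    assume ne: "l \<noteq> i"
    define b where "b = lookup (E (single l 1)) (e 0 l)"
    have "keys (E (single l 1)) \<subseteq> {e 0 l}" using E_hom[OF basis[OF l] ghom_basis] by simp
    hence Eb: "E (single l 1) = single (e 0 l) b"
      by (intro poly_mapping_eqI) (auto simp: b_def lookup_single when_def in_keys_iff subset_iff)
    obtain m where m: "keys m \<subseteq> G" "mon_deg m = e 0 l"
      using span_is_mon_deg[OF deg[OF l]] by blast
    \<comment> \<open>Chosen to have the image of \<open>e_l\<close>: multiplying \<open>e_i\<close>
      by a monomial of degree \<open>e 0 l\<close> moves its image \<open>a\<close> into that
      degree, and \<open>b / a\<close> corrects the coefficient.\<close>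
    let ?w = "smult (single m (b / a)) (single i 1)"
    have w: "?w \<in> M 0" using iS m by (intro gfree_smult poly_ring_single basis)
    have "E ?w = single (e 0 l) b"
      using E_smult[OF poly_ring_single[OF m(1)] basis[OF iS], of "b / a"] a m
      by (simp add: Ea to_semigroup_ring_single mult_single)
    hence "single l 1 - ?w \<in> cyc 0"
      using linear_map_on_diff[OF E_lin basis[OF l] w] Eb
      by (simp add: cyc_0 gfree_diff w basis l del: smult_single)
    from cyc_minimal[OF this, of l] show False
      using ne by (simp add: lookup_minus lookup_single when_def lookup_one)
  qed
  hence "S 0 = {i}" using iS by blast
  thus thesis by (rule that)
qed

end

text \<open>The test resolution \<open>F'\<close> has the same bases and degrees as
  \<open>F\<close>, and agrees with it below degree \<open>n\<close>. A monomial map to it must be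
  multiplication by one scalar there, and so has no freedom left to absorb the change made in degree
  \<open>n\<close>.\<close>

theorem strongly_indispensable_imp_incomparable:
  fixes F :: "('r::finite, 'k::field) based_complex"
  assumes SI: "strongly_indispensable G F" and G: "0 \<notin> G"
  shows "incomparable G {..<betti F n} (bdeg F n)"
  unfolding incomparable_def
proof (intro ballI impI)
  fix k l g
  assume k: "k \<in> {..<betti F n}" and l: "l \<in> {..<betti F n}" and g: "g \<in> monoid_span G"
    and eq: "bdeg F n k = bdeg F n l + g"
  have F: "graded_minimal_free_resolution G F"
    using SI by (simp add: strongly_indispensable_def)
  then interpret minimal_resolution G "\<lambda>j. {..<betti F j}" "bdeg F" "diff F" "aug F"
    by (simp add: graded_minimal_free_resolution_iff)
  show "k = l"
  proof (cases n)
    case 0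
    thus ?thesis using k l rank_one[OF G] by (metis singletonD)
  next
    case (Suc j)
    show ?thesis
    proof (rule ccontr)
      assume ne: "k \<noteq> l"
      obtain m where m: "keys m \<subseteq> G" "mon_deg m = g"
        using span_is_mon_deg[OF g] by blast
      \<comment> \<open>An elementary change of basis in degree \<open>n\<close>, the identity
        elsewhere. It is graded because \<open>m\<close> has degree \<open>g\<close>, and
        \<open>A (- a)\<close> inverts \<open>A a\<close> because \<open>k\<close> and
        \<open>l\<close> differ.\<close>
      define A :: "'k \<Rightarrow> nat \<Rightarrow> ('r, 'k) fvec \<Rightarrow> ('r, 'k) fvec" where
        "A a i = lin (\<lambda>i'. if i = n \<and> i' = k then single k 1 + single l (single m a) else single i' 1)" for a i
      have A_id: "A a i v = v" if "i \<noteq> n" for a i v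
      proof -
        have "A a i v = lin (\<lambda>i'. single i' 1) v" using that by (simp add: A_def)
        also have "\<dots> = v" by (simp add: lin_def poly_mapping_sum_single)
        finally show ?thesis .
      qed
      have A_lin: "linear_map_on (poly_ring G) smult smult (M i) (M i) (A a i)" for a i
        unfolding A_def
        by (rule lin_linear) (use k l m in \<open>auto intro!: gfree_add gfree_single poly_ring_single\<close>)
      have A_hom: "ghom (bdeg F i) d (A a i v)" if "ghom (bdeg F i) d v" for a i d v
        unfolding A_def
      proof (rule lin_ghom[OF that])
        fix i'
        have "ghom (bdeg F n) (bdeg F n k) (single l (single m a))"
          using ghom_single_single[of "bdeg F n" m l a] eq m by (simp add: add.commute)
        thus "ghom (bdeg F i) (bdeg F i i')
            (if i = n \<and> i' = k then single k 1 + single l (single m a) else single i' 1)"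
          by (auto intro: ghom_add ghom_basis)
      qed
      have A_inv: "A (- a) i (A a i v) = v" if "v \<in> M i" for a i v
        unfolding A_def
        by (rule lin_lin_id[OF that])
           (use ne in \<open>auto simp: lin_add single_uminus simp flip: single_add\<close>)
      \<comment> \<open>Only the differentials leaving and entering degree \<open>n\<close> change.
        As \<open>n\<close> is positive, the augmentation stays the same and \<open>f\<close> is a
        chain endomorphism of \<open>F\<close> below \<open>n\<close>.\<close>
      define F' where "F' = F\<lparr>diff := (\<lambda>j v. A (- 1) (j - 1) (diff F j (A 1 j v))),
        aug := (\<lambda>v. aug F (A 1 0 v))\<rparr>"
      have "minimal_resolution G (\<lambda>j. {..<betti F j}) (bdeg F)
        (\<lambda>j v. A (- 1) (j - 1) (diff F j (A 1 j v))) (\<lambda>v. aug F (A 1 0 v))"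
        by (rule transport[OF _ _ A_lin A_lin])
           (use A_inv[of _ _ 1] A_inv[of _ _ "- 1"] in \<open>auto intro: A_hom deg\<close>)
      hence "graded_minimal_free_resolution G F'"
        by (simp add: graded_minimal_free_resolution_iff F'_def)
      then obtain f where f: "injective_complex_map G F F' f"
        using SI by (auto simp: strongly_indispensable_def)
      have f_lin: "linear_map_on (poly_ring G) smult smult (M i) (M i) (f i)" for i
        using f by (simp add: injective_complex_map_def cmod_def free_module_eq F'_def)
      have f_comm: "f i (diff F (Suc i) v) = A (- 1) i (diff F (Suc i) (A 1 (Suc i) (f (Suc i) v)))"
        if "v \<in> M (Suc i)" for i v
        using f that by (simp add: injective_complex_map_def cmod_def free_module_eq F'_def)
      have f_basis: "\<exists>l < betti F i. \<exists>c. c \<noteq> 0 \<and> f i (single k 1) = single l (single 0 c)"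
        if "k < betti F i" for k i
        using f that by (simp add: injective_complex_map_def F'_def)
      \<comment> \<open>With a single basis element in degree 0, a monomial map has no choice but to
        scale it; this is the origin of \<open>c\<close>.\<close>
      obtain i0 where i0: "{..<betti F 0} = {i0}" using rank_one[OF G] by metis
      hence i0': "i < betti F 0 \<longleftrightarrow> i = i0" for i by (metis lessThan_iff singleton_iff)
      obtain l0 c where "l0 < betti F 0" "c \<noteq> 0" "f 0 (single i0 1) = single l0 (single 0 c)"
        using f_basis[of i0 0] i0'[of i0] by metis
      hence c: "c \<noteq> 0" "f 0 (single i0 1) = single i0 (single 0 c)" using i0'[of l0] by simp_all
      have scal: "f i v = smult (single 0 c) v"
        if "\<forall>i'<betti F i. f i (single i' 1) = single i' (single 0 c)" "v \<in> M i" for i v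
      proof -
        have "f i v = lin (\<lambda>i'. f i (single i' 1)) v"
          by (rule linear_map_on_lin[OF f_lin that(2)])
        also have "\<dots> = lin (\<lambda>i'. smult (single 0 c) (single i' 1)) v"
          by (rule lin_cong[OF that(2)]) (use that(1) in auto)
        also have "\<dots> = smult (single 0 c) v"
          by (rule sym, rule linear_map_on_lin[OF _ that(2), where N=UNIV])
             (auto simp: linear_map_on_iff smult_add_right smult_smult mult.commute)
        finally show ?thesis .
      qed
      \<comment> \<open>The image of a basis element and \<open>c\<close> times that element have
        equal boundary, so their difference is a cycle. Its vanishing constant terms force the same
        index and the same scalar.\<close>
      have low: "\<forall>i'<betti F i. f i (single i' 1) = single i' (single 0 c)" if "i \<le> j" for i
        using that
      proof (induction i)
        case 0
        thus ?case using i0' c by simp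
      next
        case (Suc i)
        show ?case
        proof (intro allI impI)
          fix i' assume i': "i' < betti F (Suc i)"
          hence b: "single i' 1 \<in> M (Suc i)" by (simp add: basis)
          obtain l' c' where l': "l' < betti F (Suc i)" "c' \<noteq> 0" "f (Suc i) (single i' 1) = single l' (single 0 c')"
            using f_basis[OF i'] by auto
          have M': "single l' (single 0 c') \<in> M (Suc i)" using l' by (simp add: gfree_single)
          have "smult (single 0 c) (diff F (Suc i) (single i' 1)) = f i (diff F (Suc i) (single i' 1))"
            using Suc b by (simp add: scal D_closed)
          also have "\<dots> = diff F (Suc i) (single l' (single 0 c'))"
            using f_comm[OF b] Suc.prems \<open>n = Suc j\<close> by (simp add: A_id l')
          finally have "diff F (Suc i) (single l' (single 0 c') - smult (single 0 c) (single i' 1)) = 0"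
            using M' b by (simp add: linear_map_on_diff[OF D_lin] gfree_smult D_smult del: smult_single)
          hence "single l' (single 0 c') - smult (single 0 c) (single i' 1) \<in> cyc (Suc i)"
            unfolding cyc_Suc using M' b by (simp add: gfree_diff gfree_smult del: smult_single)
          from cyc_minimal[OF this, of i'] have "l' = i' \<and> c' = c"
            using \<open>c \<noteq> 0\<close> by (auto simp: lookup_minus lookup_single when_def split: if_splits)
          thus "f (Suc i) (single i' 1) = single i' (single 0 c)" using l' by simp
        qed
      qed
      note n = \<open>n = Suc j\<close>
      have b: "single k 1 \<in> M (Suc j)" using k n by (simp add: basis)
      obtain l' c' where l': "l' < betti F (Suc j)" "c' \<noteq> 0" "f (Suc j) (single k 1) = single l' (single 0 c')"
        using f_basis[of k "Suc j"] k n by auto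
      \<comment> \<open>In degree \<open>n\<close> the differential of \<open>F'\<close> is that of
        \<open>F\<close> after \<open>A 1\<close>, so the value of \<open>f\<close> must be compared
        through \<open>A 1\<close>.\<close>
      let ?u = "A 1 (Suc j) (single l' (single 0 c'))"
      have M': "?u \<in> M (Suc j)"
        using A_lin[of "Suc j" 1] l' by (simp add: linear_map_on_iff gfree_single)
      have "smult (single 0 c) (diff F (Suc j) (single k 1)) = f j (diff F (Suc j) (single k 1))"
        using low b by (simp add: scal D_closed)
      also have "\<dots> = diff F (Suc j) ?u"
        using f_comm[OF b] n by (simp add: A_id l')
      finally have "diff F (Suc j) (?u - smult (single 0 c) (single k 1)) = 0"
        using M' b by (simp add: linear_map_on_diff[OF D_lin] gfree_smult D_smult del: smult_single)
      hence u: "?u - smult (single 0 c) (single k 1) \<in> cyc (Suc j)"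
        unfolding cyc_Suc using M' b by (simp add: gfree_diff gfree_smult del: smult_single)
      have "l' = k \<and> c' = c"
        using cyc_minimal[OF u, of k] \<open>c \<noteq> 0\<close> ne n
        by (auto simp: A_def lookup_minus lookup_single lookup_add mult_single when_def lookup_mult_0 split: if_splits)
      \<comment> \<open>Only the term added by \<open>A 1\<close> survives. Cancelling its monomial
        makes \<open>e_l\<close> itself a cycle, which minimality forbids.\<close>
      hence "?u - smult (single 0 c) (single k 1) = smult (single m c) (single l 1)"
        using n by (simp add: A_def smult_add_right mult_single)
      hence "diff F (Suc j) (smult (single m c) (single l 1)) = 0"
        using u by (simp add: cyc_Suc del: smult_single)
      hence 0: "smult (single m c) (diff F (Suc j) (single l 1)) = 0"
        using m l n by (simp add: D_smult poly_ring_single basis del: smult_single)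
      have "diff F (Suc j) (single l 1) = 0"
      proof (rule poly_mapping_eqI)
        fix i
        have "lookup (smult (single m c) (diff F (Suc j) (single l 1))) i = 0" using 0 by simp
        hence "lookup (diff F (Suc j) (single l 1)) i = 0"
          using single_mult_eq_0[of m c] \<open>c \<noteq> 0\<close> by simp
        thus "lookup (diff F (Suc j) (single l 1)) i = lookup 0 i" by simp
      qed
      thus False using D_basis_nonzero[of l j] l n by simp
    qed
  qed
qed

text \<open>Lifting forth by \<open>V\<close> and back by \<open>U\<close> agrees with the identity
  up to the kernel of \<open>d\<close>, whose elements have no constant terms. Hence one matrix of
  constants is a one-sided inverse of the other. The target type is left open to cover the
  augmentation and the differentials together.\<close>

lemma lift_constants:
  fixes d :: "('r::finite, 'k::field) fvec \<Rightarrow> 't::ab_group_add" and d' :: "('r, 'k) fvec \<Rightarrow> 't"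
  assumes fin: "finite S'"
    and d: "linear_map_on (poly_ring G) smult t (gfree G S) N d"
    and d': "linear_map_on (poly_ring G) smult t (gfree G S') N d'"
    and ker: "\<And>v k. v \<in> gfree G S \<Longrightarrow> d v = 0 \<Longrightarrow> lookup (lookup v k) 0 = 0"
    and V: "\<And>k. k \<in> S \<Longrightarrow> V k \<in> gfree G S' \<and> d' (V k) = d (single k 1)"
    and U: "\<And>l. l \<in> S' \<Longrightarrow> U l \<in> gfree G S \<and> d (U l) = d' (single l 1)"
    and k: "k \<in> S"
  shows "(\<Sum>l\<in>S'. lookup (lookup (V k) l) 0 * lookup (lookup (U l) i) 0) = (if k = i then 1 else 0)"
proof -
  have Vk: "V k \<in> gfree G S'" using V k by blast
  have UV: "lin U (V k) \<in> gfree G S" by (rule lin_closed[OF Vk]) (use U in blast)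
  have keysV: "keys (V k) \<subseteq> S'" using Vk by (simp add: gfree_def)
  have "d (lin U (V k)) = (\<Sum>l\<in>keys (V k). d (smult (lookup (V k) l) (U l)))"
    unfolding lin_def
  proof (rule linear_map_on_sum[OF d])
    fix l assume "l \<in> keys (V k)"
    thus "smult (lookup (V k) l) (U l) \<in> gfree G S"
      using keysV U Vk by (intro gfree_smult) (auto simp: gfree_def)
  qed
  also have "\<dots> = (\<Sum>l\<in>keys (V k). t (lookup (V k) l) (d' (single l 1)))"
  proof (rule sum.cong[OF refl])
    fix l assume "l \<in> keys (V k)"
    hence "l \<in> S'" "lookup (V k) l \<in> poly_ring G" using Vk by (auto simp: gfree_def)
    thus "d (smult (lookup (V k) l) (U l)) = t (lookup (V k) l) (d' (single l 1))"
      using U d by (simp add: linear_map_on_iff)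
  qed
  also have "\<dots> = d' (V k)" by (rule linear_map_on_basis[OF d' Vk, symmetric])
  also have "\<dots> = d (single k 1)" using V k by blast
  finally have "d (lin U (V k) - single k 1) = 0"
    using k by (simp add: linear_map_on_diff[OF d UV] gfree_single)
  from ker[OF gfree_diff[OF UV] this, of i] k
  have "lookup (lookup (lin U (V k)) i) 0 = (if k = i then 1 else 0)"
    by (auto simp: gfree_single lookup_minus lookup_single when_def lookup_one)
  moreover have "lookup (lookup (lin U (V k)) i) 0 = (\<Sum>l\<in>S'. lookup (lookup (V k) l) 0 * lookup (lookup (U l) i) 0)"
    unfolding lin_lookup_0
    by (rule sum.mono_neutral_left[OF fin keysV]) (auto simp: in_keys_iff)
  ultimately show ?thesis by simp
qed

text \<open>The constant matrices \<open>a\<close> and \<open>b\<close> of two opposite lifts are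
  inverse and connect only equal degrees. Since degrees in \<open>S\<close> are distinct, each row
  has one usable entry, and the degrees in \<open>S'\<close> turn out to be the same ones. A
  nonconstant entry of a lift would then compare two degrees of \<open>S\<close>, so the lift is
  monomial.\<close>

lemma mono_iso_step:
  fixes d :: "('r::finite, 'k::field) fvec \<Rightarrow> 't::ab_group_add" and d' :: "('r, 'k) fvec \<Rightarrow> 't"
  assumes G: "0 \<notin> G"
    and fin: "finite S" "finite S'"
    and d: "linear_map_on (poly_ring G) smult t (gfree G S) N d"
    and d': "linear_map_on (poly_ring G) smult t (gfree G S') N d'"
    and ker: "\<And>v k. v \<in> gfree G S \<Longrightarrow> d v = 0 \<Longrightarrow> lookup (lookup v k) 0 = 0"
    and ker': "\<And>v k. v \<in> gfree G S' \<Longrightarrow> d' v = 0 \<Longrightarrow> lookup (lookup v k) 0 = 0"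
    and V: "\<And>k. k \<in> S \<Longrightarrow> \<exists>v\<in>gfree G S'. ghom e' (e k) v \<and> d' v = d (single k 1)"
    and U: "\<And>l. l \<in> S' \<Longrightarrow> \<exists>u\<in>gfree G S. ghom e (e' l) u \<and> d u = d' (single l 1)"
    and inc: "incomparable G S e"
  obtains f where "mono_iso S e S' e' f" "\<And>v. v \<in> gfree G S \<Longrightarrow> d v = d' (f v)"
proof -
  obtain V where V: "\<And>k. k \<in> S \<Longrightarrow> V k \<in> gfree G S' \<and> ghom e' (e k) (V k) \<and> d' (V k) = d (single k 1)"
    using V by metis
  obtain U where U: "\<And>k. k \<in> S' \<Longrightarrow> U k \<in> gfree G S \<and> ghom e (e' k) (U k) \<and> d (U k) = d' (single k 1)"
    using U by metis
  define a b where "a k l = lookup (lookup (V k) l) 0" and "b l k = lookup (lookup (U l) k) 0" for k l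
  have ab: "(\<Sum>l\<in>S'. a k l * b l i) = (if k = i then 1 else 0)" if "k \<in> S" for k i
    unfolding a_def b_def
    by (rule lift_constants[OF fin(2) d d' ker]) (use V U that in auto)
  have ba: "(\<Sum>k\<in>S. b l k * a k i) = (if l = i then 1 else 0)" if "l \<in> S'" for l i
    unfolding a_def b_def
    by (rule lift_constants[OF fin(1) d' d ker']) (use V U that in auto)
  have a_deg: "e' l = e k" if "k \<in> S" "a k l \<noteq> 0" for k l
    using V[OF that(1)] that(2) unfolding a_def ghom_alt by (metis add_0 mon_deg_0)
  have b_deg: "e' l = e k" if "l \<in> S'" "b l k \<noteq> 0" for k l
    using U[OF that(1)] that(2) unfolding b_def ghom_alt by (metis add_0 mon_deg_0)
  have inj: "k = k'" if "k \<in> S" "k' \<in> S" "e k = e k'" for k k'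
    using incomparableD[OF inc that(1,2) monoid_span.zero] that(3) by simp
  have ex_l: "\<exists>l\<in>S'. a k l \<noteq> 0 \<and> e' l = e k" if "k \<in> S" for k
  proof -
    have "(\<Sum>l\<in>S'. a k l * b l k) \<noteq> 0" using ab[OF that] by simp
    then obtain l where "l \<in> S'" "a k l * b l k \<noteq> 0" by (meson sum.neutral)
    thus ?thesis using a_deg[OF that] by auto
  qed
  \<comment> \<open>At most one \<open>k\<close> shares the degree of \<open>l\<close>, so the
    diagonal sum collapses to a single product, which must be 1.\<close>
  have ex_k: "\<exists>k\<in>S. e' l = e k \<and> b l k * a k l = 1" if l: "l \<in> S'" for l
  proof -
    have "(\<Sum>k\<in>S. b l k * a k l) \<noteq> 0" using ba[OF that] by simp
    then obtain k where k: "k \<in> S" "b l k * a k l \<noteq> 0" by (meson sum.neutral)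
    have "b l k' * a k' l = 0" if "k' \<in> S - {k}" for k'
      using that b_deg[OF l, of k'] b_deg[OF l, of k] inj[of k k'] k by fastforce
    hence "(\<Sum>k\<in>S. b l k * a k l) = b l k * a k l"
      using k by (subst sum.remove[OF fin(1) k(1)]) (simp add: sum.neutral)
    moreover have "b l k \<noteq> 0" using k by auto
    ultimately show ?thesis using k(1) b_deg[OF l, of k] ba[OF l, of l] by auto
  qed
  \<comment> \<open>Two indices of equal degree would pair with the same \<open>k\<close>. The
    off-diagonal product \<open>b l k * a k l'\<close> would then have to vanish although both
    factors are nonzero.\<close>
  have inj': "l = l'" if l: "l \<in> S'" "l' \<in> S'" "e' l = e' l'" for l l'
  proof (rule ccontr)
    assume ne: "l \<noteq> l'"
    obtain k k' where k: "k \<in> S" "e' l = e k" "b l k * a k l = 1"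
      and k': "k' \<in> S" "e' l' = e k'" "b l' k' * a k' l' = 1"
      using ex_k l by meson
    have "k = k'" using inj k k' l by simp
    have "b l i * a i l' = 0" if "i \<in> S - {k}" for i
      using that b_deg[OF l(1), of i] inj[of i k] k by fastforce
    hence "(\<Sum>i\<in>S. b l i * a i l') = b l k * a k l'"
      using k by (subst sum.remove[OF fin(1) k(1)]) (simp add: sum.neutral)
    hence "b l k * a k l' = 0" using ba[OF l(1), of l'] ne by simp
    thus False using k(3) k'(3) \<open>k = k'\<close> by auto
  qed
  obtain \<pi> where \<pi>: "\<And>k. k \<in> S \<Longrightarrow> \<pi> k \<in> S' \<and> a k (\<pi> k) \<noteq> 0 \<and> e' (\<pi> k) = e k"
    using ex_l by metis
  have bij: "bij_betw \<pi> S S'"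
    unfolding bij_betw_def
  proof (intro conjI inj_onI equalityI subsetI)
    fix x y assume "x \<in> S" "y \<in> S" "\<pi> x = \<pi> y"
    thus "x = y" using \<pi> inj by metis
  next
    fix l assume l: "l \<in> S'"
    then obtain k where "k \<in> S" "e' l = e k" using ex_k by blast
    hence "l = \<pi> k" using inj'[OF l] \<pi> by simp
    thus "l \<in> \<pi> ` S" using \<open>k \<in> S\<close> by blast
  qed (use \<pi> in auto)
  \<comment> \<open>The degree of \<open>l\<close> is also a degree of some \<open>k'\<close> in
    \<open>S\<close>, so any term of \<open>V k\<close> yields a comparison inside \<open>S\<close>.
    Incomparability leaves only the constant at \<open>\<pi> k\<close>.\<close>
  have V_eq: "V k = single (\<pi> k) (single 0 (a k (\<pi> k)))" if k: "k \<in> S" for k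
  proof (rule fvec_eqI)
    fix l m
    show "lookup (lookup (V k) l) m = lookup (lookup (single (\<pi> k) (single 0 (a k (\<pi> k)))) l) m"
    proof (cases "lookup (lookup (V k) l) m = 0")
      case True
      thus ?thesis by (auto simp: lookup_single when_def a_def)
    next
      case False
      hence "lookup (V k) l \<noteq> 0" by auto
      hence l: "l \<in> S'" using V[OF k] by (auto simp: gfree_def in_keys_iff)
      have "lookup (V k) l \<in> poly_ring G" using V[OF k] by (simp add: gfree_def)
      hence m: "keys m \<subseteq> G" using False by (auto simp: poly_ring_def in_keys_iff)
      have eq: "e k = e' l + mon_deg m" using V[OF k] False by (metis ghom_alt add.commute)
      obtain k' where k': "k' \<in> S" "e' l = e k'" using ex_k[OF l] by blast
      have "k = k'"
        using incomparableD[OF inc k k'(1) mon_deg_in_span[OF m]] eq k' by simp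
      hence "mon_deg m = 0" using eq k' by simp
      hence "m = 0" by (rule mon_deg_eq_0[OF m G])
      moreover have "l = \<pi> k" using inj'[OF l] \<pi>[OF k] k' \<open>k = k'\<close> by simp
      ultimately show ?thesis by (simp add: a_def)
    qed
  qed
  let ?f = "lin (\<lambda>k. single (\<pi> k) (single 0 (a k (\<pi> k))))"
  show thesis
  proof (rule that[of ?f])
    show iso: "mono_iso S e S' e' ?f"
      unfolding mono_iso_def using bij \<pi>
      by (intro exI[of _ \<pi>] exI[of _ "\<lambda>k. a k (\<pi> k)"]) auto
    fix v :: "('r, 'k) fvec" assume v: "v \<in> gfree G S"
    have "linear_map_on (poly_ring G) smult t (gfree G S) N (\<lambda>v. d' (?f v))"
      using mono_iso_linear[OF iso, of G] d' by (simp add: linear_map_on_iff)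
    from linear_map_on_basis[OF this v]
    have "d' (?f v) = (\<Sum>k\<in>keys v. t (lookup v k) (d' (?f (single k 1))))" .
    also have "\<dots> = (\<Sum>k\<in>keys v. t (lookup v k) (d (single k 1)))"
    proof (rule sum.cong[OF refl])
      fix k assume "k \<in> keys v"
      hence "k \<in> S" using v by (auto simp: gfree_def)
      thus "t (lookup v k) (d' (?f (single k 1))) = t (lookup v k) (d (single k 1))"
        using V[of k] V_eq[of k] by simp
    qed
    also have "\<dots> = d v" by (rule linear_map_on_basis[OF d v, symmetric])
    finally show "d v = d' (?f v)" ..
  qed
qed

theorem incomparable_imp_strongly_indispensable:
  fixes F :: "('r::finite, 'k::field) based_complex"
  assumes F: "graded_minimal_free_resolution G F" and G: "0 \<notin> G"
    and inc: "\<And>n. incomparable G {..<betti F n} (bdeg F n)"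
  shows "strongly_indispensable G F"
  unfolding strongly_indispensable_def
proof (intro conjI F allI impI)
  fix F' :: "('r, 'k) based_complex" assume F': "graded_minimal_free_resolution G F'"
  interpret minimal_resolution G "\<lambda>j. {..<betti F j}" "bdeg F" "diff F" "aug F"
    using F by (simp add: graded_minimal_free_resolution_iff)
  interpret R: minimal_resolution G "\<lambda>j. {..<betti F' j}" "bdeg F'" "diff F'" "aug F'"
    using F' by (simp add: graded_minimal_free_resolution_iff)
  let ?iso = "\<lambda>n. mono_iso {..<betti F n} (bdeg F n) {..<betti F' n} (bdeg F' n)"
  \<comment> \<open>The second conjunct is the invariant of the recursion: cycles correspond in
    degree \<open>n\<close>, so boundaries of basis elements can be lifted in both directions one
    degree higher.\<close>
  let ?P = "\<lambda>n f. ?iso n f \<and> (\<forall>v\<in>M n. v \<in> cyc n \<longleftrightarrow> f v \<in> R.cyc n)"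
  let ?Q = "\<lambda>n f g. \<forall>v\<in>M (Suc n). f (diff F (Suc n) v) = diff F' (Suc n) (g v)"
  have "\<exists>f. \<forall>n. ?P n (f n) \<and> ?Q n (f n) (f (Suc n))"
  proof (rule dependent_nat_choice[where P="?P" and Q="?Q"])
    show "\<exists>f. ?P 0 f"
    proof (rule mono_iso_step[OF G _ _ E_lin R.E_lin])
      show "lookup (lookup v k) 0 = 0" if "v \<in> M 0" "aug F v = 0" for v k
        using cyc_minimal[of v 0 k] that by (simp add: cyc_0)
      show "lookup (lookup v k) 0 = 0" if "v \<in> R.M 0" "aug F' v = 0" for v k
        using R.cyc_minimal[of v 0 k] that by (simp add: R.cyc_0)
      show "\<exists>v\<in>R.M 0. ghom (bdeg F' 0) (bdeg F 0 k) v \<and> aug F' v = aug F (single k 1)"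
        if k: "k \<in> {..<betti F 0}" for k
        using R.homogeneous_lift_E[OF E_closed[OF basis[OF k]] E_hom[OF basis[OF k] ghom_basis]] by metis
      show "\<exists>v\<in>M 0. ghom (bdeg F 0) (bdeg F' 0 k) v \<and> aug F v = aug F' (single k 1)"
        if k: "k \<in> {..<betti F' 0}" for k
        using homogeneous_lift_E[OF R.E_closed[OF R.basis[OF k]] R.E_hom[OF R.basis[OF k] ghom_basis]] by metis
    next
      fix f assume f: "?iso 0 f" "\<And>v. v \<in> M 0 \<Longrightarrow> aug F v = aug F' (f v)"
      have "f v \<in> R.M 0" if "v \<in> M 0" for v
        using mono_iso_linear[OF f(1), of G] that by (simp add: linear_map_on_iff)
      thus ?thesis using f by (intro exI[of _ f]) (simp add: cyc_0 R.cyc_0)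
    qed (use inc in auto)
  next
    fix f n assume f: "?P n f"
    obtain f' where f': "mono_iso {..<betti F' n} (bdeg F' n) {..<betti F n} (bdeg F n) f'"
      "\<And>G v. v \<in> gfree G {..<betti F n} \<Longrightarrow> f' (f v) = v"
      "\<And>G v. v \<in> gfree G {..<betti F' n} \<Longrightarrow> f (f' v) = v"
      using mono_iso_inverse[of "{..<betti F n}" "bdeg F n" "{..<betti F' n}" "bdeg F' n" f] f by blast
    have lin: "linear_map_on (poly_ring G) smult smult (M n) (R.M n) f"
      using f mono_iso_linear by blast
    have lin': "linear_map_on (poly_ring G) smult smult (R.M n) (M n) f'"
      using f'(1) mono_iso_linear by blast
    \<comment> \<open>The step lemma compares two maps with a common target, so \<open>f\<close> is
      composed onto the differential of \<open>F\<close>; injectivity of \<open>f\<close> keeps the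
      kernel.\<close>
    have d: "linear_map_on (poly_ring G) smult smult (M (Suc n)) (R.M n) (\<lambda>v. f (diff F (Suc n) v))"
      using lin D_lin[of n] by (simp add: linear_map_on_iff)
    have f0: "f v = 0 \<longleftrightarrow> v = 0" if "v \<in> M n" for v
      using f'(2)[OF that] linear_map_on_0[OF lin] linear_map_on_0[OF lin'] by auto
    have ker: "v \<in> M (Suc n) \<Longrightarrow> f (diff F (Suc n) v) = 0 \<longleftrightarrow> v \<in> cyc (Suc n)" for v
      by (simp add: f0 D_closed cyc_Suc)
    show "\<exists>g. ?P (Suc n) g \<and> ?Q n f g"
    proof (rule mono_iso_step[OF G _ _ d R.D_lin])
      show "lookup (lookup v k) 0 = 0" if "v \<in> M (Suc n)" "f (diff F (Suc n) v) = 0" for v k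
        using cyc_minimal[of v "Suc n" k] that ker by simp
      show "lookup (lookup v k) 0 = 0" if "v \<in> R.M (Suc n)" "diff F' (Suc n) v = 0" for v k
        using R.cyc_minimal[of v "Suc n" k] that by (simp add: R.cyc_Suc)
      show "\<exists>v\<in>R.M (Suc n). ghom (bdeg F' (Suc n)) (bdeg F (Suc n) k) v \<and>
          diff F' (Suc n) v = f (diff F (Suc n) (single k 1))"
        if k: "k \<in> {..<betti F (Suc n)}" for k
      proof -
        let ?w = "diff F (Suc n) (single k 1)"
        have w: "?w \<in> cyc n" using basis[OF k] by (simp add: cyc_def)
        have "ghom (bdeg F n) (bdeg F (Suc n) k) ?w" by (rule D_hom[OF basis[OF k] ghom_basis])
        hence "ghom (bdeg F' n) (bdeg F (Suc n) k) (f ?w)"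
          using mono_iso_ghom f cyc_sub[OF w] by blast
        moreover have "f ?w \<in> R.cyc n" using f w cyc_sub by blast
        ultimately show ?thesis using R.homogeneous_lift by metis
      qed
      show "\<exists>v\<in>M (Suc n). ghom (bdeg F (Suc n)) (bdeg F' (Suc n) k) v \<and>
          f (diff F (Suc n) v) = diff F' (Suc n) (single k 1)"
        if k: "k \<in> {..<betti F' (Suc n)}" for k
      proof -
        let ?w = "diff F' (Suc n) (single k 1)"
        have w: "?w \<in> R.cyc n" using R.basis[OF k] by (simp add: R.cyc_def)
        have "ghom (bdeg F' n) (bdeg F' (Suc n) k) ?w" by (rule R.D_hom[OF R.basis[OF k] ghom_basis])
        hence "ghom (bdeg F n) (bdeg F' (Suc n) k) (f' ?w)"
          using mono_iso_ghom f'(1) R.cyc_sub[OF w] by blast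
        moreover have "f' ?w \<in> M n" using lin' R.cyc_sub[OF w] by (simp add: linear_map_on_iff)
        hence "f' ?w \<in> cyc n" using f w f'(3)[OF R.cyc_sub[OF w]] by simp
        ultimately obtain v where "v \<in> M (Suc n)" "ghom (bdeg F (Suc n)) (bdeg F' (Suc n) k) v"
          "diff F (Suc n) v = f' ?w" using homogeneous_lift by metis
        thus ?thesis using f'(3)[OF R.cyc_sub[OF w]] by auto
      qed
    next
      fix g assume g: "?iso (Suc n) g"
        "\<And>v. v \<in> M (Suc n) \<Longrightarrow> f (diff F (Suc n) v) = diff F' (Suc n) (g v)"
      have "g v \<in> R.M (Suc n)" if "v \<in> M (Suc n)" for v
        using mono_iso_linear[OF g(1), of G] that by (simp add: linear_map_on_iff)
      moreover have "v \<in> cyc (Suc n) \<longleftrightarrow> diff F' (Suc n) (g v) = 0" if "v \<in> M (Suc n)" for v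
        using ker[OF that] g(2)[OF that] by simp
      ultimately show ?thesis using g by (intro exI[of _ g]) (simp add: R.cyc_Suc)
    qed (use inc in auto)
  qed
  then obtain f where f: "\<And>n. ?iso n (f n)" "\<And>n. ?Q n (f n) (f (Suc n))" by blast
  have "injective_complex_map G F F' f"
    unfolding injective_complex_map_def cmod_def free_module_eq
  proof (intro conjI allI impI)
    fix j
    show "linear_map_on (poly_ring G) smult smult (M j) (R.M j) (f j)"
      using f mono_iso_linear by blast
    show "\<forall>v\<in>M (Suc j). f j (diff F (Suc j) v) = diff F' (Suc j) (f (Suc j) v)"
      using f by blast
    show "inj_on (f j) (M j)"
      using mono_iso_inverse[OF f(1)[of j]] by (metis inj_onI)
    fix k assume k: "k < betti F j"
    obtain \<pi> c where "bij_betw \<pi> {..<betti F j} {..<betti F' j}" "\<forall>k\<in>{..<betti F j}. c k \<noteq> 0"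
      "f j = lin (\<lambda>k. single (\<pi> k) (single 0 (c k)))"
      using f(1)[of j] by (auto simp: mono_iso_def)
    thus "\<exists>l<betti F' j. \<exists>c. c \<noteq> 0 \<and> f j (single k 1) = single l (single 0 c)"
      using k by (intro exI[of _ "\<pi> k"] conjI exI[of _ "c k"]) (auto simp: bij_betw_def)
  qed
  thus "\<exists>i. injective_complex_map G F F' i" by blast
qed

section \<open>Direct sums of affine semigroups\<close>

text \<open>The irreducible elements, which form the unique minimal generating set of an affine
  semigroup.\<close>

definition atoms :: "(nat ^ 'r::finite) set \<Rightarrow> (nat ^ 'r) set" where
  "atoms \<Gamma> = {a \<in> \<Gamma>. a \<noteq> 0 \<and> (\<forall>x\<in>\<Gamma>. \<forall>y\<in>\<Gamma>. a = x + y \<longrightarrow> x = 0 \<or> y = 0)}"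

lemma vec_nat_add_eq_0: "(x :: nat ^ 'r::finite) + y = 0 \<longleftrightarrow> x = 0 \<and> y = 0"
  by (auto simp: vec_eq_iff)

lemma atoms_subset: "atoms (monoid_span G) \<subseteq> G"
proof
  fix a assume a: "a \<in> atoms (monoid_span G)"
  hence "a \<in> monoid_span G" by (simp add: atoms_def)
  thus "a \<in> G" using a
  proof (induction rule: monoid_span.induct)
    case zero
    thus ?case by (simp add: atoms_def)
  next
    case (add g x)
    hence "g = 0 \<or> x = 0" by (auto simp: atoms_def monoid_span_base)
    thus ?case using add by auto
  qed
qed

text \<open>A nonzero element that is not an atom splits into two nonzero ones with smaller
  coordinate sums, so splitting terminates in atoms.\<close>

lemma monoid_span_atoms: "monoid_span (atoms (monoid_span G)) = monoid_span (G :: (nat ^ 'r::finite) set)"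
proof
  show "monoid_span (atoms (monoid_span G)) \<subseteq> monoid_span G"
    by (rule monoid_span_mono[OF atoms_subset])
  have "a \<in> monoid_span (atoms (monoid_span G))" if "a \<in> monoid_span G" for a
    using that
  proof (induction "\<Sum>i\<in>UNIV. a $ i" arbitrary: a rule: less_induct)
    case less
    consider "a = 0" | "a \<in> atoms (monoid_span G)" |
      x y where "x \<in> monoid_span G" "y \<in> monoid_span G" "a = x + y" "x \<noteq> 0" "y \<noteq> 0"
      using less.prems unfolding atoms_def by blast
    thus ?case
    proof cases
      case 3
      have pos: "(\<Sum>i\<in>UNIV. z $ i) > 0" if "z \<noteq> 0" for z :: "nat ^ 'r"
      proof (rule ccontr)
        assume "\<not> (\<Sum>i\<in>UNIV. z $ i) > 0"
        hence "\<forall>i. z $ i = 0" by simp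
        thus False using that by (simp add: vec_eq_iff)
      qed
      have "x \<in> monoid_span (atoms (monoid_span G))" "y \<in> monoid_span (atoms (monoid_span G))"
        using less.hyps[of x] less.hyps[of y] 3 pos[of x] pos[of y] by (simp_all add: sum.distrib)
      thus ?thesis using 3 by (simp add: monoid_span_add)
    qed (auto intro: monoid_span.zero monoid_span_base)
  qed
  thus "monoid_span G \<subseteq> monoid_span (atoms (monoid_span G))" by blast
qed

text \<open>Every generating set contains the atoms, and the atoms already generate. Consequently
  the set chosen inside \<open>has_SIFR\<close> coincides with any given minimal generating
  set.\<close>

lemma minimally_generates_iff:
  "minimally_generates G \<Gamma> \<longleftrightarrow> finite G \<and> monoid_span G = \<Gamma> \<and> G = atoms \<Gamma>"
proof
  assume m: "minimally_generates G \<Gamma>"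
  hence s: "monoid_span G = \<Gamma>" by (simp add: minimally_generates_def)
  hence "atoms \<Gamma> \<subseteq> G" "monoid_span (atoms \<Gamma>) = \<Gamma>"
    using atoms_subset[of G] monoid_span_atoms[of G] by auto
  hence "G = atoms \<Gamma>" using m unfolding minimally_generates_def by blast
  thus "finite G \<and> monoid_span G = \<Gamma> \<and> G = atoms \<Gamma>"
    using m by (simp add: minimally_generates_def)
next
  assume "finite G \<and> monoid_span G = \<Gamma> \<and> G = atoms \<Gamma>"
  thus "minimally_generates G \<Gamma>"
    unfolding minimally_generates_def using atoms_subset by blast
qed

section \<open>From independent extremal rays to a direct sum\<close>

lemma rat_vec_add: "rat_vec (a + b) = rat_vec a + rat_vec b"
  by (simp add: rat_vec_def vec_eq_iff)

lemma inj_rat_vec: "inj rat_vec"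
  by (auto simp: inj_def rat_vec_def vec_eq_iff)

lemma rat_vec_in_cone: "a \<in> A \<Longrightarrow> rat_vec a \<in> rat_cone A"
  unfolding rat_cone_def by (intro CollectI exI[of _ "{a}"] exI[of _ "\<lambda>_. 1"]) auto

text \<open>Writing an extremal ray as a generator plus a remainder, the generator lies on the same ray
  and is at most its smallest element, so the remainder vanishes.\<close>

lemma extremal_rays_subset:
  fixes G :: "(nat ^ 'r::finite) set"
  shows "extremal_rays (monoid_span G) \<subseteq> G"
proof
  fix a assume a: "a \<in> extremal_rays (monoid_span G)"
  hence "a \<in> monoid_span G" by (simp add: extremal_rays_def)
  thus "a \<in> G" using a
  proof (induction rule: monoid_span.induct)
    case zero
    thus ?case by (simp add: extremal_rays_def)
  next
    case (add g x)
    show ?case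
    proof (cases "g = 0")
      case True
      thus ?thesis using add by simp
    next
      case False
      have g: "g \<in> monoid_span G" using add by (simp add: monoid_span_base)
      have "rat_vec g + rat_vec x \<in> rat_cone {g + x}"
        using rat_vec_in_cone[of "g + x"] by (simp add: rat_vec_add)
      hence "rat_vec g \<in> rat_cone {g + x}"
        using add.prems rat_vec_in_cone[OF g] rat_vec_in_cone[OF add.hyps(2)]
        unfolding extremal_rays_def by blast
      hence "(g + x) $ i \<le> g $ i" for i
        using add.prems g False unfolding extremal_rays_def by blast
      hence "x = 0" by (simp add: vec_eq_iff)
      thus ?thesis using add by simp
    qed
  qed
qed

text \<open>Phrased as uniqueness of decompositions, because for monoids a trivial intersection is a
  weaker condition.\<close>

definition direct :: "(nat ^ 'r::finite) set \<Rightarrow> (nat ^ 'r) set \<Rightarrow> bool" where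
  "direct G1 G2 \<longleftrightarrow> (\<forall>x\<in>monoid_span G1. \<forall>y\<in>monoid_span G2. \<forall>x'\<in>monoid_span G1. \<forall>y'\<in>monoid_span G2.
     x + y = x' + y' \<longrightarrow> x = x' \<and> y = y')"

lemma directD:
  assumes "direct G1 G2" "x \<in> monoid_span G1" "y \<in> monoid_span G2" "x' \<in> monoid_span G1"
    "y' \<in> monoid_span G2" "x + y = x' + y'"
  shows "x = x'" "y = y'"
  using assms unfolding direct_def by blast+

lemma direct_sym: "direct G1 G2 \<Longrightarrow> direct G2 G1"
  unfolding direct_def by (metis add.commute)

lemma direct_Int:
  assumes "direct G1 G2" "x \<in> monoid_span G1" "x \<in> monoid_span G2"
  shows "x = 0"
  using directD(1)[OF assms(1,2) monoid_span.zero monoid_span.zero assms(3)] by simp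

text \<open>The coordinates of \<open>x\<close> with respect to the union are supported both in
  \<open>A\<close> and in \<open>B\<close>, hence nowhere.\<close>

lemma span_Int_independent:
  assumes ind: "vec.independent (A \<union> B)" and disj: "A \<inter> B = {}"
    and x: "x \<in> vec.span A" "x \<in> vec.span B"
  shows "x = (0 :: 'a::field ^ 'n)"
proof -
  have "vec.representation (A \<union> B) x = vec.representation A x"
    "vec.representation (A \<union> B) x = vec.representation B x"
    using ind x by (auto intro: vec.representation_extend)
  hence "vec.representation (A \<union> B) x b = 0" for b
    using vec.representation_ne_zero[of A x b] vec.representation_ne_zero[of B x b] disj by auto
  moreover have "x \<in> vec.span (A \<union> B)" using x(1) vec.span_mono[of A "A \<union> B"] by blast
  ultimately show ?thesis using vec.sum_nonzero_representation_eq[OF ind, of x] by simp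
qed

text \<open>As many independent rays as the dimension form a basis of the rational span of the
  semigroup. This is where the dimension condition of \<open>is_join\<close> enters.\<close>

lemma rat_vec_in_span_rays:
  fixes \<Gamma> :: "(nat ^ 'r::finite) set"
  assumes "card (extremal_rays \<Gamma>) = semigroup_dim \<Gamma>" "vec.independent (rat_vec ` extremal_rays \<Gamma>)"
  shows "rat_vec ` \<Gamma> \<subseteq> vec.span (rat_vec ` extremal_rays \<Gamma>)"
proof -
  have "card (rat_vec ` extremal_rays \<Gamma>) = vec.dim (rat_vec ` \<Gamma>)"
    using assms(1) by (simp add: card_image inj_on_subset[OF inj_rat_vec] semigroup_dim_def)
  moreover have "rat_vec ` extremal_rays \<Gamma> \<subseteq> rat_vec ` \<Gamma>"
    by (auto simp: extremal_rays_def)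
  moreover have "finite (rat_vec ` extremal_rays \<Gamma>)"
    using assms(2) by (rule vec.finiteI_independent)
  ultimately show ?thesis using vec.card_eq_dim assms(2) by blast
qed

text \<open>Two decompositions of one element yield a vector \<open>x - x' = y' - y\<close> lying in
  the rational spans of both families of rays, hence zero.\<close>

lemma is_join_direct:
  fixes \<Gamma>1 \<Gamma>2 \<Gamma> :: "(nat ^ 'r::finite) set"
  assumes "is_join \<Gamma>1 \<Gamma>2 \<Gamma>"
  obtains G1 G2 where "minimally_generates G1 \<Gamma>1" "minimally_generates G2 \<Gamma>2"
    "direct G1 G2" "\<Gamma> = monoid_span (G1 \<union> G2)"
proof -
  obtain G1 G2 where m: "minimally_generates G1 \<Gamma>1" "minimally_generates G2 \<Gamma>2" and G: "G1 \<inter> G2 = {}"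
    and card: "card (extremal_rays \<Gamma>1) = semigroup_dim \<Gamma>1" "card (extremal_rays \<Gamma>2) = semigroup_dim \<Gamma>2"
    and ind: "vec.independent (rat_vec ` (extremal_rays \<Gamma>1 \<union> extremal_rays \<Gamma>2))"
    and \<Gamma>: "\<Gamma> = monoid_span (G1 \<union> G2)"
    using assms unfolding is_join_def by blast
  have s: "\<Gamma>1 = monoid_span G1" "\<Gamma>2 = monoid_span G2" using m by (auto simp: minimally_generates_def)
  let ?A = "rat_vec ` extremal_rays \<Gamma>1" and ?B = "rat_vec ` extremal_rays \<Gamma>2"
  \<comment> \<open>Independence of a union of sets would tolerate a shared ray. That is excluded
    because extremal rays belong to the generating sets, which are disjoint.\<close>
  have "extremal_rays \<Gamma>1 \<inter> extremal_rays \<Gamma>2 = {}"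
    using extremal_rays_subset[of G1] extremal_rays_subset[of G2] G s by blast
  hence disj: "?A \<inter> ?B = {}" using inj_rat_vec by (auto simp: inj_def)
  have ind: "vec.independent (?A \<union> ?B)" using ind by (simp add: image_Un)
  have sp: "rat_vec ` \<Gamma>1 \<subseteq> vec.span ?A" "rat_vec ` \<Gamma>2 \<subseteq> vec.span ?B"
    by (rule rat_vec_in_span_rays[OF card(1) vec.independent_mono[OF ind]], blast,
        rule rat_vec_in_span_rays[OF card(2) vec.independent_mono[OF ind]], blast)
  have "direct G1 G2"
    unfolding direct_def s[symmetric]
  proof (intro ballI impI)
    fix x y x' y' assume x: "x \<in> \<Gamma>1" "x' \<in> \<Gamma>1" and y: "y \<in> \<Gamma>2" "y' \<in> \<Gamma>2" and eq: "x + y = x' + y'"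
    have "rat_vec x + rat_vec y = rat_vec x' + rat_vec y'"
      using eq by (simp flip: rat_vec_add)
    hence d: "rat_vec x - rat_vec x' = rat_vec y' - rat_vec y" by (simp add: algebra_simps)
    have "rat_vec x - rat_vec x' = 0"
    proof (rule span_Int_independent[OF ind disj])
      show "rat_vec x - rat_vec x' \<in> vec.span ?A" using sp x by (intro vec.span_diff) auto
      show "rat_vec x - rat_vec x' \<in> vec.span ?B" unfolding d using sp y by (intro vec.span_diff) auto
    qed
    hence "x = x'" using injD[OF inj_rat_vec] by simp
    thus "x = x' \<and> y = y'" using eq by simp
  qed
  thus thesis using that m \<Gamma> by blast
qed

lemma monoid_span_Un:
  "monoid_span (G1 \<union> G2) = {x + y | x y. x \<in> monoid_span G1 \<and> y \<in> monoid_span (G2 :: (nat ^ 'r::finite) set)}"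
proof (intro equalityI subsetI)
  fix z assume "z \<in> monoid_span (G1 \<union> G2)"
  thus "z \<in> {x + y | x y. x \<in> monoid_span G1 \<and> y \<in> monoid_span G2}"
  proof (induction rule: monoid_span.induct)
    case zero
    show ?case by (force intro: monoid_span.zero)
  next
    case (add a z)
    then obtain x y where xy: "x \<in> monoid_span G1" "y \<in> monoid_span G2" "z = x + y" by blast
    show ?case
    proof (cases "a \<in> G1")
      case True
      show ?thesis
        using xy monoid_span.add[OF True xy(1)] by (intro CollectI exI[of _ "a + x"] exI[of _ y]) (simp add: add.assoc)
    next
      case False
      hence "a \<in> G2" using add by blast
      from monoid_span.add[OF this xy(2)] show ?thesis
        using xy by (intro CollectI exI[of _ x] exI[of _ "a + y"]) (simp add: ac_simps)
    qed
  qed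
next
  fix z assume "z \<in> {x + y | x y. x \<in> monoid_span G1 \<and> y \<in> monoid_span G2}"
  thus "z \<in> monoid_span (G1 \<union> G2)"
    using monoid_span_mono[of G1 "G1 \<union> G2"] monoid_span_mono[of G2 "G1 \<union> G2"]
    by (auto intro!: monoid_span_add)
qed

text \<open>A summand is a face of the direct sum: the components in the other summand add up to
  zero, and natural vectors with zero sum vanish.\<close>

lemma direct_face:
  assumes "direct G1 G2" "x \<in> monoid_span (G1 \<union> G2)" "y \<in> monoid_span (G1 \<union> G2)"
    "x + y \<in> monoid_span G1"
  shows "x \<in> monoid_span G1"
proof -
  obtain x1 x2 y1 y2 where *: "x = x1 + x2" "y = y1 + y2" "x1 \<in> monoid_span G1" "x2 \<in> monoid_span G2"
    "y1 \<in> monoid_span G1" "y2 \<in> monoid_span G2"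
    using assms(2,3) unfolding monoid_span_Un by blast
  have "x2 + y2 = 0"
    by (rule directD(2)[OF assms(1), of "x1 + y1" _ "x + y"])
       (use * assms in \<open>auto intro: monoid_span_add monoid_span.zero simp: ac_simps\<close>)
  thus ?thesis using * by (simp add: vec_nat_add_eq_0)
qed

text \<open>A splitting of \<open>a\<close> in the sum already takes place in the face
  \<open>monoid_span G1\<close>, where \<open>a\<close> is irreducible.\<close>

lemma atoms_direct_Un:
  assumes "direct G1 G2" "G1 = atoms (monoid_span G1)"
  shows "G1 \<subseteq> atoms (monoid_span (G1 \<union> G2))"
proof
  fix a assume a: "a \<in> G1"
  hence aG: "a \<in> monoid_span G1" and at: "a \<in> atoms (monoid_span G1)"
    using assms(2) by (auto simp: monoid_span_base)
  show "a \<in> atoms (monoid_span (G1 \<union> G2))"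
    unfolding atoms_def
  proof (intro CollectI conjI ballI impI)
    show "a \<in> monoid_span (G1 \<union> G2)" using a by (simp add: monoid_span_base)
    show "a \<noteq> 0" using at by (simp add: atoms_def)
    fix x y assume xy: "x \<in> monoid_span (G1 \<union> G2)" "y \<in> monoid_span (G1 \<union> G2)" "a = x + y"
    have "x \<in> monoid_span G1" "y \<in> monoid_span G1"
      using direct_face[OF assms(1) xy(1,2)] direct_face[OF assms(1) xy(2,1)] aG xy(3)
      by (auto simp: add.commute)
    thus "x = 0 \<or> y = 0" using at xy(3) by (auto simp: atoms_def)
  qed
qed

lemma minimally_generates_Un:
  assumes m: "minimally_generates G1 \<Gamma>1" "minimally_generates G2 \<Gamma>2" and d: "direct G1 G2"
  shows "minimally_generates (G1 \<union> G2) (monoid_span (G1 \<union> G2))"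
proof -
  have "G1 = atoms (monoid_span G1)" "G2 = atoms (monoid_span G2)"
    using m by (auto simp: minimally_generates_iff)
  hence "G1 \<union> G2 \<subseteq> atoms (monoid_span (G1 \<union> G2))"
    using atoms_direct_Un[OF d] atoms_direct_Un[OF direct_sym[OF d]] by (simp add: Un_commute)
  thus ?thesis
    using m atoms_subset[of "G1 \<union> G2"] unfolding minimally_generates_iff by blast
qed

section \<open>Restriction to a direct summand\<close>

text \<open>By the face property every variable of \<open>m\<close> has degree in the first summand,
  and a nonzero element of \<open>G2\<close> does not.\<close>

lemma mon_deg_direct:
  fixes m :: "'r::finite mon"
  assumes d: "direct G1 G2" and G: "0 \<notin> G2" and m: "keys m \<subseteq> G1 \<union> G2" "mon_deg m \<in> monoid_span G1"
  shows "keys m \<subseteq> G1"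
proof
  fix c assume c: "c \<in> keys m"
  let ?n = "m - single c 1"
  have eq: "m = single c 1 + ?n"
    by (rule poly_mapping_eqI)
       (use c in \<open>auto simp: lookup_add minus_poly_mapping.rep_eq lookup_single when_def in_keys_iff\<close>)
  have "keys ?n \<subseteq> keys m"
    by (auto simp: in_keys_iff minus_poly_mapping.rep_eq)
  hence n: "mon_deg ?n \<in> monoid_span (G1 \<union> G2)" using m by (intro mon_deg_in_span) auto
  have "mon_deg (single c 1) = c" by (simp add: mon_deg_single vec_eq_iff)
  hence "c + mon_deg ?n \<in> monoid_span G1" using m(2) eq by (metis mon_deg_add)
  moreover have "c \<in> monoid_span (G1 \<union> G2)" using c m by (auto intro: monoid_span_base)
  ultimately have "c \<in> monoid_span G1" using direct_face[OF d _ n] by blast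
  hence "c \<notin> G2" using direct_Int[OF d] monoid_span_base[of c G2] G by auto
  thus "c \<in> G1" using c m by blast
qed

text \<open>Taking the part with degrees in the first summand commutes with the differentials, so
  exactness passes to it. The face property identifies this part with the free module over
  \<open>poly_ring G1\<close> on the retained basis elements.\<close>

lemma (in minimal_resolution) restrict:
  assumes G: "G = G1 \<union> G2" "0 \<notin> G2" and d: "direct G1 G2"
  shows "minimal_resolution G1 (\<lambda>j. {k \<in> S j. e j k \<in> monoid_span G1}) e D E"
proof -
  let ?S = "\<lambda>j. {k \<in> S j. e j k \<in> monoid_span G1}"
  let ?M = "\<lambda>j. gfree G1 (?S j) :: ('r, 'k) fvec set"
  let ?c = "\<lambda>j. hcomp (e j) (monoid_span G1)"
  have sub: "v \<in> M j" if "v \<in> ?M j" for v j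
    using gfree_mono[of G1 G "?S j" "S j"] G that by auto
  \<comment> \<open>The face property is applied to each term: a total degree in the first summand
    forces the monomial degree and the basis degree into it separately.\<close>
  have mem: "v \<in> ?M j"
    if v: "v \<in> M j" and h: "\<And>k m. lookup (lookup v k) m \<noteq> 0 \<Longrightarrow> mon_deg m + e j k \<in> monoid_span G1" for v j
  proof -
    have *: "k \<in> ?S j \<and> keys m \<subseteq> G1" if km: "lookup (lookup v k) m \<noteq> 0" for k m
    proof -
      have "k \<in> keys v" using km by (auto simp: in_keys_iff)
      hence k: "k \<in> S j" and m: "keys m \<subseteq> G" using km v by (auto simp: gfree_def poly_ring_def in_keys_iff)
      have "e j k \<in> monoid_span (G1 \<union> G2)" "mon_deg m \<in> monoid_span (G1 \<union> G2)"
        using deg[OF k] mon_deg_in_span[OF m] G by auto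
      hence "e j k \<in> monoid_span G1" "mon_deg m \<in> monoid_span G1"
        using direct_face[OF d] h[OF km] by (metis add.commute)+
      thus ?thesis using mon_deg_direct[OF d G(2), of m] m G k by auto
    qed
    have "keys v \<subseteq> ?S j"
    proof
      fix k assume "k \<in> keys v"
      then obtain m where "lookup (lookup v k) m \<noteq> 0"
        by (metis in_keys_iff lookup_zero poly_mapping_eqI)
      thus "k \<in> ?S j" using * by blast
    qed
    moreover have "lookup v k \<in> poly_ring G1" for k
      using * by (auto simp: in_keys_iff poly_ring_def)
    ultimately show ?thesis by (simp add: gfree_def)
  qed
  have comp_mem: "?c j v \<in> ?M j" if "v \<in> M j" for v j
    by (rule mem[OF hcomp_closed[OF that]]) (auto simp: lookup_hcomp split: if_splits)
  have comp_id: "?c j v = v" if "v \<in> ?M j" for v j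
  proof (rule fvec_eqI)
    fix k m
    have "mon_deg m + e j k \<in> monoid_span G1" if "lookup (lookup v k) m \<noteq> 0"
    proof -
      have "k \<in> keys v" using that by (auto simp: in_keys_iff)
      hence "e j k \<in> monoid_span G1" "keys m \<subseteq> G1"
        using that \<open>v \<in> ?M j\<close> by (auto simp: gfree_def poly_ring_def in_keys_iff)
      thus ?thesis by (simp add: mon_deg_in_span monoid_span_add)
    qed
    thus "lookup (lookup (?c j v) k) m = lookup (lookup v k) m"
      by (auto simp: lookup_hcomp)
  qed
  have D_comp: "D (Suc j) (?c (Suc j) v) = ?c j (D (Suc j) v)" if "v \<in> M (Suc j)" for j v
    by (rule hcomp_natural[OF D_lin D_hom that])
  have E_comp: "E (?c 0 v) = sproj (monoid_span G1) (E v)" if "v \<in> M 0" for v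
    by (rule sproj_natural[OF E_lin E_hom that])
  have D_mem: "D (Suc j) v \<in> ?M j" if "v \<in> ?M (Suc j)" for j v
    using D_comp[OF sub[OF that]] comp_id[OF that] comp_mem[OF D_closed[OF sub[OF that]]] by simp
  have lift: "w \<in> D (Suc j) ` ?M (Suc j)" if w: "w \<in> cyc j" "w \<in> ?M j" for j w
  proof -
    obtain v where v: "v \<in> M (Suc j)" "D (Suc j) v = w" using w by (auto simp: cyc_def)
    hence "D (Suc j) (?c (Suc j) v) = w" using D_comp[OF v(1)] comp_id[OF w(2)] by simp
    thus ?thesis by (intro image_eqI[OF _ comp_mem[OF v(1)]]) (rule sym)
  qed
  have proj: "sproj (monoid_span G1) f = f \<longleftrightarrow> f \<in> semigroup_ring (monoid_span G1)" for f :: "(nat ^ 'r) \<Rightarrow>\<^sub>0 'k"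
    unfolding semigroup_ring_def poly_mapping_eq_iff fun_eq_iff lookup_sproj
    by (auto simp: in_keys_iff subset_iff)
  have sr: "semigroup_ring (monoid_span G1) \<subseteq> (semigroup_ring (monoid_span G) :: ((nat ^ 'r) \<Rightarrow>\<^sub>0 'k) set)"
    unfolding semigroup_ring_def using monoid_span_mono[of G1 G] G by blast
  have E_mem: "E v \<in> semigroup_ring (monoid_span G1)" if "v \<in> ?M 0" for v
    using E_comp[OF sub[OF that]] comp_id[OF that] proj by metis
  have pr: "p \<in> poly_ring G" if "p \<in> poly_ring G1" for p :: "('r, 'k) mpoly"
    using poly_ring_mono[of G1 G] G that by blast
  show ?thesis
  proof
    fix j show "linear_map_on (poly_ring G1) smult smult (?M (Suc j)) (?M j) (D (Suc j))"
      using D_mem by (simp add: linear_map_on_iff sub pr D_add D_smult)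
  next
    fix v j d assume "v \<in> ?M (Suc j)" "ghom (e (Suc j)) d v"
    thus "ghom (e j) d (D (Suc j) v)" using D_hom sub by blast
  next
    show "linear_map_on (poly_ring G1) smult (\<lambda>p f. to_semigroup_ring p * f) (?M 0)
      (semigroup_ring (monoid_span G1)) E"
      using E_mem by (simp add: linear_map_on_iff sub pr E_add E_smult)
  next
    fix v d assume "v \<in> ?M 0" "ghom (e 0) d v"
    thus "keys (E v) \<subseteq> {d}" using E_hom sub by blast
  next
    show "E ` ?M 0 = semigroup_ring (monoid_span G1)"
    proof (intro equalityI subsetI)
      fix f :: "(nat ^ 'r) \<Rightarrow>\<^sub>0 'k" assume f: "f \<in> semigroup_ring (monoid_span G1)"
      hence "f \<in> E ` M 0" using E_surj sr by auto
      then obtain v where v: "v \<in> M 0" "E v = f" by auto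
      hence "E (?c 0 v) = f" using E_comp[OF v(1)] f proj by simp
      thus "f \<in> E ` ?M 0" by (intro image_eqI[OF _ comp_mem[OF v(1)]]) (rule sym)
    qed (use E_mem in blast)
  next
    show "D (Suc 0) ` ?M (Suc 0) = {v \<in> ?M 0. E v = 0}"
    proof -
      have "E (D (Suc 0) v) = 0" if "v \<in> ?M (Suc 0)" for v
        using exact_0 sub[OF that] by blast
      thus ?thesis using D_mem[of _ 0] sub lift[of _ 0] by (auto simp: cyc_0)
    qed
  next
    fix j
    show "D (Suc (Suc j)) ` ?M (Suc (Suc j)) = {v \<in> ?M (Suc j). D (Suc j) v = 0}"
    proof -
      have "D (Suc j) (D (Suc (Suc j)) v) = 0" if "v \<in> ?M (Suc (Suc j))" for v
        using exact_Suc[of j] sub[OF that] by blast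
      thus ?thesis using D_mem[of _ "Suc j"] sub lift[of _ "Suc j"] by (auto simp: cyc_Suc)
    qed
  next
    fix v j k assume "v \<in> ?M (Suc j)"
    thus "lookup (lookup (D (Suc j) v) k) 0 = 0" using minimal sub by blast
  qed (use fin in auto)
qed

section \<open>Contracting homotopies over the field\<close>

text \<open>Choose preimages in \<open>M\<close> of a basis of the image of \<open>M\<close> and
  extend linearly. The section is linear on the whole space, whereas \<open>f\<close> is known to be
  linear only on \<open>M\<close>.\<close>

lemma linear_section:
  fixes s1 :: "'k::field \<Rightarrow> 'a::ab_group_add \<Rightarrow> 'a" and s2 :: "'k \<Rightarrow> 'b::ab_group_add \<Rightarrow> 'b"
  assumes vs: "vector_space s1" "vector_space s2"
    and M: "0 \<in> M" "\<And>x y. x \<in> M \<Longrightarrow> y \<in> M \<Longrightarrow> x + y \<in> M" "\<And>c x. x \<in> M \<Longrightarrow> s1 c x \<in> M"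
    and f: "\<And>x y. x \<in> M \<Longrightarrow> y \<in> M \<Longrightarrow> f (x + y) = f x + f y"
      "\<And>c x. x \<in> M \<Longrightarrow> f (s1 c x) = s2 c (f x)"
  obtains g where "\<And>x y. g (x + y) = g x + g y" "\<And>c x. g (s2 c x) = s1 c (g x)"
    "\<And>x. g x \<in> M" "\<And>y. y \<in> f ` M \<Longrightarrow> f (g y) = y"
proof -
  interpret vector_space_pair s2 s1
    using vs by (simp add: vector_space_pair_def)
  obtain B where B: "B \<subseteq> f ` M" "vs1.independent B" "f ` M \<subseteq> vs1.span B"
    using vs1.maximal_independent_subset by blast
  have "\<exists>r. \<forall>b\<in>B. r b \<in> M \<and> f (r b) = b"
    using B(1) by (intro bchoice) blast
  then obtain r where r: "\<And>b. b \<in> B \<Longrightarrow> r b \<in> M \<and> f (r b) = b" by blast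
  let ?g = "construct B r"
  have lin: "Vector_Spaces.linear s2 s1 ?g" by (rule linear_construct[OF B(2)])
  have sub: "vs2.subspace M" using M by (simp add: vs2.subspace_def)
  have g_M: "?g x \<in> M" for x
    using construct_in_span[OF B(2), of r x] vs2.span_minimal[of "r ` B" M] r sub by blast
  have add: "?g (x + y) = ?g x + ?g y" for x y by (rule linear_add[OF lin])
  have scale: "?g (s2 c x) = s1 c (?g x)" for c x by (rule linear_scale[OF lin])
  have f0: "f 0 = 0" using f(1)[OF M(1) M(1)] by simp
  show thesis
  proof (rule that)
    fix y assume "y \<in> f ` M"
    hence "y \<in> vs1.span B" using B by blast
    thus "f (?g y) = y"
    proof (induction rule: vs1.span_induct_alt)
      case base
      have "?g 0 = 0" by (rule linear_0[OF lin])
      thus ?case by (simp add: f0)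
    next
      case (step c x y)
      have "?g x = r x" by (rule construct_basis[OF B(2) step(1)])
      thus ?case using step r by (simp add: add scale f M g_M)
    qed
  qed (use add scale g_M in auto)
qed

abbreviation scal :: "'k \<Rightarrow> ('r::finite, 'k::comm_ring_1) fvec \<Rightarrow> ('r, 'k) fvec" where
  "scal c v \<equiv> smult (single 0 c) v"

lemma vector_space_fvec: "vector_space (scal :: 'k::field \<Rightarrow> ('r::finite, 'k) fvec \<Rightarrow> _)"
  by unfold_locales (auto simp: smult_add_right smult_add_left smult_smult single_add mult_single)

lemma vector_space_semigroup_ring:
  "vector_space (\<lambda>c f. single 0 c * f :: (nat ^ 'r::finite) \<Rightarrow>\<^sub>0 'k::field)"
  by unfold_locales (auto simp: distrib_left distrib_right single_add mult_single simp flip: mult.assoc)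

text \<open>Over a field the maps onto the cycles split, which contracts the augmented complex. The
  maps obtained are linear over the field only, not over the polynomial ring.\<close>

lemma (in minimal_resolution) contracting_homotopy:
  obtains h :: "nat \<Rightarrow> ('r, 'k) fvec \<Rightarrow> ('r, 'k) fvec" and \<sigma> where
    "\<And>p x. x \<in> M p \<Longrightarrow> h p x \<in> M (Suc p)"
    "\<And>p x y. x \<in> M p \<Longrightarrow> y \<in> M p \<Longrightarrow> h p (x + y) = h p x + h p y"
    "\<And>p c x. x \<in> M p \<Longrightarrow> h p (scal c x) = scal c (h p x)"
    "\<And>f. \<sigma> f \<in> M 0"
    "\<And>f g. \<sigma> (f + g) = \<sigma> f + \<sigma> g"
    "\<And>c f. \<sigma> (single 0 c * f) = scal c (\<sigma> f)"
    "\<And>x. x \<in> M 0 \<Longrightarrow> D (Suc 0) (h 0 x) = x - \<sigma> (E x)"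
    "\<And>p x. x \<in> M (Suc p) \<Longrightarrow> D (Suc (Suc p)) (h (Suc p) x) + h p (D (Suc p) x) = x"
proof -
  have "\<exists>s. \<forall>p. (\<forall>x y. s p (x + y) = s p x + s p y) \<and> (\<forall>c x. s p (scal c x) = scal c (s p x)) \<and>
     (\<forall>x. s p x \<in> M (Suc p)) \<and> (\<forall>y\<in>cyc p. D (Suc p) (s p y) = y)"
  proof (intro choice allI)
    fix p
    obtain g where "\<And>x y. g (x + y) = g x + g y" "\<And>c x. g (scal c x) = scal c (g x)"
      "\<And>x. g x \<in> M (Suc p)" "\<And>y. y \<in> D (Suc p) ` M (Suc p) \<Longrightarrow> D (Suc p) (g y) = y"
      by (rule linear_section[OF vector_space_fvec vector_space_fvec, where M="M (Suc p)" and f="D (Suc p)"])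
         (auto intro: gfree_add gfree_smult D_add D_smult)
    thus "\<exists>s. (\<forall>x y. s (x + y) = s x + s y) \<and> (\<forall>c x. s (scal c x) = scal c (s x)) \<and>
     (\<forall>x. s x \<in> M (Suc p)) \<and> (\<forall>y\<in>cyc p. D (Suc p) (s y) = y)"
      unfolding cyc_def by blast
  qed
  then obtain s where s: "\<And>p x y. s p (x + y) = s p x + s p y" "\<And>p c x. s p (scal c x) = scal c (s p x)"
     "\<And>p x. s p x \<in> M (Suc p)" "\<And>p y. y \<in> cyc p \<Longrightarrow> D (Suc p) (s p y) = y" by blast
  obtain \<sigma> where \<sigma>: "\<And>x y. \<sigma> (x + y) = \<sigma> x + \<sigma> y" "\<And>c x. \<sigma> (single 0 c * x) = scal c (\<sigma> x)"
    "\<And>x. \<sigma> x \<in> M 0" "\<And>y. y \<in> E ` M 0 \<Longrightarrow> E (\<sigma> y) = y"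
    by (rule linear_section[OF vector_space_fvec vector_space_semigroup_ring, where M="M 0" and f=E])
       (auto intro: gfree_add gfree_smult E_add simp: E_smult to_semigroup_ring_single)
  \<comment> \<open>\<open>r\<close> projects onto a complement of the cycles along the cycles. Thus
    \<open>x - r p x\<close> is the cycle part of \<open>x\<close>, and \<open>h\<close> lifts that
    part one degree up.\<close>
  define r where "r p x = (case p of 0 \<Rightarrow> \<sigma> (E x) | Suc q \<Rightarrow> s q (D p x))" for p x
  define h where "h p x = s p (x - r p x)" for p x
  have r_M: "r p x \<in> M p" for p x by (cases p) (auto simp: r_def s \<sigma>)
  have r_add: "r p (x + y) = r p x + r p y" if "x \<in> M p" "y \<in> M p" for p x y
    using that by (cases p) (auto simp: r_def s \<sigma> E_add D_add)
  have r_scal: "r p (scal c x) = scal c (r p x)" if "x \<in> M p" for p c x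
    using that by (cases p) (auto simp: r_def s \<sigma> E_smult D_smult to_semigroup_ring_single)
  have r_cyc: "x - r p x \<in> cyc p" if x: "x \<in> M p" for p x
  proof (cases p)
    case 0
    have "E (x - r 0 x) = E x - E (\<sigma> (E x))"
      using linear_map_on_diff[OF E_lin, of x "\<sigma> (E x)"] x 0 \<sigma> by (simp add: r_def)
    thus ?thesis using x 0 \<sigma>(4)[of "E x"] r_M[of 0 x] by (simp add: cyc_0 gfree_diff)
  next
    case (Suc q)
    have "D (Suc q) x \<in> cyc q" using x Suc by (simp add: cyc_def)
    moreover have "D (Suc q) (x - r (Suc q) x) = D (Suc q) x - D (Suc q) (s q (D (Suc q) x))"
      using linear_map_on_diff[OF D_lin, of x q "s q (D (Suc q) x)"] x Suc s(3) by (simp add: r_def)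
    ultimately show ?thesis using x Suc s(4) r_M[of "Suc q" x] by (simp add: cyc_Suc gfree_diff)
  qed
  have D_h: "D (Suc p) (h p x) = x - r p x" if "x \<in> M p" for p x
    unfolding h_def by (rule s(4)[OF r_cyc[OF that]])
  have s0: "s p 0 = 0" for p using s(1)[of p 0 0] by simp
  have \<sigma>0: "\<sigma> 0 = 0" using \<sigma>(1)[of 0 0] by simp
  have r_cyc_0: "r p x = 0" if "x \<in> cyc p" for p x
    using that by (cases p) (auto simp: r_def cyc_0 cyc_Suc s0 \<sigma>0)
  show thesis
  proof (rule that[of h \<sigma>])
    fix p x y assume xy: "x \<in> M p" "y \<in> M p"
    have "(x + y) - r p (x + y) = (x - r p x) + (y - r p y)" by (simp add: r_add xy)
    thus "h p (x + y) = h p x + h p y" unfolding h_def by (simp only: s)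
  next
    fix p c x assume "x \<in> M p"
    thus "h p (scal c x) = scal c (h p x)" unfolding h_def by (simp add: s r_scal flip: smult_diff_right)
  next
    fix p x assume x: "x \<in> M (Suc p)"
    hence "D (Suc p) x \<in> cyc p" by (simp add: cyc_def)
    hence "h p (D (Suc p) x) = r (Suc p) x" by (simp add: h_def r_cyc_0) (simp add: r_def)
    thus "D (Suc (Suc p)) (h (Suc p) x) + h p (D (Suc p) x) = x" by (simp add: D_h x)
  next
    fix x assume "x \<in> M 0"
    thus "D (Suc 0) (h 0 x) = x - \<sigma> (E x)" by (simp add: D_h) (simp add: r_def)
  qed (auto simp: h_def s \<sigma>)
qed

section \<open>Tensor products\<close>

lemma sproj_id: "keys f \<subseteq> B \<Longrightarrow> sproj B f = f"
  by (rule poly_mapping_eqI) (auto simp: lookup_sproj in_keys_iff subset_iff)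

lemma sproj_disjoint: "keys f \<inter> B = {} \<Longrightarrow> sproj B f = 0"
  by (rule poly_mapping_eqI) (auto simp: lookup_sproj in_keys_iff)

lemma sproj_Un:
  fixes f :: "'a \<Rightarrow>\<^sub>0 'b::comm_monoid_add"
  assumes "keys f \<subseteq> A \<union> B" "A \<inter> B = {}"
  shows "sproj A f + sproj B f = f"
  by (rule poly_mapping_eqI) (use assms in \<open>auto simp: lookup_add lookup_sproj in_keys_iff subset_iff\<close>)

lemma keys_sproj: "keys (sproj B f) \<subseteq> keys f \<inter> B"
  by (auto simp: in_keys_iff lookup_sproj split: if_splits)

lemma to_semigroup_ring_superset:
  assumes "finite A" "keys p \<subseteq> A"
  shows "to_semigroup_ring p = (\<Sum>m\<in>A. single (mon_deg m) (lookup p m))"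
  unfolding to_semigroup_ring_def
  by (rule sum.mono_neutral_left) (use assms in \<open>auto simp: in_keys_iff\<close>)

lemma to_semigroup_ring_0 [simp]: "to_semigroup_ring 0 = 0"
  by (simp add: to_semigroup_ring_def)

lemma to_semigroup_ring_add:
  "to_semigroup_ring (p + q :: ('r::finite, 'k::comm_ring_1) mpoly) = to_semigroup_ring p + to_semigroup_ring q"
proof -
  let ?A = "keys p \<union> keys q"
  have "to_semigroup_ring (p + q) = (\<Sum>m\<in>?A. single (mon_deg m) (lookup (p + q) m))"
    by (rule to_semigroup_ring_superset) (use keys_add[of p q] in auto)
  thus ?thesis
    by (simp add: to_semigroup_ring_superset[of ?A p] to_semigroup_ring_superset[of ?A q]
        lookup_add single_add sum.distrib)
qed

lemma to_semigroup_ring_mult: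
  "to_semigroup_ring (p * q :: ('r::finite, 'k::comm_ring_1) mpoly) = to_semigroup_ring p * to_semigroup_ring q"
proof (induction p rule: poly_mapping_induct)
  case (single m c)
  show ?case
    by (induction q rule: poly_mapping_induct)
       (auto simp: mult_single to_semigroup_ring_single mon_deg_add to_semigroup_ring_add distrib_left)
qed (auto simp: to_semigroup_ring_add distrib_right)

lemma semigroup_ring_0 [simp]: "0 \<in> semigroup_ring \<Gamma>"
  by (simp add: semigroup_ring_def)

lemma semigroup_ring_add:
  "f \<in> semigroup_ring \<Gamma> \<Longrightarrow> g \<in> semigroup_ring \<Gamma> \<Longrightarrow> f + g \<in> semigroup_ring \<Gamma>"
  unfolding semigroup_ring_def using keys_add[of f g] by auto

lemma to_semigroup_ring_closed:
  fixes p :: "('r::finite, 'k::comm_ring_1) mpoly"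
  assumes "p \<in> poly_ring G"
  shows "to_semigroup_ring p \<in> semigroup_ring (monoid_span G)"
  unfolding to_semigroup_ring_def
proof (rule sum_closed[where P="\<lambda>f. f \<in> semigroup_ring (monoid_span G)"])
  fix m assume "m \<in> keys p"
  hence "mon_deg m \<in> monoid_span G"
    using assms by (intro mon_deg_in_span) (auto simp: poly_ring_def)
  thus "single (mon_deg m) (lookup p m) \<in> semigroup_ring (monoid_span G)"
    by (simp add: semigroup_ring_def)
qed (auto intro: semigroup_ring_add)

lemma semigroup_ring_mult:
  fixes f g :: "(nat ^ 'r::finite) \<Rightarrow>\<^sub>0 'k::comm_ring_1"
  assumes "f \<in> semigroup_ring (monoid_span G)" "g \<in> semigroup_ring (monoid_span G)"
  shows "f * g \<in> semigroup_ring (monoid_span G)"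
  unfolding semigroup_ring_def
proof safe
  fix z assume "z \<in> keys (f * g)"
  then obtain x y where "z = x + y" "x \<in> keys f" "y \<in> keys g" using keys_mult[of f g] by auto
  thus "z \<in> monoid_span G" using assms by (auto simp: semigroup_ring_def intro: monoid_span_add)
qed

lemma semigroup_ring_mono: "\<Gamma> \<subseteq> \<Delta> \<Longrightarrow> f \<in> semigroup_ring \<Gamma> \<Longrightarrow> f \<in> semigroup_ring \<Delta>"
  by (auto simp: semigroup_ring_def)

lemma lin_fun_add: "lin (\<lambda>k. w k + w' k) v = lin w v + lin w' v"
  by (simp add: lin_def smult_add_right sum.distrib)

lemma lin_fun_smult: "lin (\<lambda>k. smult p (w k)) v = smult p (lin w v)"
  by (simp add: lin_def smult_sum_right smult_smult mult.commute)

lemma lin_fun_0 [simp]: "lin (\<lambda>k. 0) v = 0"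
  by (simp add: lin_def)

text \<open>Bases are indexed by naturals, so a pair of basis elements is coded together with the
  homological degree \<open>p\<close> of the left one. In total degree \<open>n\<close> the right
  one has degree \<open>n - p\<close>.\<close>

definition enc :: "nat \<Rightarrow> nat \<Rightarrow> nat \<Rightarrow> nat" where
  "enc p a b = prod_encode (p, prod_encode (a, b))"

definition enc1 :: "nat \<Rightarrow> nat" where "enc1 i = fst (prod_decode i)"
definition enc2 :: "nat \<Rightarrow> nat" where "enc2 i = fst (prod_decode (snd (prod_decode i)))"
definition enc3 :: "nat \<Rightarrow> nat" where "enc3 i = snd (prod_decode (snd (prod_decode i)))"

lemma enc_simps [simp]: "enc1 (enc p a b) = p" "enc2 (enc p a b) = a" "enc3 (enc p a b) = b"
  by (simp_all add: enc_def enc1_def enc2_def enc3_def)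

text \<open>Bilinear over one polynomial ring. Vectors over \<open>poly_ring G1\<close> and over
  \<open>poly_ring G2\<close> are both read over the ring of the union, so extension of scalars is
  invisible.\<close>

definition tens :: "nat \<Rightarrow> ('r::finite, 'k::comm_ring_1) fvec \<Rightarrow> ('r, 'k) fvec \<Rightarrow> ('r, 'k) fvec" where
  "tens p x y = lin (\<lambda>a. lin (\<lambda>b. single (enc p a b) 1) y) x"

lemma tens_add_left: "tens p (x + x') y = tens p x y + tens p x' y"
  by (simp add: tens_def lin_add)
lemma tens_add_right: "tens p x (y + y') = tens p x y + tens p x y'"
  by (simp add: tens_def lin_add lin_fun_add)
lemma tens_smult_left: "tens p (smult q x) y = smult q (tens p x y)"
  by (simp add: tens_def lin_smult)
lemma tens_smult_right: "tens p x (smult q y) = smult q (tens p x y)"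
  by (simp add: tens_def lin_smult lin_fun_smult)
lemma tens_0 [simp]: "tens p 0 y = 0" "tens p x 0 = 0"
  by (simp_all add: tens_def)
lemma tens_diff_left: "tens p (x - x') y = tens p x y - tens p x' y"
  using tens_add_left[of p "x - x'" x' y] by (simp add: algebra_simps)
lemma tens_diff_right: "tens p x (y - y') = tens p x y - tens p x y'"
  using tens_add_right[of p x "y - y'" y'] by (simp add: algebra_simps)

lemma tens_single [simp]: "tens p (single a q) (single b q') = single (enc p a b) (q * q')"
  by (simp add: tens_def)

lemma tens_closed:
  assumes "x \<in> gfree G A" "y \<in> gfree G B" "\<And>a b. a \<in> A \<Longrightarrow> b \<in> B \<Longrightarrow> enc p a b \<in> C"
  shows "tens p x y \<in> gfree G C"
  unfolding tens_def
  by (rule lin_closed[OF assms(1)], rule lin_closed[OF assms(2)], rule gfree_single) (auto intro: assms(3))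

lemma tens_lookup_0_left:
  "(\<And>k. lookup (lookup x k) 0 = 0) \<Longrightarrow> lookup (lookup (tens p x y) k) 0 = 0"
  by (simp add: tens_def lin_lookup_0)

lemma tens_lookup_0_right:
  "(\<And>k. lookup (lookup y k) 0 = 0) \<Longrightarrow> lookup (lookup (tens p x y) k) 0 = 0"
  by (simp add: tens_def lin_lookup_0)

lemma tens_ghom:
  fixes x y :: "('r::finite, 'k::comm_ring_1) fvec"
  assumes x: "ghom f d1 x" and y: "ghom g d2 y" and e: "\<And>a b. e (enc p a b) = f a + g b"
  shows "ghom e (d1 + d2) (tens p x y)"
  unfolding tens_def
proof (rule lin_ghom[where e="\<lambda>a. f a + d2"])
  show "ghom (\<lambda>a. f a + d2) (d1 + d2) x"
    using x by (auto simp: ghom_def simp flip: add.assoc)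
  fix a
  show "ghom e (f a + d2) (lin (\<lambda>b. single (enc p a b) 1) y)"
  proof (rule lin_ghom[where e="\<lambda>b. f a + g b"])
    show "ghom (\<lambda>b. f a + g b) (f a + d2) y"
      using y unfolding ghom_def by (metis add.left_commute)
    show "ghom e (f a + g b) (single (enc p a b) (1 :: ('r, 'k) mpoly))" for b
      unfolding e[symmetric] by (rule ghom_basis)
  qed
qed

lemma gfree_induct2 [consumes 2, case_names zero_left zero_right single add_left add_right]:
  fixes x y :: "('r::finite, 'k::comm_ring_1) fvec"
  assumes x: "x \<in> gfree G S" and y: "y \<in> gfree H T"
    and z: "\<And>y. y \<in> gfree H T \<Longrightarrow> Q 0 y" "\<And>x. x \<in> gfree G S \<Longrightarrow> Q x 0"
    and t: "\<And>k m c l n d. k \<in> S \<Longrightarrow> keys m \<subseteq> G \<Longrightarrow> l \<in> T \<Longrightarrow> keys n \<subseteq> H \<Longrightarrow>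
      Q (single k (single m c)) (single l (single n d))"
    and a1: "\<And>x x' y. x \<in> gfree G S \<Longrightarrow> x' \<in> gfree G S \<Longrightarrow> y \<in> gfree H T \<Longrightarrow> Q x y \<Longrightarrow> Q x' y \<Longrightarrow> Q (x + x') y"
    and a2: "\<And>x y y'. x \<in> gfree G S \<Longrightarrow> y \<in> gfree H T \<Longrightarrow> y' \<in> gfree H T \<Longrightarrow> Q x y \<Longrightarrow> Q x y' \<Longrightarrow> Q x (y + y')"
  shows "Q x y"
  using x
proof (induction x rule: gfree_induct)
  case (single k m c)
  hence k: "single k (single m c) \<in> gfree G S" by (simp add: gfree_single poly_ring_single)
  from y show ?case
    by (induction y rule: gfree_induct) (simp_all add: z k t single a2)
qed (simp_all add: z y a1)

definition pext :: "('a \<Rightarrow> ('r::finite, 'k::field) fvec) \<Rightarrow> ('a \<Rightarrow>\<^sub>0 'k) \<Rightarrow> ('r, 'k) fvec" where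
  "pext \<psi> p = (\<Sum>m\<in>keys p. scal (lookup p m) (\<psi> m))"

lemma pext_superset: "finite A \<Longrightarrow> keys p \<subseteq> A \<Longrightarrow> pext \<psi> p = (\<Sum>m\<in>A. scal (lookup p m) (\<psi> m))"
  unfolding pext_def by (rule sum.mono_neutral_left) (auto simp: in_keys_iff)

lemma pext_add: "pext \<psi> (p + q) = pext \<psi> p + pext \<psi> q"
proof -
  let ?A = "keys p \<union> keys q"
  have "pext \<psi> (p + q) = (\<Sum>m\<in>?A. scal (lookup (p + q) m) (\<psi> m))"
    by (rule pext_superset) (use keys_add[of p q] in auto)
  thus ?thesis
    by (simp add: pext_superset[of ?A p] pext_superset[of ?A q] lookup_add single_add smult_add_left sum.distrib)
qed

lemma pext_single [simp]: "pext \<psi> (single m c) = scal c (\<psi> m)"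
  by (auto simp: pext_def)

lemma pext_0 [simp]: "pext \<psi> 0 = 0"
  by (simp add: pext_def)

text \<open>Linear extension over the field from the terms \<open>m e_i\<close>, which form a basis
  over the field. The homotopy of the tensor product needs it, not being linear over the polynomial
  ring.\<close>

definition kext :: "(nat \<Rightarrow> 'r mon \<Rightarrow> ('r::finite, 'k::field) fvec) \<Rightarrow> ('r, 'k) fvec \<Rightarrow> ('r, 'k) fvec" where
  "kext \<psi> v = (\<Sum>i\<in>keys v. pext (\<psi> i) (lookup v i))"

lemma kext_superset: "finite A \<Longrightarrow> keys v \<subseteq> A \<Longrightarrow> kext \<psi> v = (\<Sum>i\<in>A. pext (\<psi> i) (lookup v i))"
  unfolding kext_def by (rule sum.mono_neutral_left) (auto simp: in_keys_iff)

lemma kext_add: "kext \<psi> (u + v) = kext \<psi> u + kext \<psi> v"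
proof -
  let ?A = "keys u \<union> keys v"
  have "kext \<psi> (u + v) = (\<Sum>m\<in>?A. pext (\<psi> m) (lookup (u + v) m))"
    by (rule kext_superset) (use keys_add[of u v] in auto)
  thus ?thesis
    by (simp add: kext_superset[of ?A u] kext_superset[of ?A v] lookup_add pext_add sum.distrib)
qed

lemma kext_single [simp]: "kext \<psi> (single i (single m c)) = scal c (\<psi> i m)"
proof -
  have "kext \<psi> (single i (single m c)) = (\<Sum>j\<in>{i}. pext (\<psi> j) (lookup (single i (single m c)) j))"
    by (rule kext_superset) auto
  thus ?thesis by simp
qed

lemma kext_0 [simp]: "kext \<psi> 0 = 0"
  by (simp add: kext_def)

text \<open>The counterpart of \<open>lin\<close> for values in the semigroup ring, on which
  polynomials act through \<open>to_semigroup_ring\<close>.\<close>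

definition linE :: "(nat \<Rightarrow> (nat ^ 'r::finite) \<Rightarrow>\<^sub>0 'k::comm_ring_1) \<Rightarrow> ('r, 'k) fvec \<Rightarrow> ((nat ^ 'r) \<Rightarrow>\<^sub>0 'k)" where
  "linE u v = (\<Sum>i\<in>keys v. to_semigroup_ring (lookup v i) * u i)"

lemma linE_superset:
  "finite A \<Longrightarrow> keys v \<subseteq> A \<Longrightarrow> linE u v = (\<Sum>i\<in>A. to_semigroup_ring (lookup v i) * u i)"
  unfolding linE_def by (rule sum.mono_neutral_left) (auto simp: in_keys_iff)

lemma linE_add: "linE u (v + w) = linE u v + linE u w"
proof -
  let ?A = "keys v \<union> keys w"
  have "linE u (v + w) = (\<Sum>i\<in>?A. to_semigroup_ring (lookup (v + w) i) * u i)"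
    by (rule linE_superset) (use keys_add[of v w] in auto)
  thus ?thesis
    by (simp add: linE_superset[of ?A v] linE_superset[of ?A w] lookup_add to_semigroup_ring_add
        distrib_right sum.distrib)
qed

lemma linE_smult: "linE u (smult p v) = to_semigroup_ring p * linE u v"
proof -
  have "linE u (smult p v) = (\<Sum>i\<in>keys v. to_semigroup_ring (lookup (smult p v) i) * u i)"
    by (rule linE_superset) (auto simp: in_keys_iff)
  thus ?thesis by (simp add: linE_def to_semigroup_ring_mult sum_distrib_left mult.assoc)
qed

lemma linE_single [simp]: "linE u (single i p) = to_semigroup_ring p * u i"
  by (auto simp: linE_def)

lemma linE_0 [simp]: "linE u 0 = 0"
  by (simp add: linE_def)

lemma smult_uminus_left: "smult (- p) v = - smult p v"
  by (rule poly_mapping_eqI) simp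

lemma kext_scal: "kext \<psi> (scal c v) = scal c (kext \<psi> v)"
proof -
  have "v \<in> gfree UNIV UNIV" by (simp add: gfree_def poly_ring_def)
  thus ?thesis
    by (induction v rule: gfree_induct)
       (auto simp: mult_single smult_smult smult_add_right kext_add)
qed

lemma keys_add_subset: "keys f \<subseteq> A \<Longrightarrow> keys g \<subseteq> A \<Longrightarrow> keys (f + g) \<subseteq> A"
  using keys_add[of f g] by auto

lemma single_smult: "single a q = smult q (single a (1 :: ('r::finite, 'k::comm_ring_1) mpoly))"
  by simp

context minimal_resolution
begin

text \<open>\<open>D 0\<close> is unconstrained; \<open>d\<close> replaces it by the zero map.\<close>

definition "d p x = (if p = 0 then 0 else D p x)"

lemma d_0 [simp]: "d 0 x = 0" "d p 0 = 0"
  using linear_map_on_0[OF D_lin, of "p - 1"] by (auto simp: d_def)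

lemma d_Suc [simp]: "d (Suc p) x = D (Suc p) x"
  by (simp add: d_def)

lemma d_closed: "x \<in> M p \<Longrightarrow> d p x \<in> M (p - 1)"
  by (cases p) (auto simp: D_closed)

lemma d_add: "x \<in> M p \<Longrightarrow> y \<in> M p \<Longrightarrow> d p (x + y) = d p x + d p y"
  by (cases p) (auto simp: D_add)

lemma d_smult: "q \<in> poly_ring G \<Longrightarrow> x \<in> M p \<Longrightarrow> d p (smult q x) = smult q (d p x)"
  by (cases p) (auto simp: D_smult)

lemma d_d: "x \<in> M p \<Longrightarrow> d (p - 1) (d p x) = 0"
proof (cases p)
  case (Suc q)
  assume "x \<in> M p"
  hence "D (Suc q) x \<in> cyc q" using Suc by (simp add: cyc_def)
  thus ?thesis using Suc by (cases q) (auto simp: cyc_Suc)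
qed simp

lemma E_D: "x \<in> M (Suc 0) \<Longrightarrow> E (D (Suc 0) x) = 0"
  using exact_0 by blast

lemma d_ghom: "x \<in> M p \<Longrightarrow> ghom (e p) b x \<Longrightarrow> ghom (e (p - 1)) b (d p x)"
  by (cases p) (auto simp: D_hom)

lemma d_minimal: "x \<in> M p \<Longrightarrow> lookup (lookup (d p x) k) 0 = 0"
  by (cases p) (auto simp: minimal)

lemma E_0: "E 0 = 0"
  by (rule linear_map_on_0[OF E_lin])

lemma E_single:
  assumes "k \<in> S 0" "keys m \<subseteq> G"
  obtains b c where "b \<in> monoid_span G" "E (single k (single m a)) = single b c"
proof -
  let ?b = "mon_deg m + e 0 k"
  have t: "single k (single m a) \<in> M 0" using assms by (simp add: gfree_single poly_ring_single)
  have "keys (E (single k (single m a))) \<subseteq> {?b}" by (rule E_hom[OF t ghom_single_single])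
  hence "E (single k (single m a)) = single ?b (lookup (E (single k (single m a))) ?b)"
    by (intro poly_mapping_eqI) (auto simp: lookup_single when_def in_keys_iff subset_iff)
  moreover have "?b \<in> monoid_span G"
    using assms by (intro monoid_span_add mon_deg_in_span deg)
  ultimately show thesis using that by blast
qed

end

section \<open>The tensor product of two resolutions\<close>

locale resolution_pair =
  A: minimal_resolution G1 S1 e1 D1 E1 + B: minimal_resolution G2 S2 e2 D2 E2
  for G1 G2 :: "(nat ^ 'r::finite) set" and S1 S2 and e1 e2 :: "nat \<Rightarrow> nat \<Rightarrow> nat ^ 'r"
    and D1 D2 :: "nat \<Rightarrow> ('r, 'k::field) fvec \<Rightarrow> ('r, 'k) fvec" and E1 E2 +
  assumes direct: "direct G1 G2" and nonzero: "0 \<notin> G1" "0 \<notin> G2"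
begin

abbreviation "G \<equiv> G1 \<union> G2"

definition "TS n = {enc p a b | p a b. p \<le> n \<and> a \<in> S1 p \<and> b \<in> S2 (n - p)}"

definition "Te n i = e1 (enc1 i) (enc2 i) + e2 (n - enc1 i) (enc3 i)"

text \<open>The usual differential of a tensor product, with the sign given by the left degree. The
  truncated \<open>enc1 i - 1\<close> is harmless, since \<open>A.d 0\<close> vanishes.\<close>

definition "TD n = lin (\<lambda>i.
  tens (enc1 i - 1) (A.d (enc1 i) (single (enc2 i) 1)) (single (enc3 i) 1) +
  scal ((-1) ^ enc1 i) (tens (enc1 i) (single (enc2 i) 1) (B.d (n - enc1 i) (single (enc3 i) 1))))"

definition "TE = linE (\<lambda>i. E1 (single (enc2 i) 1) * E2 (single (enc3 i) 1))"

abbreviation "TM n \<equiv> gfree G (TS n) :: ('r, 'k) fvec set"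

lemma disjoint: "G1 \<inter> G2 = {}"
  using direct_Int[OF direct] monoid_span_base[of _ G1] monoid_span_base[of _ G2] nonzero by blast

lemma TSI: "a \<in> S1 p \<Longrightarrow> b \<in> S2 q \<Longrightarrow> n = p + q \<Longrightarrow> enc p a b \<in> TS n"
  unfolding TS_def by (intro CollectI exI[of _ p] exI[of _ a] exI[of _ b]) auto

lemma TSE:
  assumes "i \<in> TS n"
  obtains p q a b where "n = p + q" "a \<in> S1 p" "b \<in> S2 q" "i = enc p a b"
  using assms unfolding TS_def by (auto dest: le_Suc_ex)

lemma A_M: "x \<in> A.M p \<Longrightarrow> x \<in> gfree G (S1 p)"
  using gfree_mono[of G1 G "S1 p" "S1 p"] by auto

lemma B_M: "x \<in> B.M p \<Longrightarrow> x \<in> gfree G (S2 p)"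
  using gfree_mono[of G2 G "S2 p" "S2 p"] by auto

lemma tens_TM: "x \<in> A.M p \<Longrightarrow> y \<in> B.M q \<Longrightarrow> n = p + q \<Longrightarrow> tens p x y \<in> TM n"
  by (rule tens_closed[OF A_M B_M]) (auto intro: TSI)

text \<open>The variables are disjoint, so a monomial is the product of its parts in
  \<open>G1\<close> and in \<open>G2\<close>. Hence tensors of vectors over the two smaller rings
  generate additively, which is \<open>pure_induct\<close>.\<close>

lemma tens_term:
  assumes "keys m \<subseteq> G"
  shows "single (enc p a b) (single m c) =
    tens p (single a (single (sproj G1 m) c)) (single b (single (sproj G2 m) 1))"
  using sproj_Un[OF assms disjoint] by (simp add: mult_single)

lemma pure_induct [consumes 1, case_names zero tens add]:
  assumes v: "v \<in> TM n"
    and z: "Q 0"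
    and t: "\<And>p q x y. n = p + q \<Longrightarrow> x \<in> A.M p \<Longrightarrow> y \<in> B.M q \<Longrightarrow> Q (tens p x y)"
    and a: "\<And>u w. u \<in> TM n \<Longrightarrow> w \<in> TM n \<Longrightarrow> Q u \<Longrightarrow> Q w \<Longrightarrow> Q (u + w)"
  shows "Q v"
  using v
proof (induction v rule: gfree_induct)
  case (single i m c)
  obtain p q a b where i: "n = p + q" "a \<in> S1 p" "b \<in> S2 q" "i = enc p a b"
    using single(1) by (rule TSE)
  have k: "keys (sproj G1 m) \<subseteq> G1" "keys (sproj G2 m) \<subseteq> G2"
    using keys_sproj[of G1 m] keys_sproj[of G2 m] by auto
  show ?case unfolding i(4) tens_term[OF single(2)]
    by (rule t) (use i k in \<open>auto intro: gfree_single poly_ring_single\<close>)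
qed (use z a in auto)

lemma TD_add: "TD n (u + v) = TD n u + TD n v"
  by (simp add: TD_def lin_add)
lemma TD_smult: "TD n (smult p v) = smult p (TD n v)"
  by (simp add: TD_def lin_smult)
lemma TD_0 [simp]: "TD n 0 = 0"
  by (simp add: TD_def)
lemma TE_add: "TE (u + v) = TE u + TE v"
  by (simp add: TE_def linE_add)
lemma TE_smult: "TE (smult p v) = to_semigroup_ring p * TE v"
  by (simp add: TE_def linE_smult)
lemma TE_0 [simp]: "TE 0 = 0"
  by (simp add: TE_def)

lemma TD_tens:
  assumes "x \<in> A.M p" "y \<in> B.M q" "n = p + q"
  shows "TD n (tens p x y) = tens (p - 1) (A.d p x) y + scal ((-1) ^ p) (tens p x (B.d q y))"
  unfolding assms(3) using assms(1,2)
proof (induction x y rule: gfree_induct2)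
  case (single k m c l n d)
  have *: "single m c \<in> poly_ring G1" "single n d \<in> poly_ring G2"
    "single k 1 \<in> A.M p" "single l 1 \<in> B.M q"
    using single by (auto intro: poly_ring_single gfree_single)
  have d1: "A.d p (single k (single m c)) = smult (single m c) (A.d p (single k 1))"
    using A.d_smult[OF *(1,3)] by simp
  have d2: "B.d q (single l (single n d)) = smult (single n d) (B.d q (single l 1))"
    using B.d_smult[OF *(2,4)] by simp
  show ?case unfolding d1 d2
    by (subst (3 4) single_smult)
       (simp add: TD_def tens_smult_left tens_smult_right smult_add_right smult_smult ac_simps del: smult_single)
next
  case add_left thus ?case by (simp add: tens_add_left tens_add_right TD_add A.d_add smult_add_right)
next
  case add_right thus ?case by (simp add: tens_add_left tens_add_right TD_add B.d_add smult_add_right)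
qed simp_all

lemma TE_tens:
  assumes "x \<in> A.M 0" "y \<in> B.M 0"
  shows "TE (tens 0 x y) = E1 x * E2 y"
  using assms
proof (induction x y rule: gfree_induct2)
  case (single k m c l n d)
  have *: "single m c \<in> poly_ring G1" "single n d \<in> poly_ring G2"
    "single k 1 \<in> A.M 0" "single l 1 \<in> B.M 0"
    using single by (auto intro: poly_ring_single gfree_single)
  have d1: "E1 (single k (single m c)) = to_semigroup_ring (single m c) * E1 (single k 1)"
    using A.E_smult[OF *(1,3)] by simp
  have d2: "E2 (single l (single n d)) = to_semigroup_ring (single n d) * E2 (single l 1)"
    using B.E_smult[OF *(2,4)] by simp
  show ?case unfolding d1 d2
    by (simp add: TE_def to_semigroup_ring_mult ac_simps)
next
  case add_left thus ?case by (simp add: tens_add_left TE_add A.E_add distrib_right)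
next
  case add_right thus ?case by (simp add: tens_add_right TE_add B.E_add distrib_left)
qed (simp_all add: A.E_0 B.E_0)

lemma TD_closed: "v \<in> TM (Suc n) \<Longrightarrow> TD (Suc n) v \<in> TM n"
proof (induction v rule: pure_induct)
  case (tens p q x y)
  have "tens (p - 1) (A.d p x) y \<in> TM n"
    using A.d_closed[OF tens(2)] tens by (cases p) (auto intro!: tens_TM)
  moreover have "tens p x (B.d q y) \<in> TM n"
    using B.d_closed[OF tens(3)] tens by (cases q) (auto intro!: tens_TM)
  ultimately show ?case
    by (simp add: TD_tens[OF tens(2,3,1)] gfree_add gfree_smult)
qed (simp_all add: TD_add gfree_add)

lemma TD_minimal: "v \<in> TM n \<Longrightarrow> lookup (lookup (TD n v) k) 0 = 0"
proof (induction v rule: pure_induct)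
  case (tens p q x y)
  have "lookup (lookup (tens (p - 1) (A.d p x) y) k) 0 = 0"
    by (rule tens_lookup_0_left) (rule A.d_minimal[OF tens(2)])
  moreover have "lookup (lookup (tens p x (B.d q y)) k) 0 = 0"
    by (rule tens_lookup_0_right) (rule B.d_minimal[OF tens(3)])
  ultimately show ?case
    by (simp add: TD_tens[OF tens(2,3,1)] lookup_add lookup_mult_0)
qed (simp_all add: TD_add lookup_add)

text \<open>The two mixed terms are equal and carry opposite signs. The cases \<open>p = 0\<close>
  and \<open>q = 0\<close> are separate because predecessors are truncated there, but the
  corresponding term is zero.\<close>

lemma TD_TD: "v \<in> TM (Suc n) \<Longrightarrow> TD n (TD (Suc n) v) = 0"
proof (induction v rule: pure_induct)
  case (tens p q x y)
  let ?x = "A.d p x" and ?y = "B.d q y"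
  have x: "?x \<in> A.M (p - 1)" and y: "?y \<in> B.M (q - 1)"
    using A.d_closed B.d_closed tens by auto
  have 1: "TD n (tens (p - 1) ?x y) = scal ((-1) ^ (p - 1)) (tens (p - 1) ?x ?y)"
  proof (cases p)
    case 0 thus ?thesis by simp
  next
    case (Suc p')
    thus ?thesis using TD_tens[OF x tens(3), of n] tens(1) A.d_d[OF tens(2)] by simp
  qed
  have 2: "TD n (tens p x ?y) = tens (p - 1) ?x ?y"
  proof (cases q)
    case 0 thus ?thesis by simp
  next
    case (Suc q')
    thus ?thesis using TD_tens[OF tens(2) y, of n] tens(1) B.d_d[OF tens(3)] by simp
  qed
  show ?case
    unfolding TD_tens[OF tens(2,3,1)] TD_add TD_smult 1 2
    by (cases p) (simp_all add: single_uminus smult_uminus_left)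
qed (simp_all add: TD_add)

lemma TE_TD: "v \<in> TM (Suc 0) \<Longrightarrow> TE (TD (Suc 0) v) = 0"
proof (induction v rule: pure_induct)
  case (tens p q x y)
  have eq: "TE (TD (Suc 0) (tens p x y)) = TE (tens (p - 1) (A.d p x) y) +
      to_semigroup_ring (single 0 ((-1) ^ p)) * TE (tens p x (B.d q y))"
    by (simp only: TD_tens[OF tens(2,3,1)] TE_add TE_smult)
  have "p = 0 \<and> q = Suc 0 \<or> p = Suc 0 \<and> q = 0" using tens(1) by auto
  thus ?case unfolding eq
    using tens(2,3) A.E_D[of x] A.D_closed[of x 0] B.E_D[of y] B.D_closed[of y 0]
    by (auto simp: TE_tens)
qed (simp_all add: TD_add TE_add)

text \<open>The homotopy \<open>h\<^sub>1 \<otimes> 1 + \<sigma>\<^sub>1\<epsilon>\<^sub>1 \<otimes> h\<^sub>2\<close> contracts the tensor product.\<close>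

lemma TM_contraction:
  obtains H \<tau> where "\<And>n v. v \<in> TM n \<Longrightarrow> H n v \<in> TM (Suc n)" "\<And>n. H n 0 = 0" "\<tau> 0 = 0"
    "\<And>n v. v \<in> TM (Suc n) \<Longrightarrow> TD (Suc (Suc n)) (H (Suc n) v) + H n (TD (Suc n) v) = v"
    "\<And>v. v \<in> TM 0 \<Longrightarrow> TD (Suc 0) (H 0 v) + \<tau> (TE v) = v"
proof -
  obtain h1 \<sigma>1 where h1:
    "\<And>p x. x \<in> A.M p \<Longrightarrow> h1 p x \<in> A.M (Suc p)"
    "\<And>p x y. x \<in> A.M p \<Longrightarrow> y \<in> A.M p \<Longrightarrow> h1 p (x + y) = h1 p x + h1 p y"
    "\<And>p c x. x \<in> A.M p \<Longrightarrow> h1 p (scal c x) = scal c (h1 p x)"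
    and \<sigma>1: "\<And>f. \<sigma>1 f \<in> A.M 0" "\<And>f g. \<sigma>1 (f + g) = \<sigma>1 f + \<sigma>1 g"
    "\<And>c f. \<sigma>1 (single 0 c * f) = scal c (\<sigma>1 f)"
    and h1_eq: "\<And>x. x \<in> A.M 0 \<Longrightarrow> D1 (Suc 0) (h1 0 x) = x - \<sigma>1 (E1 x)"
    "\<And>p x. x \<in> A.M (Suc p) \<Longrightarrow> D1 (Suc (Suc p)) (h1 (Suc p) x) + h1 p (D1 (Suc p) x) = x"
    using A.contracting_homotopy by blast
  obtain h2 \<sigma>2 where h2:
    "\<And>p x. x \<in> B.M p \<Longrightarrow> h2 p x \<in> B.M (Suc p)"
    "\<And>p x y. x \<in> B.M p \<Longrightarrow> y \<in> B.M p \<Longrightarrow> h2 p (x + y) = h2 p x + h2 p y"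
    "\<And>p c x. x \<in> B.M p \<Longrightarrow> h2 p (scal c x) = scal c (h2 p x)"
    and \<sigma>2: "\<And>f. \<sigma>2 f \<in> B.M 0" "\<And>f g. \<sigma>2 (f + g) = \<sigma>2 f + \<sigma>2 g"
    "\<And>c f. \<sigma>2 (single 0 c * f) = scal c (\<sigma>2 f)"
    and h2_eq: "\<And>x. x \<in> B.M 0 \<Longrightarrow> D2 (Suc 0) (h2 0 x) = x - \<sigma>2 (E2 x)"
    "\<And>p x. x \<in> B.M (Suc p) \<Longrightarrow> D2 (Suc (Suc p)) (h2 (Suc p) x) + h2 p (D2 (Suc p) x) = x"
    using B.contracting_homotopy by blast
  have \<sigma>0: "\<sigma>1 0 = 0" "\<sigma>2 0 = 0" using \<sigma>1(2)[of 0 0] \<sigma>2(2)[of 0 0] by simp_all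
  have h0: "h1 p 0 = 0" "h2 p 0 = 0" for p using h1(2)[of 0 p 0] h2(2)[of 0 p 0] by simp_all
  have \<sigma>_single: "\<sigma>1 (single b c) = scal c (\<sigma>1 (single b 1))" "\<sigma>2 (single b c) = scal c (\<sigma>2 (single b 1))" for b c
    using \<sigma>1(3)[of c "single b 1"] \<sigma>2(3)[of c "single b 1"] by (simp_all add: mult_single)
  \<comment> \<open>The homotopy on pure tensors. Its second term exists only for
    \<open>p = 0\<close>, since the augmentation is defined in degree 0; there \<open>n\<close> is
    the degree of \<open>y\<close>.\<close>
  define T where "T n p x y = tens (Suc p) (h1 p x) y + (if p = 0 then tens 0 (\<sigma>1 (E1 x)) (h2 n y) else 0)"
    for n p x y
  \<comment> \<open>A term of the product determines its two factors once its monomial is split by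
    variables, so \<open>T\<close> can be prescribed on terms and extended over the field.\<close>
  define H where "H n = kext (\<lambda>i m. T n (enc1 i) (single (enc2 i) (single (sproj G1 m) 1))
    (single (enc3 i) (single (sproj G2 m) 1)))" for n
  have T_add1: "T n p (x + x') y = T n p x y + T n p x' y" if "x \<in> A.M p" "x' \<in> A.M p" for n p x x' y
    using that by (auto simp: T_def h1 \<sigma>1 A.E_add tens_add_left)
  have T_add2: "T n p x (y + y') = T n p x y + T n p x y'" if "y \<in> B.M q" "y' \<in> B.M q" "n = p + q" for n p q x y y'
    using that by (auto simp: T_def h2 tens_add_right)
  have T_scal1: "T n p (scal c x) y = scal c (T n p x y)" if "x \<in> A.M p" for n p c x y
    using that by (auto simp: T_def h1 \<sigma>1 A.E_smult to_semigroup_ring_single tens_smult_left smult_add_right)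
  have T_scal2: "T n p x (scal c y) = scal c (T n p x y)" if "y \<in> B.M q" "n = p + q" for n p q c x y
    using that by (auto simp: T_def h2 tens_smult_right smult_add_right)
  have T_0: "T n p 0 y = 0" "T n p x 0 = 0" for n p x y
    by (simp_all add: T_def h0 \<sigma>0 A.E_0)
  have H_tens: "H n (tens p x y) = T n p x y" if "x \<in> A.M p" "y \<in> B.M q" "n = p + q" for n p q x y
    unfolding that(3) using that(1,2)
  proof (induction x y rule: gfree_induct2)
    case (single k m c l n' d)
    have M: "single k (single m 1) \<in> A.M p" "single l (single n' 1) \<in> B.M q"
      using single by (auto intro: poly_ring_single gfree_single)
    have "keys n' \<inter> G1 = {}" "keys m \<inter> G2 = {}" using single disjoint by blast+
    hence s: "sproj G1 (m + n') = m" "sproj G2 (m + n') = n'"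
      using single by (auto simp: sproj_add sproj_id sproj_disjoint)
    have "single k (single m c) = scal c (single k (single m 1))"
      "single l (single n' d) = scal d (single l (single n' 1))"
      by (simp_all add: mult_single)
    moreover have "H (p + q) (tens p (single k (single m c)) (single l (single n' d))) =
      scal (c * d) (T (p + q) p (single k (single m 1)) (single l (single n' 1)))"
      by (simp add: H_def mult_single s)
    ultimately show ?case
      using M by (simp add: T_scal1 T_scal2 gfree_smult smult_smult mult_single mult.commute del: smult_single)
  next
    case add_left thus ?case by (simp add: tens_add_left T_add1 H_def kext_add)
  next
    case add_right thus ?case by (simp add: tens_add_right T_add2 H_def kext_add)
  qed (simp_all add: H_def T_0)
  have H_add: "H n (u + v) = H n u + H n v" for n u v by (simp add: H_def kext_add)
  have H_scal: "H n (scal c v) = scal c (H n v)" for n c v by (simp add: H_def kext_scal)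
  have H_0: "H n 0 = 0" for n by (simp add: H_def)
  have H_closed: "H n v \<in> TM (Suc n)" if "v \<in> TM n" for n v
    using that
  proof (induction v rule: pure_induct)
    case (tens p q x y)
    have "tens (Suc p) (h1 p x) y \<in> TM (Suc n)"
      using tens h1 by (intro tens_TM) auto
    moreover have "tens 0 (\<sigma>1 (E1 x)) (h2 n y) \<in> TM (Suc n)" if "p = 0"
      using tens h2 \<sigma>1 that by (intro tens_TM) auto
    ultimately show ?case
      by (simp add: H_tens[OF tens(2,3,1)] T_def gfree_add)
  qed (simp_all add: H_0 H_add gfree_add)
  \<comment> \<open>Directness makes the decomposition of a degree unique, so the choice returns
    exactly the two components.\<close>
  define dec where "dec \<gamma> = (SOME xy. fst xy \<in> monoid_span G1 \<and> snd xy \<in> monoid_span G2 \<and> fst xy + snd xy = \<gamma>)"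
    for \<gamma>
  have dec: "dec (x + y) = (x, y)" if "x \<in> monoid_span G1" "y \<in> monoid_span G2" for x y
  proof -
    have "fst (dec (x + y)) \<in> monoid_span G1 \<and> snd (dec (x + y)) \<in> monoid_span G2 \<and>
        fst (dec (x + y)) + snd (dec (x + y)) = x + y"
      unfolding dec_def by (rule someI[of _ "(x, y)"]) (use that in auto)
    thus ?thesis using directD[OF direct] that by (intro prod_eqI) auto
  qed
  \<comment> \<open>A linear section of \<open>TE\<close>: each degree is split into its two
    components, and the sections of the factors are applied to them.\<close>
  define \<tau> where "\<tau> = pext (\<lambda>\<gamma>. tens 0 (\<sigma>1 (single (fst (dec \<gamma>)) 1)) (\<sigma>2 (single (snd (dec \<gamma>)) 1)))"
  have \<tau>: "\<tau> (E1 x * E2 y) = tens 0 (\<sigma>1 (E1 x)) (\<sigma>2 (E2 y))" if "x \<in> A.M 0" "y \<in> B.M 0" for x y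
    using that
  proof (induction x y rule: gfree_induct2)
    case (single k m c l n d)
    obtain b1 c1 where 1: "b1 \<in> monoid_span G1" "E1 (single k (single m c)) = single b1 c1"
      using A.E_single[OF single(1,2)] by blast
    obtain b2 c2 where 2: "b2 \<in> monoid_span G2" "E2 (single l (single n d)) = single b2 c2"
      using B.E_single[OF single(3,4)] by blast
    show ?case
      by (simp add: 1(2) 2(2) mult_single \<tau>_def dec[OF 1(1) 2(1)] \<sigma>_single[of b1 c1] \<sigma>_single[of b2 c2]
          tens_smult_left tens_smult_right smult_smult mult.commute)
  next
    case add_left thus ?case by (simp add: A.E_add distrib_right \<tau>_def pext_add \<sigma>1 tens_add_left)
  next
    case add_right thus ?case by (simp add: B.E_add distrib_left \<tau>_def pext_add \<sigma>2 tens_add_right)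
  qed (simp_all add: A.E_0 B.E_0 \<sigma>0 \<tau>_def)
  show thesis
  proof (rule that[of H \<tau>])
    fix n v assume "v \<in> TM (Suc n)"
    thus "TD (Suc (Suc n)) (H (Suc n) v) + H n (TD (Suc n) v) = v"
    proof (induction v rule: pure_induct)
      case (tens p q x y)
      show ?case
      proof (cases p)
        case 0
        then obtain q' where q: "q = Suc q'" and n: "n = q'" using tens(1) by (cases q) auto
        have x: "x \<in> A.M 0" and y: "y \<in> B.M (Suc q')" using tens 0 q by auto
        have Dy: "D2 (Suc q') y \<in> B.M q'" by (rule B.D_closed[OF y])
        have a: "TD (Suc (Suc q')) (tens (Suc 0) (h1 0 x) y) =
            tens 0 (x - \<sigma>1 (E1 x)) y - tens (Suc 0) (h1 0 x) (D2 (Suc q') y)"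
          using TD_tens[OF h1(1)[OF x] y, of "Suc (Suc q')"] h1_eq(1)[OF x]
          by (simp add: single_uminus smult_uminus_left)
        \<comment> \<open>\<open>h1\<close> contracts \<open>x\<close> only up to
          \<open>\<sigma>1 (E1 x)\<close>; this second part of \<open>T\<close> supplies the missing
          tensor.\<close>
        have b: "TD (Suc (Suc q')) (tens 0 (\<sigma>1 (E1 x)) (h2 (Suc q') y)) =
            tens 0 (\<sigma>1 (E1 x)) (D2 (Suc (Suc q')) (h2 (Suc q') y))"
          using TD_tens[OF \<sigma>1(1) h2(1)[OF y], of "Suc (Suc q')"] by simp
        have c: "TD (Suc q') (tens 0 x y) = tens 0 x (D2 (Suc q') y)"
          using TD_tens[OF x y, of "Suc q'"] by simp
        have d: "D2 (Suc (Suc q')) (h2 (Suc q') y) = y - h2 q' (D2 (Suc q') y)"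
          using h2_eq(2)[OF y] by (simp add: algebra_simps)
        have "TD (Suc (Suc n)) (H (Suc n) (tens p x y)) + H n (TD (Suc n) (tens p x y)) =
           TD (Suc (Suc q')) (T (Suc q') 0 x y) + T q' 0 x (D2 (Suc q') y)"
          using H_tens[OF x y, of "Suc q'"] H_tens[OF x Dy, of q'] 0 n c by simp
        also have "\<dots> = tens 0 x y"
          by (simp add: T_def TD_add a b d tens_diff_left tens_diff_right)
        finally show ?thesis using 0 by simp
      next
        case (Suc p')
        have x: "x \<in> A.M (Suc p')" and y: "y \<in> B.M q" and n: "n = p' + q" using tens Suc by auto
        have Dx: "D1 (Suc p') x \<in> A.M p'" by (rule A.D_closed[OF x])
        have T1: "T (Suc n) (Suc p') x y = tens (Suc (Suc p')) (h1 (Suc p') x) y" by (simp add: T_def)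
        \<comment> \<open>For \<open>p' = 0\<close> the second part of \<open>T\<close> vanishes
          because the augmentation kills boundaries.\<close>
        have T2: "T n p' (D1 (Suc p') x) y = tens (Suc p') (h1 p' (D1 (Suc p') x)) y"
          using x A.E_D[of x] by (cases p') (auto simp: T_def \<sigma>0)
        have T3: "H n (tens (Suc p') x (B.d q y)) = tens (Suc (Suc p')) (h1 (Suc p') x) (B.d q y)"
        proof (cases q)
          case 0 thus ?thesis by (simp add: H_0)
        next
          case (Suc q')
          thus ?thesis using H_tens[OF x, of "D2 (Suc q') y" q' n] B.D_closed[of y q'] y n
            by (simp add: T_def)
        qed
        have d: "D1 (Suc (Suc p')) (h1 (Suc p') x) = x - h1 p' (D1 (Suc p') x)"
          using h1_eq(2)[OF x] by (simp add: algebra_simps)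
        have a: "TD (Suc (Suc n)) (tens (Suc (Suc p')) (h1 (Suc p') x) y) =
            tens (Suc p') (x - h1 p' (D1 (Suc p') x)) y +
            scal ((-1) ^ Suc (Suc p')) (tens (Suc (Suc p')) (h1 (Suc p') x) (B.d q y))"
          using TD_tens[OF h1(1)[OF x] y, of "Suc (Suc n)"] n by (simp add: d del: power_Suc)
        have b: "TD (Suc n) (tens (Suc p') x y) =
            tens p' (D1 (Suc p') x) y + scal ((-1) ^ Suc p') (tens (Suc p') x (B.d q y))"
          using TD_tens[OF x y, of "Suc n"] n by (simp del: power_Suc)
        have "TD (Suc (Suc n)) (H (Suc n) (tens p x y)) + H n (TD (Suc n) (tens p x y)) =
           TD (Suc (Suc n)) (T (Suc n) (Suc p') x y) + (T n p' (D1 (Suc p') x) y +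
             scal ((-1) ^ Suc p') (H n (tens (Suc p') x (B.d q y))))"
          using H_tens[OF x y, of "Suc n"] H_tens[OF Dx y n] n Suc b
          by (simp add: H_add H_scal del: power_Suc)
        also have "\<dots> = tens p x y"
          unfolding T1 T2 T3 a using Suc
          by (simp add: tens_diff_left single_uminus smult_uminus_left)
        finally show ?thesis .
      qed
    next
      case (add u w)
      have "TD (Suc (Suc n)) (H (Suc n) (u + w)) + H n (TD (Suc n) (u + w)) =
        (TD (Suc (Suc n)) (H (Suc n) u) + H n (TD (Suc n) u)) +
        (TD (Suc (Suc n)) (H (Suc n) w) + H n (TD (Suc n) w))"
        by (simp add: TD_add H_add)
      thus ?case using add by simp
    qed (simp add: H_0)
  next
    fix v assume "v \<in> TM 0"
    thus "TD (Suc 0) (H 0 v) + \<tau> (TE v) = v"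
    proof (induction v rule: pure_induct)
      case (tens p q x y)
      hence 0: "p = 0" "q = 0" and x: "x \<in> A.M 0" and y: "y \<in> B.M 0" by auto
      have a: "TD (Suc 0) (tens (Suc 0) (h1 0 x) y) = tens 0 (x - \<sigma>1 (E1 x)) y"
        using TD_tens[OF h1(1)[OF x] y, of "Suc 0"] h1_eq(1)[OF x] by simp
      have b: "TD (Suc 0) (tens 0 (\<sigma>1 (E1 x)) (h2 0 y)) = tens 0 (\<sigma>1 (E1 x)) (y - \<sigma>2 (E2 y))"
        using TD_tens[OF \<sigma>1(1) h2(1)[OF y], of "Suc 0"] h2_eq(1)[OF y] by simp
      have "TD (Suc 0) (H 0 (tens 0 x y)) + \<tau> (TE (tens 0 x y)) = tens 0 x y"
        using H_tens[OF x y, of 0]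
        by (simp add: T_def TD_add a b TE_tens x y \<tau> tens_diff_left tens_diff_right)
      thus ?case by (simp add: 0)
    next
      case (add u w)
      have "TD (Suc 0) (H 0 (u + w)) + \<tau> (TE (u + w)) =
        (TD (Suc 0) (H 0 u) + \<tau> (TE u)) + (TD (Suc 0) (H 0 w) + \<tau> (TE w))"
        by (simp add: TD_add H_add TE_add \<tau>_def pext_add)
      thus ?case using add by simp
    qed (simp add: H_0 \<tau>_def)
  qed (use H_closed H_0 in \<open>auto simp: \<tau>_def\<close>)
qed

text \<open>Exactness comes from the contraction: on a cycle the other summand vanishes, so
  \<open>v\<close> is the boundary of \<open>H n v\<close>. Surjectivity of \<open>TE\<close> comes
  from splitting each degree into its components.\<close>

lemma tensor_resolution: "minimal_resolution G TS Te TD TE"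
proof -
  obtain H \<tau> where H: "\<And>n v. v \<in> TM n \<Longrightarrow> H n v \<in> TM (Suc n)" "\<And>n. H n 0 = 0" "\<tau> 0 = 0"
    "\<And>n v. v \<in> TM (Suc n) \<Longrightarrow> TD (Suc (Suc n)) (H (Suc n) v) + H n (TD (Suc n) v) = v"
    "\<And>v. v \<in> TM 0 \<Longrightarrow> TD (Suc 0) (H 0 v) + \<tau> (TE v) = v"
    using TM_contraction by blast
  have sub: "monoid_span G1 \<subseteq> monoid_span G" "monoid_span G2 \<subseteq> monoid_span G"
    by (auto intro!: monoid_span_mono)
  have TE_closed: "TE v \<in> semigroup_ring (monoid_span G)" if "v \<in> TM 0" for v
    unfolding TE_def linE_def
  proof (rule sum_closed[where P="\<lambda>f. f \<in> semigroup_ring (monoid_span G)"])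
    fix i assume "i \<in> keys v"
    hence "i \<in> TS 0" and p: "lookup v i \<in> poly_ring G" using that by (auto simp: gfree_def)
    then obtain a b where i: "a \<in> S1 0" "b \<in> S2 0" "i = enc 0 a b" by (auto elim: TSE)
    have "E1 (single a 1) \<in> semigroup_ring (monoid_span G)" "E2 (single b 1) \<in> semigroup_ring (monoid_span G)"
      using A.E_closed[OF A.basis[OF i(1)]] B.E_closed[OF B.basis[OF i(2)]] sub
      by (auto intro: semigroup_ring_mono)
    thus "to_semigroup_ring (lookup v i) * (E1 (single (enc2 i) 1) * E2 (single (enc3 i) 1))
        \<in> semigroup_ring (monoid_span G)"
      unfolding i(3) enc_simps using p i by (intro semigroup_ring_mult to_semigroup_ring_closed) auto
  qed (auto intro: semigroup_ring_add)
  show ?thesis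
  proof
    fix j
    have "TS j \<subseteq> (\<lambda>(p, a, b). enc p a b) ` (SIGMA p:{..j}. S1 p \<times> S2 (j - p))"
      by (auto simp: TS_def intro!: image_eqI[where x="(p, a, b)" for p a b])
    thus "finite (TS j)" by (rule finite_subset) (use A.fin B.fin in auto)
  next
    fix k j assume "k \<in> TS j"
    then obtain p q a b where k: "j = p + q" "a \<in> S1 p" "b \<in> S2 q" "k = enc p a b" by (rule TSE)
    thus "Te j k \<in> monoid_span G"
      using A.deg[OF k(2)] B.deg[OF k(3)] sub by (auto simp: Te_def intro!: monoid_span_add)
  next
    fix j show "linear_map_on (poly_ring G) smult smult (TM (Suc j)) (TM j) (TD (Suc j))"
      by (auto simp: linear_map_on_iff TD_add TD_smult TD_closed)
  next
    fix v j d assume v: "v \<in> TM (Suc j)" and d: "ghom (Te (Suc j)) d v"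
    show "ghom (Te j) d (TD (Suc j) v)"
      unfolding TD_def
    proof (rule lin_ghom[OF d])
      fix i assume "i \<in> keys v"
      hence "i \<in> TS (Suc j)" using v by (auto simp: gfree_def)
      then obtain p q a b where i: "Suc j = p + q" "a \<in> S1 p" "b \<in> S2 q" "i = enc p a b" by (rule TSE)
      have q: "Suc j - p = q" using i by simp
      have "ghom (Te j) (Te (Suc j) i) (tens (p - 1) (A.d p (single a 1)) (single b 1))"
      proof (cases p)
        case 0 thus ?thesis by simp
      next
        case (Suc p')
        show ?thesis unfolding Te_def i(4) enc_simps q
          by (rule tens_ghom[OF A.d_ghom[OF A.basis[OF i(2)] ghom_basis] ghom_basis])
             (use Suc i(1) in \<open>simp add: q\<close>)
      qed
      moreover have "ghom (Te j) (Te (Suc j) i) (tens p (single a 1) (B.d q (single b 1)))"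
      proof (cases q)
        case 0 thus ?thesis by simp
      next
        case (Suc q')
        show ?thesis unfolding Te_def i(4) enc_simps q
          by (rule tens_ghom[OF ghom_basis B.d_ghom[OF B.basis[OF i(3)] ghom_basis]])
             (use Suc i(1) in \<open>simp add: q\<close>)
      qed
      ultimately show "ghom (Te j) (Te (Suc j) i)
         (tens (enc1 i - 1) (A.d (enc1 i) (single (enc2 i) 1)) (single (enc3 i) 1) +
          scal ((-1) ^ enc1 i) (tens (enc1 i) (single (enc2 i) 1) (B.d (Suc j - enc1 i) (single (enc3 i) 1))))"
        using q by (auto simp: i(4) intro!: ghom_add ghom_smult split: if_splits)
    qed
  next
    show "linear_map_on (poly_ring G) smult (\<lambda>p f. to_semigroup_ring p * f) (TM 0)
        (semigroup_ring (monoid_span G)) TE"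
      by (auto simp: linear_map_on_iff TE_add TE_smult TE_closed)
  next
    fix v d assume v: "v \<in> TM 0" and d: "ghom (Te 0) d v"
    show "keys (TE v) \<subseteq> {d}"
      unfolding TE_def linE_def
    proof (rule sum_closed[where P="\<lambda>f. keys f \<subseteq> {d}"])
      fix i assume iv: "i \<in> keys v"
      hence "i \<in> TS 0" using v by (auto simp: gfree_def)
      then obtain a b where i: "a \<in> S1 0" "b \<in> S2 0" "i = enc 0 a b" by (auto elim: TSE)
      have 1: "keys (E1 (single a 1)) \<subseteq> {e1 0 a}" "keys (E2 (single b 1)) \<subseteq> {e2 0 b}"
        using A.E_hom[OF A.basis[OF i(1)] ghom_basis] B.E_hom[OF B.basis[OF i(2)] ghom_basis] .
      have "keys (to_semigroup_ring (lookup v i)) \<subseteq> {f. f + Te 0 i = d}"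
        unfolding to_semigroup_ring_def
        by (rule sum_closed[where P="\<lambda>f. keys f \<subseteq> {f. f + Te 0 i = d}", OF _ _ keys_add_subset])
           (use d iv in \<open>auto simp: ghom_def\<close>)
      moreover have "keys (E1 (single a 1) * E2 (single b 1)) \<subseteq> {Te 0 i}"
        using keys_mult[of "E1 (single a 1)" "E2 (single b 1)"] 1 by (auto simp: Te_def i(3))
      ultimately show "keys (to_semigroup_ring (lookup v i) * (E1 (single (enc2 i) 1) * E2 (single (enc3 i) 1))) \<subseteq> {d}"
        using keys_mult[of "to_semigroup_ring (lookup v i)" "E1 (single a 1) * E2 (single b 1)"]
        unfolding i(3) enc_simps by blast
    qed (simp, erule (1) keys_add_subset)
  next
    show "TE ` TM 0 = semigroup_ring (monoid_span G)"
    proof (intro equalityI subsetI)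
      fix f :: "(nat ^ 'r) \<Rightarrow>\<^sub>0 'k" assume f: "f \<in> semigroup_ring (monoid_span G)"
      have "(\<Sum>g\<in>keys f. single g (lookup f g)) \<in> TE ` TM 0"
      proof (rule sum_closed[where P="\<lambda>f. f \<in> TE ` TM 0"])
        fix g assume "g \<in> keys f"
        hence "g \<in> monoid_span G" using f by (auto simp: semigroup_ring_def)
        then obtain x y where g: "g = x + y" "x \<in> monoid_span G1" "y \<in> monoid_span G2"
          by (auto simp: monoid_span_Un)
        have "single x (lookup f g) \<in> E1 ` A.M 0" "single y 1 \<in> E2 ` B.M 0"
          unfolding A.E_surj B.E_surj using g by (auto simp: semigroup_ring_def)
        then obtain u v where uv: "u \<in> A.M 0" "E1 u = single x (lookup f g)" "v \<in> B.M 0" "E2 v = single y 1"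
          by (metis imageE)
        have "TE (tens 0 u v) = single g (lookup f g)"
          using TE_tens[OF uv(1,3)] uv g by (simp add: mult_single)
        thus "single g (lookup f g) \<in> TE ` TM 0"
          using tens_TM[OF uv(1,3)] by (intro image_eqI[of _ _ "tens 0 u v"]) auto
      next
        show "0 \<in> TE ` TM 0" by (intro image_eqI[of _ _ 0]) auto
        fix f g assume "f \<in> TE ` TM 0" "g \<in> TE ` TM 0"
        then obtain u v where "u \<in> TM 0" "v \<in> TM 0" "f = TE u" "g = TE v" by auto
        thus "f + g \<in> TE ` TM 0"
          by (intro image_eqI[of _ _ "u + v"]) (auto simp: TE_add gfree_add)
      qed
      thus "f \<in> TE ` TM 0" by (simp add: poly_mapping_sum_single)
    qed (use TE_closed in auto)
  next
    show "TD (Suc 0) ` TM (Suc 0) = {v \<in> TM 0. TE v = 0}"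
    proof (intro equalityI subsetI)
      fix v assume "v \<in> {v \<in> TM 0. TE v = 0}"
      hence "v \<in> TM 0" "TD (Suc 0) (H 0 v) = v" using H(5)[of v] H(3) by auto
      thus "v \<in> TD (Suc 0) ` TM (Suc 0)" using H(1) by (intro image_eqI[of _ _ "H 0 v"]) auto
    qed (auto simp: TD_closed TE_TD)
  next
    fix j show "TD (Suc (Suc j)) ` TM (Suc (Suc j)) = {v \<in> TM (Suc j). TD (Suc j) v = 0}"
    proof (intro equalityI subsetI)
      fix v assume "v \<in> {v \<in> TM (Suc j). TD (Suc j) v = 0}"
      hence "v \<in> TM (Suc j)" "TD (Suc (Suc j)) (H (Suc j) v) = v" using H(4)[of v j] H(2) by auto
      thus "v \<in> TD (Suc (Suc j)) ` TM (Suc (Suc j))"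
        using H(1) by (intro image_eqI[of _ _ "H (Suc j) v"]) auto
    qed (auto simp: TD_closed TD_TD)
  qed (rule TD_minimal)
qed

end

section \<open>Degrees along a minimal resolution, and incomparability of the tensor product\<close>

context minimal_resolution
begin

text \<open>The boundary of \<open>e_l\<close> has a nonzero entry, and by minimality all its
  monomials are nonconstant, hence of nonzero degree.\<close>

lemma degree_step:
  assumes G: "0 \<notin> G" and l: "l \<in> S (Suc p)"
  shows "\<exists>k\<in>S p. \<exists>g\<in>monoid_span G. g \<noteq> 0 \<and> e (Suc p) l = e p k + g"
proof -
  let ?w = "D (Suc p) (single l 1)"
  have w: "?w \<in> M p" using D_closed[OF basis[OF l]] .
  obtain k where k: "lookup ?w k \<noteq> 0"
    using D_basis_nonzero[OF l] by (metis lookup_zero poly_mapping_eqI)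
  then obtain m where m: "lookup (lookup ?w k) m \<noteq> 0"
    by (metis lookup_zero poly_mapping_eqI)
  have "ghom (e p) (e (Suc p) l) ?w" by (rule D_hom[OF basis[OF l] ghom_basis])
  hence eq: "e (Suc p) l = e p k + mon_deg m" using m unfolding ghom_alt by (metis add.commute)
  have "k \<in> S p" and mG: "keys m \<subseteq> G"
    using w k m by (auto simp: gfree_def poly_ring_def in_keys_iff)
  moreover have "m \<noteq> 0" using m minimal[OF basis[OF l], of k] by metis
  hence "mon_deg m \<noteq> 0" using mon_deg_eq_0[OF mG G] by blast
  ultimately show ?thesis using eq mon_deg_in_span[OF mG] by blast
qed

lemma degree_descent:
  assumes G: "0 \<notin> G" and "p < q" and "l \<in> S q"
  shows "\<exists>k\<in>S p. \<exists>g\<in>monoid_span G. g \<noteq> 0 \<and> e q l = e p k + g"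
  using \<open>p < q\<close> \<open>l \<in> S q\<close>
proof (induction q arbitrary: l)
  case (Suc q)
  obtain k g where k: "k \<in> S q" "g \<in> monoid_span G" "g \<noteq> 0" "e (Suc q) l = e q k + g"
    using degree_step[OF G Suc.prems(2)] by blast
  show ?case
  proof (cases "p = q")
    case True
    thus ?thesis using k by blast
  next
    case False
    then obtain k' g' where k': "k' \<in> S p" "g' \<in> monoid_span G" "g' \<noteq> 0" "e q k = e p k' + g'"
      using Suc.IH[of k] Suc.prems k by force
    have "e (Suc q) l = e p k' + (g' + g)" using k k' by (simp add: add.assoc)
    moreover have "g' + g \<noteq> 0" using k' by (simp add: vec_nat_add_eq_0)
    ultimately show ?thesis using k k' monoid_span_add by blast
  qed
qed simp

text \<open>Descending from \<open>l\<close> to level \<open>p\<close> would exhibit a basis degree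
  of that level below \<open>e p k\<close> by a nonzero amount. This rules out comparisons between
  different homological degrees inside the tensor product.\<close>

lemma incomparable_levels:
  assumes G: "0 \<notin> G" and inc: "\<And>n. incomparable G (S n) (e n)"
    and "k \<in> S p" "l \<in> S q" "p < q" "g \<in> monoid_span G"
  shows "e p k \<noteq> e q l + g"
proof
  assume eq: "e p k = e q l + g"
  obtain k' g' where k': "k' \<in> S p" "g' \<in> monoid_span G" "g' \<noteq> 0" "e q l = e p k' + g'"
    using degree_descent[OF G \<open>p < q\<close> \<open>l \<in> S q\<close>] by blast
  have *: "e p k = e p k' + (g' + g)" using eq k' by (simp add: add.assoc)
  hence "k = k'" using incomparableD[OF inc \<open>k \<in> S p\<close> k'(1)] monoid_span_add k' assms by blast
  thus False using * k' by (simp add: vec_nat_add_eq_0)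
qed

end

text \<open>Directness splits a comparison into one in each factor. If \<open>p\<close> and
  \<open>p'\<close> differed, then, the total degree being fixed, one factor would compare a lower
  level with a higher one.\<close>

lemma (in resolution_pair) tensor_incomparable:
  assumes inc: "\<And>n. incomparable G1 (S1 n) (e1 n)" "\<And>n. incomparable G2 (S2 n) (e2 n)"
  shows "incomparable G (TS n) (Te n)"
  unfolding incomparable_def
proof (intro ballI impI)
  fix k l g assume kl: "k \<in> TS n" "l \<in> TS n" and g: "g \<in> monoid_span G" and eq: "Te n k = Te n l + g"
  obtain p q a b where k: "n = p + q" "a \<in> S1 p" "b \<in> S2 q" "k = enc p a b"
    using kl(1) by (rule TSE)
  obtain p' q' a' b' where l: "n = p' + q'" "a' \<in> S1 p'" "b' \<in> S2 q'" "l = enc p' a' b'"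
    using kl(2) by (rule TSE)
  obtain g1 g2 where g12: "g1 \<in> monoid_span G1" "g2 \<in> monoid_span G2" "g = g1 + g2"
    using g by (auto simp: monoid_span_Un)
  have q: "n - p = q" "n - p' = q'" using k l by auto
  have "e1 p a + e2 q b = (e1 p' a' + g1) + (e2 q' b' + g2)"
    using eq by (simp add: Te_def k(4) l(4) q g12(3) ac_simps)
  hence eq1: "e1 p a = e1 p' a' + g1" and eq2: "e2 q b = e2 q' b' + g2"
    using directD[OF direct A.deg[OF k(2)] B.deg[OF k(3)]
        monoid_span_add[OF A.deg[OF l(2)] g12(1)] monoid_span_add[OF B.deg[OF l(3)] g12(2)]] by blast+
  have "\<not> p < p'" using A.incomparable_levels[OF nonzero(1) inc(1) k(2) l(2) _ g12(1)] eq1 by blast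
  moreover have "\<not> q < q'" using B.incomparable_levels[OF nonzero(2) inc(2) k(3) l(3) _ g12(2)] eq2 by blast
  ultimately have pq: "p = p'" "q = q'" using k(1) l(1) by auto
  have "a = a'" using incomparableD[OF inc(1)] k l eq1 g12 pq by metis
  moreover have "b = b'" using incomparableD[OF inc(2)] k l eq2 g12 pq by metis
  ultimately show "k = l" using k l pq by simp
qed

text \<open>Renumbering is a bijection preserving degrees, so incomparability carries over to the
  official record.\<close>

lemma (in minimal_resolution) incomparable_imp_SIFR:
  assumes m: "minimally_generates G \<Gamma>" and G: "0 \<notin> G" and inc: "\<And>n. incomparable G (S n) (e n)"
  shows "has_SIFR TYPE('k) \<Gamma>"
proof -
  obtain F :: "('r, 'k) based_complex" and \<rho> where F: "graded_minimal_free_resolution G F"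
    "\<And>j. bij_betw (\<rho> j) {..<betti F j} (S j)"
    "\<And>j k. k < betti F j \<Longrightarrow> bdeg F j k = e j (\<rho> j k)"
    using relabel by blast
  have "incomparable G {..<betti F n} (bdeg F n)" for n
    unfolding incomparable_def
  proof (intro ballI impI)
    fix k l g assume *: "k \<in> {..<betti F n}" "l \<in> {..<betti F n}" "g \<in> monoid_span G"
      "bdeg F n k = bdeg F n l + g"
    have "\<rho> n k \<in> S n" "\<rho> n l \<in> S n" using F(2)[of n] * by (auto simp: bij_betw_def)
    hence "\<rho> n k = \<rho> n l" using incomparableD[OF inc] * F(3) by (metis lessThan_iff)
    thus "k = l" using F(2)[of n] * by (auto simp: bij_betw_def inj_on_def)
  qed
  hence "strongly_indispensable G F"
    by (rule incomparable_imp_strongly_indispensable[OF F(1) G])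
  thus ?thesis using m by (auto simp: has_SIFR_def)
qed

text \<open>The starting resolutions of the final argument come from here. Uniqueness of the minimal
  generating set lets them be taken over the prescribed \<open>G\<close>.\<close>

lemma has_SIFR_resolution:
  fixes \<Gamma> :: "(nat ^ 'r::finite) set"
  assumes "has_SIFR TYPE('k::field) \<Gamma>" and G: "minimally_generates G \<Gamma>"
  obtains S e and D :: "nat \<Rightarrow> ('r, 'k::field) fvec \<Rightarrow> ('r, 'k) fvec" and E where
    "minimal_resolution G S e D E" "\<And>n. incomparable G (S n) (e n)"
proof -
  obtain G' and F :: "('r, 'k) based_complex" where
    G': "minimally_generates G' \<Gamma>" "strongly_indispensable G' F"
    using assms(1) unfolding has_SIFR_def by blast
  have "G' = G" using G G'(1) by (simp add: minimally_generates_iff)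
  moreover have "0 \<notin> G" using G by (auto simp: minimally_generates_iff atoms_def)
  ultimately show thesis
    using that[of "\<lambda>j. {..<betti F j}" "bdeg F" "diff F" "aug F"] G'(2)
      strongly_indispensable_imp_incomparable[of G F]
    by (auto simp: strongly_indispensable_def graded_minimal_free_resolution_iff)
qed

text \<open>Restriction leaves fewer basis elements and fewer possible gaps \<open>g\<close>, so
  incomparability is inherited.\<close>

lemma has_SIFR_summand:
  fixes G1 G2 :: "(nat ^ 'r::finite) set"
  assumes m: "minimally_generates G1 (monoid_span G1)" "minimally_generates (G1 \<union> G2) (monoid_span (G1 \<union> G2))"
    and d: "direct G1 G2" and S: "has_SIFR TYPE('k::field) (monoid_span (G1 \<union> G2))"
  shows "has_SIFR TYPE('k) (monoid_span G1)"
proof -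
  obtain S e and D :: "nat \<Rightarrow> ('r, 'k) fvec \<Rightarrow> ('r, 'k) fvec" and E where
    R: "minimal_resolution (G1 \<union> G2) S e D E" and inc: "\<And>n. incomparable (G1 \<union> G2) (S n) (e n)"
    using has_SIFR_resolution[OF S m(2)] by blast
  have 0: "0 \<notin> G1" "0 \<notin> G2" using m(2) by (auto simp: minimally_generates_iff atoms_def)
  have "minimal_resolution G1 (\<lambda>j. {k \<in> S j. e j k \<in> monoid_span G1}) e D E"
    by (rule minimal_resolution.restrict[OF R refl 0(2) d])
  moreover have "incomparable G1 {k \<in> S n. e n k \<in> monoid_span G1} (e n)" for n
    using inc[of n] monoid_span_mono[of G1 "G1 \<union> G2"] unfolding incomparable_def by blast
  ultimately show ?thesis
    by (rule minimal_resolution.incomparable_imp_SIFR[OF _ m(1) 0(1)])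
qed

theorem theorem3p4:
  fixes \<Gamma>1 \<Gamma>2 \<Gamma> :: "(nat ^ 'r) set"
  assumes "affine_semigroup \<Gamma>1"
    and "affine_semigroup \<Gamma>2"
    and "is_join \<Gamma>1 \<Gamma>2 \<Gamma>"
  shows "has_SIFR TYPE('k::field) \<Gamma> \<longleftrightarrow> has_SIFR TYPE('k) \<Gamma>1 \<and> has_SIFR TYPE('k) \<Gamma>2"
proof -
  obtain G1 G2 where m: "minimally_generates G1 \<Gamma>1" "minimally_generates G2 \<Gamma>2"
    and d: "direct G1 G2" and \<Gamma>: "\<Gamma> = monoid_span (G1 \<union> G2)"
    using is_join_direct[OF assms(3)] by blast
  have s: "monoid_span G1 = \<Gamma>1" "monoid_span G2 = \<Gamma>2"
    using m by (auto simp: minimally_generates_def)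
  have mU: "minimally_generates (G1 \<union> G2) (monoid_span (G1 \<union> G2))"
    by (rule minimally_generates_Un[OF m d])
  show ?thesis
  proof (intro iffI conjI)
    assume S: "has_SIFR TYPE('k) \<Gamma>"
    show "has_SIFR TYPE('k) \<Gamma>1"
      using has_SIFR_summand[of G1 G2] m(1) mU d S by (simp add: s \<Gamma>)
    show "has_SIFR TYPE('k) \<Gamma>2"
      using has_SIFR_summand[of G2 G1] m(2) mU direct_sym[OF d] S by (simp add: s \<Gamma> Un_commute)
  next
    assume S: "has_SIFR TYPE('k) \<Gamma>1 \<and> has_SIFR TYPE('k) \<Gamma>2"
    obtain S1 e1 and D1 :: "nat \<Rightarrow> ('r, 'k) fvec \<Rightarrow> ('r, 'k) fvec" and E1 where
      R1: "minimal_resolution G1 S1 e1 D1 E1" and i1: "\<And>n. incomparable G1 (S1 n) (e1 n)"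
      using has_SIFR_resolution[OF conjunct1[OF S] m(1)] by blast
    obtain S2 e2 and D2 :: "nat \<Rightarrow> ('r, 'k) fvec \<Rightarrow> ('r, 'k) fvec" and E2 where
      R2: "minimal_resolution G2 S2 e2 D2 E2" and i2: "\<And>n. incomparable G2 (S2 n) (e2 n)"
      using has_SIFR_resolution[OF conjunct2[OF S] m(2)] by blast
    have 0: "0 \<notin> G1" "0 \<notin> G2" using m by (auto simp: minimally_generates_iff atoms_def)
    interpret resolution_pair G1 G2 S1 S2 e1 e2 D1 D2 E1 E2
      using R1 R2 d 0 by (simp add: resolution_pair_def resolution_pair_axioms_def)
    show "has_SIFR TYPE('k) \<Gamma>"
      using minimal_resolution.incomparable_imp_SIFR[OF tensor_resolution mU _ tensor_incomparable[OF i1 i2]] 0 \<Gamma>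
      by simp
  qed
qed

end
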